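(* Let $1\le\ell\le k$ be integers and let $(Z,\mathscr{Z},\mu)$ be a measure space with $\mu(Z)=1$. For each $i\in[\ell]$ let $\mathbf{X}^{(i)}=\{(X_0^{(i)}(z),X_1^{(i)}(z),\dots,X_k^{(i)}(z)):z\in Z\}$ be a Gaussian family such that for every $z\in Z$ the vector $(X^{(i)}_0(z),\dots,X^{(i)}_k(z))$ is a standard $(k+1)$-dimensional Gaussian vector; if $\ell\ge2$, assume that $\mathbf{X}^{(i_1)}$ and $\mathbf{X}^{(i_2)}$ are stochastically independent for all $i_1\ne i_2$. Let $\mathbf{X}_\star(z)=\{X^{(i)}_j(z):(i,j)\in[\ell]\times[k]\}\in\mathrm{Mat}_{\ell,k}(\mathbb{R})$. Let $\Phi_{\ell,k}:\mathrm{Mat}_{\ell,k}(\mathbb{R})\to\mathbb{R}_+$ satisfy Assumption A, with $\mathbb{E}[\Phi_{\ell,k}(\mathbf{X}_\star(z))^2]<\infty$ for every $z\in Z$, and set $\alpha_{\ell,k}:=\mathbb{E}[\Phi_{\ell,k}(\mathbf{X}_\star(z))]$. Put $$\mathbf{G}=\{(X_0^{(1)}(z),\dots,X_0^{(\ell)}(z)):z\in Z\},\quad G^{(i)}(z)=X_0^{(i)}(z),\quad W=\{W(z)=\Phi_{\ell,k}(\mathbf{X}_\star(z)):z\in Z\},$$ $$D^{(i)}=\frac1k\sum_{j=1}^k\int_Z X_j^{(i)}(z)^2\,\mu(dz)-\int_Z X_0^{(i)}(z)^2\,\mu(dz),\qquad m^{(i)}=\int_Z X_0^{(i)}(z)\,\mu(dz).$$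 (i) Fix $u^{(\ell)}=(u_1,\dots,u_\ell)\in\mathbb{R}^\ell$ and assume that $J=J(\mathbf{G},W;u^{(\ell)})$ is well-defined in $L^2(\mathbb{P})$. Then for every $q\ge0$, $$\mathrm{proj}_q(J)=\sum_{\substack{j_1,\dots,j_\ell,r\ge0\\ j_1+\dots+j_\ell+r=q}}\frac{\beta^{(u_1)}_{j_1}\cdots\beta^{(u_\ell)}_{j_\ell}}{j_1!\cdots j_\ell!}\int_Z\prod_{i=1}^\ell H_{j_i}(G^{(i)}(z))\cdot\mathrm{proj}_r(W(z))\,\mu(dz),$$ where $\beta^{(u)}_j=H_j(u)\gamma(u)$. In particular, $$\mathrm{proj}_0(J)=\mathbb{E}[J]=\alpha_{\ell,k}\prod_{i=1}^\ell\gamma(u_i),\qquad \mathrm{proj}_1(J)=\alpha_{\ell,k}\prod_{i=1}^\ell\gamma(u_i)\cdot\sum_{i=1}^\ell m^{(i)}u_i,$$ $$\mathrm{proj}_2(J)=\frac{\alpha_{\ell,k}}2\prod_{i=1}^\ell\gamma(u_i)\cdot\sum_{i=1}^\ell\left(u_i^2\int_Z(X_0^{(i)}(z)^2-1)\,\mu(dz)+D^{(i)}\right).$$ (ii) If (in the situation of (i)) $u_i=D^{(i)}=0$ for every $i\in[\ell]$, then $$\mathrm{proj}_0(J)=\mathbb{E}[J]=\frac{\alpha_{\ell,k}}{(2\pi)^{\ell/2}},\qquad \mathrm{proj}_{2q+1}(J)=\mathrm{proj}_2(J)=0\quad\text{for all } q\ge0.$$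
   Context: $[m]=\{1,\dots,m\}$; $\gamma(x)=(2\pi)^{-1/2}e^{-x^2/2}$; $H_j$ are the Hermite polynomials $H_0=1$, $H_j(x)=xH_{j-1}(x)-H_{j-1}'(x)$. Assumption A on $\Phi_{\ell,k}:\mathrm{Mat}_{\ell,k}(\mathbb{R})\to\mathbb{R}_+$: for every $\mathbf{X}\in\mathrm{Mat}_{\ell,k}(\mathbb{R})$, (A1) $\Phi_{\ell,k}(\mathbf{X})$ is invariant under permutations of the columns and of the rows of $\mathbf{X}$; (A2) for every $c\in\mathbb{R}$, multiplying any one row of $\mathbf{X}$ by $c$ multiplies $\Phi_{\ell,k}(\mathbf{X})$ by $|c|$; (A3) multiplying any one column of $\mathbf{X}$ by $-1$ leaves $\Phi_{\ell,k}(\mathbf{X})$ unchanged; (A4) if $\ell\ge2$, replacing the $i_1$-th row by the sum of the $i_1$-th and $i_2$-th rows ($i_1\ne i_2$) leaves $\Phi_{\ell,k}(\mathbf{X})$ unchanged. For a field $\mathbf{G}=(G^{(1)},\dots,G^{(\ell)})$ and a random field $W$ indexed by $Z$, and $u^{(\ell)}\in\mathbb{R}^\ell$, $$J(\mathbf{G},W;u^{(\ell)}):=\lim_{\varepsilon\to0}\int_Z(2\varepsilon)^{-\ell}\prod_{i=1}^\ell\mathbf{1}_{[-\varepsilon,\varepsilon]}(G^{(i)}(z)-u_i)\,W(z)\,\mu(dz)$$ whenever the limit exists $\mathbb{P}$-almost surely; $J$ is said to be well-defined in $L^2(\mathbb{P})$ when the limit exists in $L^2(\mathbb{P})$. Wiener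 chaos: let $\mathbb{G}$ be the $L^2(\mathbb{P})$-closure of the linear span of the Gaussian random variables $X^{(i)}_j(z)$, $i\in[\ell]$, $0\le j\le k$, $z\in Z$. The $q$-th Wiener chaos is the $L^2(\mathbb{P})$-closure of the span of all products $\prod_{a=1}^mH_{q_a}(Y_a)$ with $m\ge 1$, $q_1+\dots+q_m=q$ and $(Y_1,\dots,Y_m)$ a standard Gaussian vector extracted from $\mathbb{G}$; $\mathrm{proj}_q$ is the orthogonal projection of $L^2(\Omega,\sigma(\mathbb{G}),\mathbb{P})$ onto the $q$-th Wiener chaos.
   Formalization: The printed proj_2(J) omits, for ℓ≥2, the term (α/2)∏γ(u_i)·Σ_{i1≠i2} u_{i1}u_{i2}∫X_0^{(i1)}X_0^{(i2)}dμ, which is added here; the families X^{(i)} are taken mutually independent, the fields jointly measurable and Φ Borel. *)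

theory Defs
  imports "HOL-Probability.Probability" "HOL-Computational_Algebra.Polynomial"
begin

section \<open>Hermite polynomials\<close>

fun hermite :: "nat \<Rightarrow> real poly" where
  "hermite 0 = 1"
| "hermite (Suc j) = [:0, 1:] * hermite j - pderiv (hermite j)"

definition hermite_coeff :: "real \<Rightarrow> nat \<Rightarrow> real" where
  "hermite_coeff u j = poly (hermite j) u * std_normal_density u"

section \<open>Homogeneous matrix functionals\<close>

definition assumption_A :: "(real ^ 'k ^ 'l \<Rightarrow> real) \<Rightarrow> bool" where
  "assumption_A \<Phi> \<longleftrightarrow>
     (\<forall>A. 0 \<le> \<Phi> A) \<and>
     (\<forall>A \<pi> \<tau>. bij \<pi> \<longrightarrow> bij \<tau> \<longrightarrow> \<Phi> (\<chi> i j. A $ \<pi> i $ \<tau> j) = \<Phi> A) \<and>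
     (\<forall>A c i0. \<Phi> (\<chi> i j. if i = i0 then c * A $ i $ j else A $ i $ j) = \<bar>c\<bar> * \<Phi> A) \<and>
     (\<forall>A j0. \<Phi> (\<chi> i j. if j = j0 then - A $ i $ j else A $ i $ j) = \<Phi> A) \<and>
     (\<forall>A i1 i2. i1 \<noteq> i2 \<longrightarrow>
        \<Phi> (\<chi> i j. if i = i1 then A $ i1 $ j + A $ i2 $ j else A $ i $ j) = \<Phi> A)"

section \<open>Gaussian vectors and Gaussian families\<close>

text \<open>Degenerate (almost surely constant) variables count as Gaussian.\<close>

definition gaussian_rv :: "'w measure \<Rightarrow> ('w \<Rightarrow> real) \<Rightarrow> bool" where
  "gaussian_rv M Y \<longleftrightarrow> Y \<in> borel_measurable M \<and>
     ((\<exists>m s. s > 0 \<and> distributed M lborel Y (normal_density m s)) \<or>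
      (\<exists>m. AE \<omega> in M. Y \<omega> = m))"

definition gaussian_family :: "'w measure \<Rightarrow> 't set \<Rightarrow> ('t \<Rightarrow> 'w \<Rightarrow> real) \<Rightarrow> bool" where
  "gaussian_family M T Y \<longleftrightarrow>
     (\<forall>S c. finite S \<and> S \<subseteq> T \<longrightarrow> gaussian_rv M (\<lambda>\<omega>. \<Sum>t\<in>S. c t * Y t \<omega>))"

definition std_gaussian_vector :: "'w measure \<Rightarrow> 't set \<Rightarrow> ('t \<Rightarrow> 'w \<Rightarrow> real) \<Rightarrow> bool" where
  "std_gaussian_vector M T Y \<longleftrightarrow> finite T \<and>
     prob_space.indep_vars M (\<lambda>_. borel) Y T \<and>
     (\<forall>t\<in>T. distributed M lborel (Y t) std_normal_density)"

section \<open>Square integrable random variables\<close>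

text \<open>Elements of \<open>L\<^sup>2\<close> are represented by functions. Closed subspaces are represented by the set
  of all their representatives, so that they are saturated under almost sure equality.\<close>

definition L2_space :: "'w measure \<Rightarrow> ('w \<Rightarrow> real) set" where
  "L2_space M = {f \<in> borel_measurable M. integrable M (\<lambda>\<omega>. (f \<omega>)\<^sup>2)}"

definition lin_span :: "('w \<Rightarrow> real) set \<Rightarrow> ('w \<Rightarrow> real) set" where
  "lin_span S = {\<lambda>\<omega>. \<Sum>f\<in>T. c f * f \<omega> | T c. finite T \<and> T \<subseteq> S}"

definition L2_closure :: "'w measure \<Rightarrow> ('w \<Rightarrow> real) set \<Rightarrow> ('w \<Rightarrow> real) set" where
  "L2_closure M S = {f \<in> L2_space M.
     \<forall>e>0. \<exists>g \<in> S \<inter> L2_space M. (\<integral>\<omega>. (f \<omega> - g \<omega>)\<^sup>2 \<partial>M) < e}"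

definition L2_tendsto ::
  "'w measure \<Rightarrow> ('e \<Rightarrow> 'w \<Rightarrow> real) \<Rightarrow> ('w \<Rightarrow> real) \<Rightarrow> 'e filter \<Rightarrow> bool" where
  "L2_tendsto M f g F \<longleftrightarrow> g \<in> L2_space M \<and> eventually (\<lambda>e. f e \<in> L2_space M) F \<and>
     ((\<lambda>e. \<integral>\<omega>. (f e \<omega> - g \<omega>)\<^sup>2 \<partial>M) \<longlongrightarrow> 0) F"

section \<open>Wiener chaos\<close>

text \<open>In a family \<open>X i c z\<close> the index \<open>c\<close> ranges over \<open>'k option\<close>, which encodes
  \<open>{0, \<dots>, k}\<close>: the value \<open>None\<close> stands for \<open>0\<close> and the values \<open>Some j\<close> for \<open>1, \<dots>, k\<close>.\<close>

definition gauss_space ::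
  "'w measure \<Rightarrow> 'z measure \<Rightarrow> ('l \<Rightarrow> 'k option \<Rightarrow> 'z \<Rightarrow> 'w \<Rightarrow> real) \<Rightarrow> ('w \<Rightarrow> real) set" where
  "gauss_space M N X = L2_closure M (lin_span {X i c z | i c z. z \<in> space N})"

text \<open>When \<open>\<GG>\<close> is an \<open>L\<^sup>2\<close>-closed subspace, it contains the indicator functions of the null sets,
  so that this \<open>\<sigma>\<close>-algebra is complete relative to \<open>M\<close>.\<close>

definition gauss_sigma :: "'w measure \<Rightarrow> ('w \<Rightarrow> real) set \<Rightarrow> 'w measure" where
  "gauss_sigma M \<GG> = sigma (space M) {f -` A \<inter> space M | f A. f \<in> \<GG> \<and> A \<in> sets borel}"

definition wiener_chaos :: "'w measure \<Rightarrow> ('w \<Rightarrow> real) set \<Rightarrow> nat \<Rightarrow> ('w \<Rightarrow> real) set" where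
  "wiener_chaos M \<GG> q = L2_closure M (lin_span
     {\<lambda>\<omega>. \<Prod>a<m. poly (hermite (d a)) (Y a \<omega>) | (m::nat) d Y.
        1 \<le> m \<and> (\<Sum>a<m. d a) = q \<and> (\<forall>a<m. Y a \<in> \<GG>) \<and> std_gaussian_vector M {..<m} Y})"

text \<open>\<open>is_chaos_proj M \<GG> q F R\<close>: the random variable \<open>F\<close> lies in \<open>L\<^sup>2(\<Omega>, \<sigma>(\<GG>), P)\<close>, and \<open>R\<close>
  represents its orthogonal projection onto the \<open>q\<close>-th chaos. It determines \<open>R\<close> up to almost sure
  equality.\<close>

definition is_chaos_proj ::
  "'w measure \<Rightarrow> ('w \<Rightarrow> real) set \<Rightarrow> nat \<Rightarrow> ('w \<Rightarrow> real) \<Rightarrow> ('w \<Rightarrow> real) \<Rightarrow> bool" where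
  "is_chaos_proj M \<GG> q F R \<longleftrightarrow>
     F \<in> L2_space M \<and> F \<in> borel_measurable (gauss_sigma M \<GG>) \<and>
     R \<in> wiener_chaos M \<GG> q \<and>
     (\<forall>Y \<in> wiener_chaos M \<GG> q. (\<integral>\<omega>. (F \<omega> - R \<omega>) * Y \<omega> \<partial>M) = 0)"

text \<open>A jointly measurable version of the field of projections of \<open>W z\<close>. It makes pathwise integrals
  over \<open>z\<close> meaningful, each single projection being defined only up to a null set.\<close>

definition is_chaos_proj_field ::
  "'w measure \<Rightarrow> 'z measure \<Rightarrow> ('w \<Rightarrow> real) set \<Rightarrow> nat \<Rightarrow>
     ('z \<Rightarrow> 'w \<Rightarrow> real) \<Rightarrow> ('z \<Rightarrow> 'w \<Rightarrow> real) \<Rightarrow> bool" where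
  "is_chaos_proj_field M N \<GG> r W V \<longleftrightarrow>
     (\<lambda>(z, \<omega>). V z \<omega>) \<in> borel_measurable (N \<Otimes>\<^sub>M M) \<and>
     (\<forall>z\<in>space N. is_chaos_proj M \<GG> r (W z) (V z))"

section \<open>The functionals\<close>

definition J_approx ::
  "'z measure \<Rightarrow> ('l::finite \<Rightarrow> 'z \<Rightarrow> 'w \<Rightarrow> real) \<Rightarrow> ('z \<Rightarrow> 'w \<Rightarrow> real) \<Rightarrow> ('l \<Rightarrow> real) \<Rightarrow>
     real \<Rightarrow> 'w \<Rightarrow> real" where
  "J_approx N G W u \<epsilon> \<omega> =
     (\<integral>z. inverse ((2 * \<epsilon>) ^ CARD('l)) *
        (\<Prod>i\<in>UNIV. indicator {-\<epsilon>..\<epsilon>} (G i z \<omega> - u i)) * W z \<omega> \<partial>N)"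

definition X_star :: "('l \<Rightarrow> 'k option \<Rightarrow> 'z \<Rightarrow> 'w \<Rightarrow> real) \<Rightarrow> 'z \<Rightarrow> 'w \<Rightarrow> real ^ 'k ^ 'l" where
  "X_star X z \<omega> = (\<chi> i j. X i (Some j) z \<omega>)"

definition D_field ::
  "'z measure \<Rightarrow> ('l \<Rightarrow> 'k::finite option \<Rightarrow> 'z \<Rightarrow> 'w \<Rightarrow> real) \<Rightarrow> 'l \<Rightarrow> 'w \<Rightarrow> real" where
  "D_field N X i \<omega> =
     1 / real CARD('k) * (\<Sum>j\<in>UNIV. \<integral>z. (X i (Some j) z \<omega>)\<^sup>2 \<partial>N) - (\<integral>z. (X i None z \<omega>)\<^sup>2 \<partial>N)"

definition m_field ::
  "'z measure \<Rightarrow> ('l \<Rightarrow> 'k option \<Rightarrow> 'z \<Rightarrow> 'w \<Rightarrow> real) \<Rightarrow> 'l \<Rightarrow> 'w \<Rightarrow> real" where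
  "m_field N X i \<omega> = (\<integral>z. X i None z \<omega> \<partial>N)"

end

theory Submission
  imports Defs
begin

text \<open>The vectors \<open>\<xi> z\<close> of all \<open>X i c z\<close> are standard Gaussian, hence have the same law. The pairing of a
  product of Hermite polynomials in jointly Gaussian variables with the characters of \<open>\<xi> z\<close> is a
  homogeneous polynomial times a Gaussian factor, so Fourier uniqueness shows that the projection of
  \<open>F (\<xi> z)\<close> onto the \<open>q\<close>-th chaos is the degree \<open>q\<close> part of the Hermite expansion of \<open>F\<close>, whose
  coefficients do not depend on \<open>z\<close>. Averaging over \<open>z\<close> and letting the window shrink, the Hermite
  coefficients of the indicators converge to \<open>H\<^sub>j(u) \<gamma>(u)\<close>. In degrees \<open>0, 1, 2\<close> the coefficients of
  \<open>\<Phi>\<close> follow from its symmetries; the only nontrivial one, \<open>\<alpha> / k\<close>, comes from homogeneity in a row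
  by differentiating a Gaussian tilt.\<close>

section \<open>Square integrable functions\<close>

text \<open>The chaos is generated by all of \<open>\<GG>\<close>, so its generators involve
  variables at other points and are in general not functions of \<open>\<xi> z\<close>. A function
  of \<open>\<xi> z\<close> sees a generator only through covariances with \<open>\<xi> z\<close>;
  this is what lets \<open>chaos_kernel\<close> trade a generator of degree q for a Hermite
  polynomial of degree q in \<open>\<xi> z\<close> itself. A projection is certified by two facts,
  membership in the chaos and orthogonality of the remainder, and the limit over windows is taken
  only in pairings with a fixed element of the chaos. Integrals over z are pathwise, which creates
  two obligations: averages of chaos elements must stay in the closed chaos, and the limit must be
  measurable for the \<sigma>-algebra of \<open>\<GG>\<close>, although the field is jointly
  measurable only for the full \<sigma>-algebra of \<open>M\<close>. The value \<alpha> / k arises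
  thus: the tilt gives (k + 1) \<alpha> for the mean of \<Phi> times a squared row norm, centring
  the k squares removes k \<alpha>, and column symmetry shares the remaining \<alpha> equally among
  k coordinates.\<close>

lemma L2_spaceD:
  assumes "f \<in> L2_space M"
  shows "f \<in> borel_measurable M" "integrable M (\<lambda>\<omega>. (f \<omega>)\<^sup>2)"
  using assms by (auto simp: L2_space_def)

lemma L2_mult_integrable:
  assumes "f \<in> L2_space M" "g \<in> L2_space M"
  shows "integrable M (\<lambda>\<omega>. f \<omega> * g \<omega>)"
proof (rule Bochner_Integration.integrable_bound)
  show "integrable M (\<lambda>\<omega>. (f \<omega>)\<^sup>2 + (g \<omega>)\<^sup>2)"
    using assms by (auto dest: L2_spaceD)
  have "\<bar>a * b\<bar> \<le> a\<^sup>2 + b\<^sup>2" for a b :: real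
  proof -
    have "0 \<le> (\<bar>a\<bar> - \<bar>b\<bar>)\<^sup>2" by simp
    then have "2 * (\<bar>a\<bar> * \<bar>b\<bar>) \<le> a\<^sup>2 + b\<^sup>2" by (simp add: power2_diff)
    moreover have "0 \<le> \<bar>a\<bar> * \<bar>b\<bar>" by simp
    ultimately show ?thesis unfolding abs_mult by linarith
  qed
  then show "AE \<omega> in M. norm (f \<omega> * g \<omega>) \<le> norm ((f \<omega>)\<^sup>2 + (g \<omega>)\<^sup>2)"
    by simp
qed (use assms in \<open>auto dest!: L2_spaceD(1)\<close>)

lemma L2_lincomb:
  assumes f: "f \<in> L2_space M" and g: "g \<in> L2_space M"
  shows "(\<lambda>\<omega>. a * f \<omega> + b * g \<omega>) \<in> L2_space M"
proof -
  have "integrable M (\<lambda>\<omega>. a\<^sup>2 * (f \<omega>)\<^sup>2 + b\<^sup>2 * (g \<omega>)\<^sup>2 + 2 * a * b * (f \<omega> * g \<omega>))"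
    using L2_mult_integrable[OF f g] L2_spaceD[OF f] L2_spaceD[OF g] by auto
  moreover have "(\<lambda>\<omega>. a\<^sup>2 * (f \<omega>)\<^sup>2 + b\<^sup>2 * (g \<omega>)\<^sup>2 + 2 * a * b * (f \<omega> * g \<omega>)) =
      (\<lambda>\<omega>. (a * f \<omega> + b * g \<omega>)\<^sup>2)"
    by (auto simp: power2_eq_square algebra_simps)
  ultimately show ?thesis
    using L2_spaceD(1)[OF f] L2_spaceD(1)[OF g] by (auto simp: L2_space_def)
qed

lemma L2_diff: "f \<in> L2_space M \<Longrightarrow> g \<in> L2_space M \<Longrightarrow> (\<lambda>\<omega>. f \<omega> - g \<omega>) \<in> L2_space M"
  using L2_lincomb[of f M g 1 "-1"] by simp

lemma L2_zero: "(\<lambda>_. 0) \<in> L2_space M"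
  by (simp add: L2_space_def)

lemma L2_sum:
  "finite I \<Longrightarrow> (\<And>i. i \<in> I \<Longrightarrow> f i \<in> L2_space M) \<Longrightarrow> (\<lambda>\<omega>. \<Sum>i\<in>I. c i * f i \<omega>) \<in> L2_space M"
proof (induction I rule: finite_induct)
  case (insert i I)
  then show ?case using L2_lincomb[of "f i" M "\<lambda>\<omega>. \<Sum>i\<in>I. c i * f i \<omega>" "c i" 1] by simp
qed (simp add: L2_zero)

lemma (in finite_measure) L2_const: "(\<lambda>_. c) \<in> L2_space M"
  by (simp add: L2_space_def)

lemma (in finite_measure) L2_integrable: "f \<in> L2_space M \<Longrightarrow> integrable M f"
  using L2_mult_integrable[OF _ L2_const[of 1], of f] by simp

lemma L2_AE_cong:
  assumes "f \<in> L2_space M" "g \<in> borel_measurable M" "AE \<omega> in M. f \<omega> = g \<omega>"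
  shows "g \<in> L2_space M"
proof -
  have "integrable M (\<lambda>\<omega>. (g \<omega>)\<^sup>2)"
    using assms by (subst integrable_cong_AE[where g="\<lambda>\<omega>. (f \<omega>)\<^sup>2"]) (auto dest: L2_spaceD)
  then show ?thesis using assms by (simp add: L2_space_def)
qed

lemma L2_norm_zero_AE:
  assumes "f \<in> L2_space M" "(\<integral>\<omega>. (f \<omega>)\<^sup>2 \<partial>M) = 0"
  shows "AE \<omega> in M. f \<omega> = 0"
  using integral_nonneg_eq_0_iff_AE[of M "\<lambda>\<omega>. (f \<omega>)\<^sup>2"] assms L2_spaceD[OF assms(1)] by auto

lemma L2_Cauchy_Schwarz:
  assumes f: "f \<in> L2_space M" and g: "g \<in> L2_space M"
  shows "(\<integral>\<omega>. f \<omega> * g \<omega> \<partial>M)\<^sup>2 \<le> (\<integral>\<omega>. (f \<omega>)\<^sup>2 \<partial>M) * (\<integral>\<omega>. (g \<omega>)\<^sup>2 \<partial>M)"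
proof (cases "(\<integral>\<omega>. (g \<omega>)\<^sup>2 \<partial>M) = 0")
  case True
  have "AE \<omega> in M. g \<omega> = 0"
    using L2_norm_zero_AE[OF g True] .
  then have "(\<integral>\<omega>. f \<omega> * g \<omega> \<partial>M) = (\<integral>\<omega>. 0 \<partial>M)"
    using L2_spaceD(1)[OF f] L2_spaceD(1)[OF g] by (intro integral_cong_AE) auto
  then show ?thesis using True by simp
next
  case False
  define B where "B = (\<integral>\<omega>. (g \<omega>)\<^sup>2 \<partial>M)"
  define C where "C = (\<integral>\<omega>. f \<omega> * g \<omega> \<partial>M)"
  \<comment> \<open>The minimiser of the quadratic t |-> ||f - t g||^2.\<close>
  define t where "t = C / B"
  have B: "B > 0"
    using False zero_le_power2 by (simp add: B_def less_le)
  have "0 \<le> (\<integral>\<omega>. (f \<omega> - t * g \<omega>)\<^sup>2 \<partial>M)" by simp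
  also have "\<dots> = (\<integral>\<omega>. (f \<omega>)\<^sup>2 + t\<^sup>2 * (g \<omega>)\<^sup>2 - 2 * t * (f \<omega> * g \<omega>) \<partial>M)"
    by (intro Bochner_Integration.integral_cong refl) (simp add: power2_eq_square algebra_simps)
  also have "\<dots> = (\<integral>\<omega>. (f \<omega>)\<^sup>2 \<partial>M) + t\<^sup>2 * B - 2 * t * C"
    using L2_mult_integrable[OF f g] L2_spaceD[OF f] L2_spaceD[OF g] by (simp add: B_def C_def)
  also have "\<dots> = (\<integral>\<omega>. (f \<omega>)\<^sup>2 \<partial>M) - C\<^sup>2 / B"
    using B by (simp add: t_def field_simps power2_eq_square)
  finally show ?thesis using B by (simp add: B_def C_def field_simps)
qed

text \<open>Stands in for the triangle inequality when distances are kept squared, via (x + y)^2 <=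
  2 x^2 + 2 y^2. Its factors 2 dictate the constants in the closure arguments.\<close>

lemma L2_sum_norm_le:
  assumes f: "f \<in> L2_space M" and g: "g \<in> L2_space M"
  shows "(\<integral>\<omega>. (a * f \<omega> + b * g \<omega>)\<^sup>2 \<partial>M) \<le>
    2 * a\<^sup>2 * (\<integral>\<omega>. (f \<omega>)\<^sup>2 \<partial>M) + 2 * b\<^sup>2 * (\<integral>\<omega>. (g \<omega>)\<^sup>2 \<partial>M)"
proof -
  have *: "(x + y)\<^sup>2 \<le> 2 * x\<^sup>2 + 2 * y\<^sup>2" for x y :: real
    using zero_le_power2[of "x - y"] by (simp add: power2_sum power2_diff)
  have "(\<integral>\<omega>. (a * f \<omega> + b * g \<omega>)\<^sup>2 \<partial>M) \<le>
      (\<integral>\<omega>. 2 * a\<^sup>2 * (f \<omega>)\<^sup>2 + 2 * b\<^sup>2 * (g \<omega>)\<^sup>2 \<partial>M)"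
  proof (intro integral_mono)
    fix \<omega>
    show "(a * f \<omega> + b * g \<omega>)\<^sup>2 \<le> 2 * a\<^sup>2 * (f \<omega>)\<^sup>2 + 2 * b\<^sup>2 * (g \<omega>)\<^sup>2"
      using *[of "a * f \<omega>" "b * g \<omega>"] by (simp add: power_mult_distrib)
  qed (use L2_spaceD[OF f] L2_spaceD[OF g] L2_spaceD[OF L2_lincomb[OF f g, of a b]] in simp_all)
  then show ?thesis using L2_spaceD[OF f] L2_spaceD[OF g] by simp
qed

text \<open>Strong convergence implies weak convergence, by Cauchy-Schwarz. The limit
  \<open>J\<close> is identified through such pairings.\<close>

lemma L2_tendsto_integral_mult:
  assumes lim: "L2_tendsto M f g F" and h: "h \<in> L2_space M"
  shows "((\<lambda>e. \<integral>\<omega>. f e \<omega> * h \<omega> \<partial>M) \<longlongrightarrow> (\<integral>\<omega>. g \<omega> * h \<omega> \<partial>M)) F"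
proof -
  define B where "B = (\<integral>\<omega>. (h \<omega>)\<^sup>2 \<partial>M)"
  have ev: "eventually (\<lambda>e. f e \<in> L2_space M) F" and g: "g \<in> L2_space M"
    and l: "((\<lambda>e. \<integral>\<omega>. (f e \<omega> - g \<omega>)\<^sup>2 \<partial>M) \<longlongrightarrow> 0) F"
    using lim by (auto simp: L2_tendsto_def)
  have "((\<lambda>e. sqrt ((\<integral>\<omega>. (f e \<omega> - g \<omega>)\<^sup>2 \<partial>M) * B)) \<longlongrightarrow> sqrt (0 * B)) F"
    by (intro tendsto_intros l)
  then have l': "((\<lambda>e. sqrt ((\<integral>\<omega>. (f e \<omega> - g \<omega>)\<^sup>2 \<partial>M) * B)) \<longlongrightarrow> 0) F"
    by simp
  have "eventually (\<lambda>e. norm ((\<integral>\<omega>. f e \<omega> * h \<omega> \<partial>M) - (\<integral>\<omega>. g \<omega> * h \<omega> \<partial>M))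
      \<le> sqrt ((\<integral>\<omega>. (f e \<omega> - g \<omega>)\<^sup>2 \<partial>M) * B)) F"
    using ev
  proof eventually_elim
    case (elim e)
    have "(\<integral>\<omega>. f e \<omega> * h \<omega> \<partial>M) - (\<integral>\<omega>. g \<omega> * h \<omega> \<partial>M) = (\<integral>\<omega>. (f e \<omega> - g \<omega>) * h \<omega> \<partial>M)"
      using L2_mult_integrable[OF elim h] L2_mult_integrable[OF g h]
      by (simp add: left_diff_distrib)
    then show ?case
      using real_sqrt_le_mono[OF L2_Cauchy_Schwarz[OF L2_diff[OF elim g] h]]
      by (simp add: B_def)
  qed
  from Lim_null_comparison[OF this l'] show ?thesis
    by (rule LIM_zero_cancel)
qed

section \<open>Linear spans and their L2 closures\<close>

lemma lin_span_lincomb: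
  assumes "f \<in> lin_span S" "g \<in> lin_span S"
  shows "(\<lambda>\<omega>. a * f \<omega> + b * g \<omega>) \<in> lin_span S"
proof -
  obtain T c T' c' where f: "f = (\<lambda>\<omega>. \<Sum>h\<in>T. c h * h \<omega>)" "finite T" "T \<subseteq> S"
    and g: "g = (\<lambda>\<omega>. \<Sum>h\<in>T'. c' h * h \<omega>)" "finite T'" "T' \<subseteq> S"
    using assms unfolding lin_span_def by blast
  define d where "d h = a * (if h \<in> T then c h else 0) + b * (if h \<in> T' then c' h else 0)" for h
  have "(\<Sum>h\<in>T \<union> T'. d h * h \<omega>) = a * f \<omega> + b * g \<omega>" for \<omega>
  proof -
    have "(\<Sum>h\<in>T \<union> T'. (if h \<in> T then c h else 0) * h \<omega>) = f \<omega>"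
      unfolding f(1) using f g by (intro sum.mono_neutral_cong_right) auto
    moreover have "(\<Sum>h\<in>T \<union> T'. (if h \<in> T' then c' h else 0) * h \<omega>) = g \<omega>"
      unfolding g(1) using f g by (intro sum.mono_neutral_cong_right) auto
    moreover have "(\<Sum>h\<in>T \<union> T'. d h * h \<omega>) =
       a * (\<Sum>h\<in>T \<union> T'. (if h \<in> T then c h else 0) * h \<omega>) +
       b * (\<Sum>h\<in>T \<union> T'. (if h \<in> T' then c' h else 0) * h \<omega>)"
      unfolding d_def by (simp add: sum_distrib_left sum.distrib distrib_right mult.assoc)
    ultimately show ?thesis by simp
  qed
  then have "(\<lambda>\<omega>. a * f \<omega> + b * g \<omega>) = (\<lambda>\<omega>. \<Sum>h\<in>T \<union> T'. d h * h \<omega>)" by simp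
  then show ?thesis
    using f g unfolding lin_span_def by (intro CollectI exI[of _ "T \<union> T'"] exI[of _ d]) auto
qed

lemma lin_span_superset: "f \<in> S \<Longrightarrow> f \<in> lin_span S"
  unfolding lin_span_def by (intro CollectI exI[of _ "{f}"] exI[of _ "\<lambda>_. 1"]) auto

lemma L2_closure_superset: "f \<in> S \<Longrightarrow> f \<in> L2_space M \<Longrightarrow> f \<in> L2_closure M S"
  by (auto simp: L2_closure_def intro!: bexI[of _ f])

lemma L2_closure_AE_cong:
  assumes f: "f \<in> L2_closure M S" and g: "g \<in> borel_measurable M" and ae: "AE \<omega> in M. f \<omega> = g \<omega>"
  shows "g \<in> L2_closure M S"
proof -
  have fL: "f \<in> L2_space M" using f by (auto simp: L2_closure_def)
  have gL: "g \<in> L2_space M" by (rule L2_AE_cong[OF fL g ae])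
  have "(\<integral>\<omega>. (g \<omega> - h \<omega>)\<^sup>2 \<partial>M) = (\<integral>\<omega>. (f \<omega> - h \<omega>)\<^sup>2 \<partial>M)" if "h \<in> L2_space M" for h
    using ae g L2_spaceD(1)[OF that] L2_spaceD(1)[OF fL] by (intro integral_cong_AE) auto
  then show ?thesis using f gL unfolding L2_closure_def by auto
qed

lemma L2_closure_closed:
  assumes f: "f \<in> L2_space M"
    and approx: "\<And>e. e > 0 \<Longrightarrow> \<exists>g\<in>L2_closure M S. (\<integral>\<omega>. (f \<omega> - g \<omega>)\<^sup>2 \<partial>M) < e"
  shows "f \<in> L2_closure M S"
  unfolding L2_closure_def
proof (intro CollectI conjI f allI impI)
  fix e :: real assume "e > 0"
  \<comment> \<open>Two errors below e / 4, each doubled by \<open>L2_sum_norm_le\<close>, add up to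
    less than e.\<close>
  then obtain g where g: "g \<in> L2_closure M S" "(\<integral>\<omega>. (f \<omega> - g \<omega>)\<^sup>2 \<partial>M) < e / 4"
    using approx[of "e / 4"] by auto
  then obtain h where h: "h \<in> S \<inter> L2_space M" "(\<integral>\<omega>. (g \<omega> - h \<omega>)\<^sup>2 \<partial>M) < e / 4"
    using \<open>e > 0\<close> unfolding L2_closure_def
    by (elim CollectE conjE allE[of _ "e / 4"]) auto
  have gL: "g \<in> L2_space M" using g by (auto simp: L2_closure_def)
  have "(\<integral>\<omega>. (f \<omega> - h \<omega>)\<^sup>2 \<partial>M) = (\<integral>\<omega>. (1 * (f \<omega> - g \<omega>) + 1 * (g \<omega> - h \<omega>))\<^sup>2 \<partial>M)"
    by simp
  also have "\<dots> \<le> 2 * 1\<^sup>2 * (\<integral>\<omega>. (f \<omega> - g \<omega>)\<^sup>2 \<partial>M) + 2 * 1\<^sup>2 * (\<integral>\<omega>. (g \<omega> - h \<omega>)\<^sup>2 \<partial>M)"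
    using h by (intro L2_sum_norm_le L2_diff f gL) auto
  also have "\<dots> < e" using g h by simp
  finally show "\<exists>h\<in>S \<inter> L2_space M. (\<integral>\<omega>. (f \<omega> - h \<omega>)\<^sup>2 \<partial>M) < e" using h by blast
qed

lemma L2_closure_span_lincomb:
  assumes f: "f \<in> L2_closure M (lin_span S)" and g: "g \<in> L2_closure M (lin_span S)"
  shows "(\<lambda>\<omega>. a * f \<omega> + b * g \<omega>) \<in> L2_closure M (lin_span S)"
proof -
  have fL: "f \<in> L2_space M" and gL: "g \<in> L2_space M" using f g by (auto simp: L2_closure_def)
  show ?thesis
    unfolding L2_closure_def
  proof (intro CollectI conjI L2_lincomb fL gL allI impI)
    fix e :: real assume e: "e > 0"
    \<comment> \<open>The summands 1 keep the denominator positive even for a = b = 0 and make the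
      final comparison with e strict.\<close>
    define e' where "e' = e / (2 * (2 * a\<^sup>2 + 1) + 2 * (2 * b\<^sup>2 + 1))"
    have pos: "2 * (2 * a\<^sup>2 + 1) + 2 * (2 * b\<^sup>2 + 1) > 0"
      by (intro add_pos_pos mult_pos_pos add_nonneg_pos) auto
    then have e': "e' > 0" using e by (simp add: e'_def)
    obtain f' where f': "f' \<in> lin_span S" "f' \<in> L2_space M" "(\<integral>\<omega>. (f \<omega> - f' \<omega>)\<^sup>2 \<partial>M) < e'"
      using f e' unfolding L2_closure_def by auto
    obtain g' where g': "g' \<in> lin_span S" "g' \<in> L2_space M" "(\<integral>\<omega>. (g \<omega> - g' \<omega>)\<^sup>2 \<partial>M) < e'"
      using g e' unfolding L2_closure_def by auto
    have "(\<integral>\<omega>. (a * f \<omega> + b * g \<omega> - (a * f' \<omega> + b * g' \<omega>))\<^sup>2 \<partial>M) =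
      (\<integral>\<omega>. (a * (f \<omega> - f' \<omega>) + b * (g \<omega> - g' \<omega>))\<^sup>2 \<partial>M)"
      by (simp add: algebra_simps)
    also have "\<dots> \<le> 2 * a\<^sup>2 * (\<integral>\<omega>. (f \<omega> - f' \<omega>)\<^sup>2 \<partial>M) + 2 * b\<^sup>2 * (\<integral>\<omega>. (g \<omega> - g' \<omega>)\<^sup>2 \<partial>M)"
      by (intro L2_sum_norm_le L2_diff fL gL f' g')
    also have "\<dots> \<le> 2 * a\<^sup>2 * e' + 2 * b\<^sup>2 * e'"
      using f' g' by (intro add_mono mult_left_mono) auto
    also have "\<dots> < (2 * (2 * a\<^sup>2 + 1) + 2 * (2 * b\<^sup>2 + 1)) * e'"
      using e' by (simp add: algebra_simps add_pos_nonneg)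
    also have "\<dots> = e" using pos by (simp add: e'_def)
    finally show "\<exists>h\<in>lin_span S \<inter> L2_space M. (\<integral>\<omega>. (a * f \<omega> + b * g \<omega> - h \<omega>)\<^sup>2 \<partial>M) < e"
      using lin_span_lincomb[OF f'(1) g'(1), of a b] L2_lincomb[OF f'(2) g'(2), of a b]
      by (intro bexI[of _ "\<lambda>\<omega>. a * f' \<omega> + b * g' \<omega>"] IntI)
  qed
qed

lemma zero_in_lin_span: "(\<lambda>_. 0) \<in> lin_span S"
  unfolding lin_span_def by (intro CollectI exI[of _ "{}"]) auto

lemma zero_in_L2_closure_span: "(\<lambda>_. 0) \<in> L2_closure M (lin_span S)"
  by (intro L2_closure_superset L2_zero zero_in_lin_span)

lemma L2_closure_span_sum:
  assumes "finite I" "\<And>i. i \<in> I \<Longrightarrow> f i \<in> L2_closure M (lin_span S)"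
  shows "(\<lambda>\<omega>. \<Sum>i\<in>I. c i * f i \<omega>) \<in> L2_closure M (lin_span S)"
  using assms
proof (induction I rule: finite_induct)
  case (insert i I)
  then show ?case
    using L2_closure_span_lincomb[of "f i" M S "\<lambda>\<omega>. \<Sum>i\<in>I. c i * f i \<omega>" "c i" 1] by simp
qed (simp add: zero_in_L2_closure_span)

text \<open>Linearity carries orthogonality from the generators to their span. For the closure,
  Cauchy-Schwarz bounds the squared pairing by ||h||^2 e for every positive e.\<close>

lemma L2_closure_span_orthogonal:
  assumes S: "S \<subseteq> L2_space M" and h: "h \<in> L2_space M"
    and orth: "\<And>g. g \<in> S \<Longrightarrow> (\<integral>\<omega>. h \<omega> * g \<omega> \<partial>M) = 0"
    and f: "f \<in> L2_closure M (lin_span S)"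
  shows "(\<integral>\<omega>. h \<omega> * f \<omega> \<partial>M) = 0"
proof -
  have span: "(\<integral>\<omega>. h \<omega> * g \<omega> \<partial>M) = 0" if g: "g \<in> lin_span S" for g
  proof -
    obtain T c where T: "g = (\<lambda>\<omega>. \<Sum>s\<in>T. c s * s \<omega>)" "finite T" "T \<subseteq> S"
      using g unfolding lin_span_def by blast
    have "(\<integral>\<omega>. h \<omega> * g \<omega> \<partial>M) = (\<integral>\<omega>. (\<Sum>s\<in>T. c s * (h \<omega> * s \<omega>)) \<partial>M)"
      unfolding T(1) by (simp add: sum_distrib_left mult_ac)
    also have "\<dots> = (\<Sum>s\<in>T. c s * (\<integral>\<omega>. h \<omega> * s \<omega> \<partial>M))"
    proof (subst Bochner_Integration.integral_sum)
      fix s assume "s \<in> T"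
      then have "s \<in> L2_space M" using T S by auto
      from L2_mult_integrable[OF h this] show "integrable M (\<lambda>\<omega>. c s * (h \<omega> * s \<omega>))" by simp
    qed simp
    also have "\<dots> = 0" using orth T by (intro sum.neutral) auto
    finally show ?thesis .
  qed
  have fL: "f \<in> L2_space M" using f by (auto simp: L2_closure_def)
  have "(\<integral>\<omega>. h \<omega> * f \<omega> \<partial>M)\<^sup>2 \<le> (\<integral>\<omega>. (h \<omega>)\<^sup>2 \<partial>M) * e" if "e > 0" for e
  proof -
    obtain g where g: "g \<in> lin_span S" "g \<in> L2_space M" "(\<integral>\<omega>. (f \<omega> - g \<omega>)\<^sup>2 \<partial>M) < e"
      using f \<open>e > 0\<close> unfolding L2_closure_def by auto
    have "(\<integral>\<omega>. h \<omega> * f \<omega> \<partial>M) = (\<integral>\<omega>. h \<omega> * (f \<omega> - g \<omega>) \<partial>M)"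
      using span[OF g(1)] L2_mult_integrable[OF h fL] L2_mult_integrable[OF h g(2)]
      by (simp add: right_diff_distrib)
    then have "(\<integral>\<omega>. h \<omega> * f \<omega> \<partial>M)\<^sup>2 \<le> (\<integral>\<omega>. (h \<omega>)\<^sup>2 \<partial>M) * (\<integral>\<omega>. (f \<omega> - g \<omega>)\<^sup>2 \<partial>M)"
      using L2_Cauchy_Schwarz[OF h L2_diff[OF fL g(2)]] by simp
    also have "\<dots> \<le> (\<integral>\<omega>. (h \<omega>)\<^sup>2 \<partial>M) * e"
      using g by (intro mult_left_mono) auto
    finally show ?thesis .
  qed
  note * = this
  have "((\<lambda>e. (\<integral>\<omega>. (h \<omega>)\<^sup>2 \<partial>M) * e) \<longlongrightarrow> (\<integral>\<omega>. (h \<omega>)\<^sup>2 \<partial>M) * 0) (at_right 0)"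
    by (intro tendsto_intros)
  moreover have "eventually (\<lambda>e. (\<integral>\<omega>. h \<omega> * f \<omega> \<partial>M)\<^sup>2 \<le> (\<integral>\<omega>. (h \<omega>)\<^sup>2 \<partial>M) * e) (at_right 0)"
    using * by (auto simp: eventually_at_filter)
  ultimately have "(\<integral>\<omega>. h \<omega> * f \<omega> \<partial>M)\<^sup>2 \<le> (\<integral>\<omega>. (h \<omega>)\<^sup>2 \<partial>M) * 0"
    by (intro tendsto_lowerbound) auto
  then show ?thesis by simp
qed

text \<open>The second moments are bounded uniformly in z because every field used later is a fixed
  function of \<open>\<xi> z\<close>, whose law does not depend on z. Over a probability space of
  parameters this bound gives square integrability on the product.\<close>

definition L2_field :: "'z measure \<Rightarrow> 'w measure \<Rightarrow> ('z \<Rightarrow> 'w \<Rightarrow> real) \<Rightarrow> bool" where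
  "L2_field N M f \<longleftrightarrow> (\<lambda>(z, \<omega>). f z \<omega>) \<in> borel_measurable (N \<Otimes>\<^sub>M M) \<and>
     (\<forall>z\<in>space N. f z \<in> L2_space M) \<and> (\<exists>K. \<forall>z\<in>space N. (\<integral>\<omega>. (f z \<omega>)\<^sup>2 \<partial>M) \<le> K)"

lemma L2_fieldD:
  assumes "L2_field N M f"
  shows "(\<lambda>(z, \<omega>). f z \<omega>) \<in> borel_measurable (N \<Otimes>\<^sub>M M)" "z \<in> space N \<Longrightarrow> f z \<in> L2_space M"
  using assms by (auto simp: L2_field_def)

lemma L2_field_const: "h \<in> L2_space M \<Longrightarrow> L2_field N M (\<lambda>_. h)"
  by (auto simp: L2_field_def dest: L2_spaceD(1))

section \<open>Averages of square integrable fields over the parameter space\<close>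

context pair_prob_space
begin

lemma L2_field_square_integrable:
  assumes "L2_field M1 M2 f"
  shows "(\<lambda>(z, \<omega>). f z \<omega>) \<in> L2_space (M1 \<Otimes>\<^sub>M M2)"
proof -
  have meas[measurable]: "(\<lambda>(z, \<omega>). f z \<omega>) \<in> borel_measurable (M1 \<Otimes>\<^sub>M M2)"
    and L: "\<And>z. z \<in> space M1 \<Longrightarrow> f z \<in> L2_space M2"
    using L2_fieldD[OF assms] by auto
  obtain K where K: "\<And>z. z \<in> space M1 \<Longrightarrow> (\<integral>\<omega>. (f z \<omega>)\<^sup>2 \<partial>M2) \<le> K"
    using assms by (auto simp: L2_field_def)
  have "integrable (M1 \<Otimes>\<^sub>M M2) (\<lambda>x. ((\<lambda>(z, \<omega>). f z \<omega>) x)\<^sup>2)"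
  proof (rule Fubini_integrable)
    have "(\<lambda>z. \<integral>\<omega>. norm (((\<lambda>(z, \<omega>). f z \<omega>) (z, \<omega>))\<^sup>2) \<partial>M2) \<in> borel_measurable M1"
      by measurable
    then show "integrable M1 (\<lambda>z. \<integral>\<omega>. norm (((\<lambda>(z, \<omega>). f z \<omega>) (z, \<omega>))\<^sup>2) \<partial>M2)"
      by (rule M1.integrable_const_bound[where B=K, rotated]) (use K in auto)
    show "AE z in M1. integrable M2 (\<lambda>\<omega>. ((\<lambda>(z, \<omega>). f z \<omega>) (z, \<omega>))\<^sup>2)"
      using L by (auto dest: L2_spaceD)
  qed measurable
  then show ?thesis by (simp add: L2_space_def)
qed

lemma L2_field_mult_integrable:
  assumes "L2_field M1 M2 f" "L2_field M1 M2 g"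
  shows "integrable (M1 \<Otimes>\<^sub>M M2) (\<lambda>(z, \<omega>). f z \<omega> * g z \<omega>)"
  using L2_mult_integrable[OF assms[THEN L2_field_square_integrable]]
  by (simp add: case_prod_unfold)

lemma L2_field_AE_integrable:
  assumes "L2_field M1 M2 f"
  shows "AE \<omega> in M2. integrable M1 (\<lambda>z. f z \<omega>)"
  using AE_integrable_snd[OF L2_field_mult_integrable[OF assms L2_field_const[OF M2.L2_const[of 1]]]]
  by simp

lemma L2_field_integral_measurable:
  assumes "L2_field M1 M2 f"
  shows "(\<lambda>\<omega>. \<integral>z. f z \<omega> \<partial>M1) \<in> borel_measurable M2"
proof -
  have [measurable]: "(\<lambda>(z, \<omega>). f z \<omega>) \<in> borel_measurable (M1 \<Otimes>\<^sub>M M2)"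
    by (rule L2_fieldD[OF assms])
  have "(\<lambda>(\<omega>, z). f z \<omega>) \<in> borel_measurable (M2 \<Otimes>\<^sub>M M1)"
    by measurable
  then show ?thesis by (rule M1.borel_measurable_lebesgue_integral)
qed

text \<open>Since \<open>M1\<close> has mass 1, Cauchy-Schwarz against the constant 1 bounds the
  squared average by the average of the squares, pathwise.\<close>

lemma L2_field_integral_L2:
  assumes "L2_field M1 M2 f"
  shows "(\<lambda>\<omega>. \<integral>z. f z \<omega> \<partial>M1) \<in> L2_space M2"
proof -
  note meas[measurable] = L2_field_integral_measurable[OF assms]
  have m[measurable]: "(\<lambda>(z, \<omega>). f z \<omega>) \<in> borel_measurable (M1 \<Otimes>\<^sub>M M2)"
    by (rule L2_fieldD[OF assms])
  have int: "integrable (M1 \<Otimes>\<^sub>M M2) (\<lambda>(z, \<omega>). (f z \<omega>)\<^sup>2)"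
    using L2_field_mult_integrable[OF assms assms] by (simp add: power2_eq_square)
  have "AE \<omega> in M2. norm ((\<integral>z. f z \<omega> \<partial>M1)\<^sup>2) \<le> norm (\<integral>z. (f z \<omega>)\<^sup>2 \<partial>M1)"
    using AE_integrable_snd[OF int] AE_space
  proof eventually_elim
    case (elim \<omega>)
    have "(\<lambda>z. f z \<omega>) \<in> borel_measurable M1"
      using measurable_compose[OF measurable_Pair2'[OF elim(2)] m] by simp
    then have "(\<lambda>z. f z \<omega>) \<in> L2_space M1" using elim by (simp add: L2_space_def)
    from L2_Cauchy_Schwarz[OF this M1.L2_const[of 1]] show ?case
      by (simp add: M1.prob_space)
  qed
  from Bochner_Integration.integrable_bound[OF integrable_snd[OF int] _ this]
  have "integrable M2 (\<lambda>\<omega>. (\<integral>z. f z \<omega> \<partial>M1)\<^sup>2)"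
    by simp
  then show ?thesis by (simp add: L2_space_def)
qed

lemma L2_field_integral_mult:
  assumes f: "L2_field M1 M2 f" and h: "h \<in> L2_space M2"
  shows "(\<integral>\<omega>. (\<integral>z. f z \<omega> \<partial>M1) * h \<omega> \<partial>M2) = (\<integral>z. (\<integral>\<omega>. f z \<omega> * h \<omega> \<partial>M2) \<partial>M1)"
    and "integrable M1 (\<lambda>z. \<integral>\<omega>. f z \<omega> * h \<omega> \<partial>M2)"
proof -
  note int = L2_field_mult_integrable[OF f L2_field_const[OF h]]
  show "integrable M1 (\<lambda>z. \<integral>\<omega>. f z \<omega> * h \<omega> \<partial>M2)"
    using integrable_fst[OF int] .
  have "(\<integral>\<omega>. (\<integral>z. f z \<omega> \<partial>M1) * h \<omega> \<partial>M2) = (\<integral>\<omega>. (\<integral>z. f z \<omega> * h \<omega> \<partial>M1) \<partial>M2)"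
    by simp
  also have "\<dots> = (\<integral>z. (\<integral>\<omega>. f z \<omega> * h \<omega> \<partial>M2) \<partial>M1)"
    using Fubini_integral[OF int] .
  finally show "(\<integral>\<omega>. (\<integral>z. f z \<omega> \<partial>M1) * h \<omega> \<partial>M2) = (\<integral>z. (\<integral>\<omega>. f z \<omega> * h \<omega> \<partial>M2) \<partial>M1)" .
qed

text \<open>The squared distance \<open>D\<close> from the average \<open>A\<close> to the subspace satisfies
  \<open>D \<le> (1 - t)\<^sup>2 D + O(t\<^sup>2)\<close>: perturb a near-minimiser \<open>g\<close> to \<open>(1 - t) g + t f z\<close> and average over \<open>z\<close>.
  This avoids the existence of orthogonal projections.\<close>

lemma L2_field_integral_in_closure:
  assumes f: "L2_field M1 M2 f"
    and C: "\<And>z. z \<in> space M1 \<Longrightarrow> f z \<in> L2_closure M2 (lin_span S)"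
  shows "(\<lambda>\<omega>. \<integral>z. f z \<omega> \<partial>M1) \<in> L2_closure M2 (lin_span S)"
proof -
  define C where "C = L2_closure M2 (lin_span S)"
  define A where "A = (\<lambda>\<omega>. \<integral>z. f z \<omega> \<partial>M1)"
  have Aeq: "(\<integral>z. f z \<omega> \<partial>M1) = A \<omega>" for \<omega> by (simp add: A_def)
  define d where "d g = (\<integral>\<omega>. (A \<omega> - g \<omega>)\<^sup>2 \<partial>M2)" for g
  define D where "D = Inf (d ` C)"
  have AL: "A \<in> L2_space M2"
    unfolding A_def by (rule L2_field_integral_L2[OF f])
  have CL: "g \<in> L2_space M2" if "g \<in> C" for g
    using that by (auto simp: C_def L2_closure_def)
  have ne: "C \<noteq> {}" using zero_in_L2_closure_span by (auto simp: C_def)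
  have bdd: "bdd_below (d ` C)" by (intro bdd_belowI[of _ 0]) (auto simp: d_def)
  have D_le: "D \<le> d g" if "g \<in> C" for g
    unfolding D_def using that bdd by (intro cInf_lower) auto
  have D0: "0 \<le> D" unfolding D_def using ne by (intro cInf_greatest) (auto simp: d_def)
  obtain K where K: "\<And>z. z \<in> space M1 \<Longrightarrow> (\<integral>\<omega>. (f z \<omega>)\<^sup>2 \<partial>M2) \<le> K"
    using f by (auto simp: L2_field_def)
  define K' where "K' = 2 * (\<integral>\<omega>. (A \<omega>)\<^sup>2 \<partial>M2) + 2 * K"
  have step: "D \<le> (1 - t)\<^sup>2 * d g + t\<^sup>2 * K'" if g: "g \<in> C" for g t
  proof -
    note gL = CL[OF g]
    note AgL = L2_diff[OF AL gL]
    define \<psi> where "\<psi> z = (\<integral>\<omega>. f z \<omega> * (A \<omega> - g \<omega>) \<partial>M2)" for z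
    define c where "c = (\<integral>\<omega>. A \<omega> * (A \<omega> - g \<omega>) \<partial>M2)"
    have \<psi>: "integrable M1 \<psi>" "(\<integral>z. \<psi> z \<partial>M1) = c"
      using L2_field_integral_mult[OF f AgL, unfolded Aeq] unfolding \<psi>_def c_def
      by (simp_all only:)
    have "D \<le> (1 - t)\<^sup>2 * d g + t\<^sup>2 * K' + 2 * t * (1 - t) * (c - \<psi> z)" if z: "z \<in> space M1" for z
    proof -
      have fz: "f z \<in> C" using C[OF z] by (simp add: C_def)
      note fzL = CL[OF fz]
      note AfL = L2_diff[OF AL fzL]
      have "(\<lambda>\<omega>. (1 - t) * g \<omega> + t * f z \<omega>) \<in> C"
        using g fz unfolding C_def by (intro L2_closure_span_lincomb)
      then have "D \<le> (\<integral>\<omega>. (A \<omega> - ((1 - t) * g \<omega> + t * f z \<omega>))\<^sup>2 \<partial>M2)"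
        using D_le unfolding d_def by blast
      also have "\<dots> = (\<integral>\<omega>. (1 - t)\<^sup>2 * (A \<omega> - g \<omega>)\<^sup>2 + t\<^sup>2 * (A \<omega> - f z \<omega>)\<^sup>2
           + 2 * t * (1 - t) * (A \<omega> * (A \<omega> - g \<omega>) - f z \<omega> * (A \<omega> - g \<omega>)) \<partial>M2)"
        by (intro Bochner_Integration.integral_cong refl) (simp add: power2_eq_square algebra_simps)
      also have "\<dots> = (1 - t)\<^sup>2 * d g + t\<^sup>2 * d (f z) + 2 * t * (1 - t) * (c - \<psi> z)"
        using L2_spaceD(2)[OF AgL] L2_spaceD(2)[OF AfL] L2_mult_integrable[OF AL AgL]
          L2_mult_integrable[OF fzL AgL]
        by (simp add: d_def c_def \<psi>_def)
      also have "\<dots> \<le> (1 - t)\<^sup>2 * d g + t\<^sup>2 * K' + 2 * t * (1 - t) * (c - \<psi> z)"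
      proof -
        have "d (f z) = (\<integral>\<omega>. (1 * A \<omega> + (-1) * f z \<omega>)\<^sup>2 \<partial>M2)"
          by (simp add: d_def)
        also have "\<dots> \<le> 2 * 1\<^sup>2 * (\<integral>\<omega>. (A \<omega>)\<^sup>2 \<partial>M2) + 2 * (-1)\<^sup>2 * (\<integral>\<omega>. (f z \<omega>)\<^sup>2 \<partial>M2)"
          by (rule L2_sum_norm_le[OF AL fzL])
        also have "\<dots> \<le> K'" using K[OF z] by (simp add: K'_def)
        finally have "d (f z) \<le> K'" .
        from mult_left_mono[OF this, of "t\<^sup>2"] show ?thesis by simp
      qed
      finally show ?thesis .
    qed
    \<comment> \<open>Averaging removes the first-order term: the integral of \<open>\<psi>\<close>
      over z is \<open>c\<close>, because \<open>A\<close> is the average of the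
      \<open>f z\<close>.\<close>
    then have "D \<le> (\<integral>z. (1 - t)\<^sup>2 * d g + t\<^sup>2 * K' + 2 * t * (1 - t) * (c - \<psi> z) \<partial>M1)"
      using \<psi> by (intro M1.integral_ge_const) auto
    also have "\<dots> = (1 - t)\<^sup>2 * d g + t\<^sup>2 * K'"
      using \<psi> by (simp add: M1.prob_space)
    finally show ?thesis .
  qed
  have le: "D \<le> (1 - t)\<^sup>2 * D + t\<^sup>2 * K'" for t
  proof (rule field_le_epsilon)
    fix e :: real assume e: "0 < e"
    define e' where "e' = e / ((1 - t)\<^sup>2 + 1)"
    have pos: "(1 - t)\<^sup>2 + 1 > 0" by (simp add: add_nonneg_pos)
    have e': "e' > 0" using e pos by (simp add: e'_def)
    obtain g where g: "g \<in> C" "d g < D + e'"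
      using cInf_lessD[of "d ` C" "D + e'"] ne e' by (auto simp: D_def)
    have "D \<le> (1 - t)\<^sup>2 * d g + t\<^sup>2 * K'" by (rule step[OF g(1)])
    also have "(1 - t)\<^sup>2 * d g \<le> (1 - t)\<^sup>2 * (D + e')"
      using g by (intro mult_left_mono) auto
    also have "(1 - t)\<^sup>2 * (D + e') \<le> (1 - t)\<^sup>2 * D + ((1 - t)\<^sup>2 + 1) * e'"
      using e' by (simp add: algebra_simps)
    also have "((1 - t)\<^sup>2 + 1) * e' = e" using pos by (simp add: e'_def)
    finally show "D \<le> (1 - t)\<^sup>2 * D + t\<^sup>2 * K' + e" by simp
  qed
  \<comment> \<open>Expanding (1 - t)^2 cancels D on both sides; dividing by t leaves (2 - t) D <= t
    K', and 2 - t is at least 1.\<close>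
  have le2: "D \<le> t * K'" if t: "0 < t" "t < 1" for t
  proof -
    have "t * ((2 - t) * D) \<le> t * (t * K')"
      using le[of t] by (simp add: power2_eq_square algebra_simps)
    then have "(2 - t) * D \<le> t * K'" using t by simp
    moreover have "1 * D \<le> (2 - t) * D" using t D0 by (intro mult_right_mono) auto
    ultimately show ?thesis by simp
  qed
  have "D \<le> 0"
  proof (rule tendsto_lowerbound)
    show "((\<lambda>t. t * K') \<longlongrightarrow> 0) (at_right 0)" by (auto intro!: tendsto_eq_intros)
    show "eventually (\<lambda>t. D \<le> t * K') (at_right 0)"
      unfolding eventually_at_right_field using le2 by (intro exI[of _ 1]) auto
  qed simp
  then have D: "D = 0" using D0 by simp
  have "\<exists>g\<in>C. d g < e" if "e > 0" for e
    using cInf_lessD[of "d ` C" e] ne that D by (auto simp: D_def)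
  then show ?thesis
    unfolding A_def[symmetric] using AL unfolding C_def d_def by (intro L2_closure_closed) auto
qed

end

section \<open>Hermite polynomials and standard Gaussian vectors\<close>

text \<open>The Appell property. Differentiating the defining recursion reproduces that same
  recursion one degree lower, multiplied by n + 1, besides the term from the derivative of
  x.\<close>

lemma pderiv_hermite_Suc: "pderiv (hermite (Suc n)) = smult (real (Suc n)) (hermite n)"
proof (induction n)
  case 0
  then show ?case by (simp add: pderiv_pCons)
next
  case (Suc n)
  have "pderiv (hermite (Suc (Suc n))) =
      pderiv ([:0, 1:] * hermite (Suc n)) - pderiv (smult (real (Suc n)) (hermite n))"
    by (subst hermite.simps(2), subst Suc) (simp only: pderiv_diff)
  also have "\<dots> = hermite (Suc n) + smult (real (Suc n)) ([:0, 1:] * hermite n - pderiv (hermite n))"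
    unfolding pderiv_mult Suc pderiv_smult
    by (simp add: pderiv_pCons smult_diff_right del: hermite.simps)
  also have "[:0, 1:] * hermite n - pderiv (hermite n) = hermite (Suc n)" by simp
  also have "hermite (Suc n) + smult (real (Suc n)) (hermite (Suc n)) =
      smult (real (Suc (Suc n))) (hermite (Suc n))"
  proof -
    have "real (Suc (Suc n)) = 1 + real (Suc n)" by simp
    then show ?thesis by (simp only: smult_add_left smult_1_left)
  qed
  finally show ?case .
qed

lemma hermite_Suc_Suc:
  "poly (hermite (Suc (Suc n))) x = x * poly (hermite (Suc n)) x - real (Suc n) * poly (hermite n) x"
  by (subst hermite.simps(2), subst pderiv_hermite_Suc) (simp del: hermite.simps)

text \<open>For n = 0 the truncated index n - 1 does no harm, as its factor is 0. This form avoids a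
  case split when moments are differentiated.\<close>

lemma hermite_rec:
  "poly (hermite (Suc n)) x = x * poly (hermite n) x - real n * poly (hermite (n - 1)) x"
  by (cases n) (simp_all only: hermite_Suc_Suc diff_Suc_1, simp)

lemma hermite_uminus: "poly (hermite n) (- x) = (-1) ^ n * poly (hermite n) x"
proof (induction n rule: less_induct)
  case (less n)
  consider "n = 0" | "n = 1" | m where "n = Suc (Suc m)"
    by (metis One_nat_def nat.exhaust)
  then show ?case
  proof cases
    case (3 m)
    then show ?thesis
      using less[of m] less[of "Suc m"] by (simp add: hermite_Suc_Suc algebra_simps del: hermite.simps)
  qed auto
qed

lemma hermite_odd_zero: "odd n \<Longrightarrow> poly (hermite n) 0 = 0"
  using hermite_uminus[of n 0] by simp

section \<open>Gaussian integrals of polynomials\<close>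

definition gauss_int :: "real poly \<Rightarrow> real" where
  "gauss_int p = (\<integral>x. std_normal_density x * poly p x \<partial>lborel)"

lemma integrable_std_normal_poly: "integrable lborel (\<lambda>x. std_normal_density x * poly p x)"
proof -
  have "(\<lambda>x. std_normal_density x * poly p x) =
      (\<lambda>x. \<Sum>i\<le>degree p. coeff p i * (std_normal_density x * x ^ i))"
    by (auto simp: poly_altdef sum_distrib_left mult_ac)
  then show ?thesis using integrable_std_normal_moment by simp
qed

lemma gauss_int_add: "gauss_int (p + q) = gauss_int p + gauss_int q"
  unfolding gauss_int_def
  using integrable_std_normal_poly[of p] integrable_std_normal_poly[of q] by (simp add: distrib_left)

lemma gauss_int_smult: "gauss_int (smult c p) = c * gauss_int p"
  unfolding gauss_int_def by (simp add: mult.left_commute[of _ c])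

lemma gauss_int_diff: "gauss_int (p - q) = gauss_int p - gauss_int q"
  unfolding gauss_int_def
  using integrable_std_normal_poly[of p] integrable_std_normal_poly[of q] by (simp add: right_diff_distrib)

lemma gauss_int_sum: "finite I \<Longrightarrow> gauss_int (\<Sum>i\<in>I. p i) = (\<Sum>i\<in>I. gauss_int (p i))"
  by (induction I rule: finite_induct) (simp_all add: gauss_int_add, simp add: gauss_int_def)

lemma gauss_int_1: "gauss_int 1 = 1"
  using integral_std_normal_moment_even[of 0] by (simp add: gauss_int_def)

lemma std_normal_moment_rec:
  "gauss_int (monom 1 (Suc n)) = real n * gauss_int (monom 1 (n - 1))"
proof (cases "even n")
  case True
  then obtain k where k: "n = 2 * k" by (auto elim: evenE)
  have "gauss_int (monom 1 (Suc n)) = 0"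
    using integral_std_normal_moment_odd[of k] k by (simp add: gauss_int_def poly_monom)
  moreover have "real n * gauss_int (monom 1 (n - 1)) = 0"
  proof (cases k)
    case (Suc m)
    then have "n - 1 = 2 * m + 1" using k by simp
    then show ?thesis
      using integral_std_normal_moment_odd[of m] by (simp add: gauss_int_def poly_monom)
  qed (simp add: k)
  ultimately show ?thesis by simp
next
  case False
  then obtain k where k: "n = 2 * k + 1" by (auto elim: oddE)
  have 1: "gauss_int (monom 1 (2 * m)) = fact (2 * m) / (2 ^ m * fact m)" for m
    using integral_std_normal_moment_even[of m] by (simp add: gauss_int_def poly_monom)
  have "gauss_int (monom 1 (Suc n)) = fact (2 * Suc k) / (2 ^ Suc k * fact (Suc k))"
    unfolding 1[symmetric] k by simp
  also have "\<dots> = real n * (fact (2 * k) / (2 ^ k * fact k))"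
  proof -
    have *: "fact (2 * Suc k) = real (2 * k + 2) * (real n * fact (2 * k))"
      by (simp add: k algebra_simps)
    have **: "2 ^ Suc k * fact (Suc k) = real (2 * k + 2) * (2 ^ k * fact k)"
      by (simp add: algebra_simps)
    show ?thesis unfolding * ** by (subst mult_divide_mult_cancel_left) auto
  qed
  also have "fact (2 * k) / (2 ^ k * fact k) = gauss_int (monom 1 (n - 1))"
    unfolding 1[symmetric] k by simp
  finally show ?thesis .
qed

text \<open>Gaussian integration by parts. On monomials it is the recursion of the moments, and both
  sides are linear in the polynomial.\<close>

lemma gauss_int_stein: "gauss_int ([:0, 1:] * p) = gauss_int (pderiv p)"
proof -
  have m: "gauss_int ([:0, 1:] * monom c n) = gauss_int (pderiv (monom c n))" for c n
  proof -
    have "[:0, 1:] * monom c n = smult c (monom 1 (Suc n))"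
      by (simp add: monom_Suc smult_monom)
    moreover have "pderiv (monom c n) = smult (c * real n) (monom 1 (n - 1))"
      by (simp add: pderiv_monom smult_monom mult.commute)
    ultimately show ?thesis by (simp add: gauss_int_smult std_normal_moment_rec)
  qed
  have "gauss_int ([:0, 1:] * (\<Sum>i\<le>degree p. monom (coeff p i) i)) =
      gauss_int (pderiv (\<Sum>i\<le>degree p. monom (coeff p i) i))"
    using m by (simp add: sum_distrib_left gauss_int_sum higher_pderiv_sum[of 1, simplified] del: mult_pCons_left)
  then show ?thesis by (simp only: poly_as_sum_of_monoms)
qed

text \<open>The operator x - d/dx that raises Hermite polynomials is the adjoint of d/dx under the
  Gaussian weight.\<close>

lemma gauss_int_hermite_Suc: "gauss_int (hermite (Suc n) * q) = gauss_int (hermite n * pderiv q)"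
proof -
  have "hermite (Suc n) * q = [:0, 1:] * (hermite n * q) - pderiv (hermite n) * q"
    by (simp add: left_diff_distrib)
  then have "gauss_int (hermite (Suc n) * q) =
      gauss_int ([:0, 1:] * (hermite n * q)) - gauss_int (pderiv (hermite n) * q)"
    by (simp only: gauss_int_diff)
  also have "\<dots> = gauss_int (hermite n * pderiv q)"
    by (simp only: gauss_int_stein pderiv_mult gauss_int_add) (simp add: mult.commute)
  finally show ?thesis .
qed

text \<open>Each step lowers the first index by adjointness and the second by the Appell property,
  picking up the factor that builds the factorial. If one index runs out first, the derivative of a
  constant appears.\<close>

lemma gauss_int_hermite_mult:
  "gauss_int (hermite m * hermite n) = (if m = n then fact n else 0)"
proof (induction m arbitrary: n)
  case 0
  show ?case
  proof (cases n)
    case 0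
    then show ?thesis by (simp add: gauss_int_1)
  next
    case (Suc k)
    have "gauss_int (hermite 0 * hermite n) = gauss_int (hermite (Suc k) * 1)"
      by (simp add: Suc)
    also have "\<dots> = gauss_int 0" unfolding gauss_int_hermite_Suc by simp
    finally show ?thesis using Suc by (simp add: gauss_int_def)
  qed
next
  case (Suc m)
  show ?case
  proof (cases n)
    case 0
    have "gauss_int (hermite (Suc m) * 1) = gauss_int 0" unfolding gauss_int_hermite_Suc by simp
    then show ?thesis by (simp add: 0 gauss_int_def)
  next
    case (Suc k)
    then show ?thesis
      unfolding Suc gauss_int_hermite_Suc pderiv_hermite_Suc mult_smult_right gauss_int_smult Suc.IH
      by simp
  qed
qed

lemma std_normal_expectation_poly:
  assumes "distributed M lborel Y std_normal_density"
  shows "integrable M (\<lambda>\<omega>. poly p (Y \<omega>))" "(\<integral>\<omega>. poly p (Y \<omega>) \<partial>M) = gauss_int p"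
proof -
  have [measurable]: "poly p \<in> borel_measurable lborel"
    by (simp add: borel_measurable_continuous_onI continuous_on_poly)
  show "integrable M (\<lambda>\<omega>. poly p (Y \<omega>))"
    using distributed_integrable[OF assms, of "poly p"] integrable_std_normal_poly[of p] by simp
  show "(\<integral>\<omega>. poly p (Y \<omega>) \<partial>M) = gauss_int p"
    using distributed_integral[OF assms, of "poly p"] by (simp add: gauss_int_def)
qed

lemma borel_measurable_poly[measurable]: "poly (p :: real poly) \<in> borel_measurable borel"
  by (simp add: borel_measurable_continuous_onI continuous_on_poly)

context prob_space
begin

lemma std_gaussian_vector_poly:
  assumes "std_gaussian_vector M T Y"
  shows "integrable M (\<lambda>\<omega>. \<Prod>t\<in>T. poly (P t) (Y t \<omega>))"
    and "(\<integral>\<omega>. (\<Prod>t\<in>T. poly (P t) (Y t \<omega>)) \<partial>M) = (\<Prod>t\<in>T. gauss_int (P t))"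
proof -
  have fin: "finite T" and ind: "indep_vars (\<lambda>_. borel) Y T"
    and d: "\<And>t. t \<in> T \<Longrightarrow> distributed M lborel (Y t) std_normal_density"
    using assms by (auto simp: std_gaussian_vector_def)
  have ind': "indep_vars (\<lambda>_. borel) (\<lambda>t \<omega>. poly (P t) (Y t \<omega>)) T"
    by (rule indep_vars_compose2[OF ind]) (rule borel_measurable_poly)
  show "integrable M (\<lambda>\<omega>. \<Prod>t\<in>T. poly (P t) (Y t \<omega>))"
    by (rule indep_vars_integrable[OF fin ind']) (rule std_normal_expectation_poly(1)[OF d])
  have "(\<integral>\<omega>. (\<Prod>t\<in>T. poly (P t) (Y t \<omega>)) \<partial>M) = (\<Prod>t\<in>T. \<integral>\<omega>. poly (P t) (Y t \<omega>) \<partial>M)"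
    by (rule indep_vars_lebesgue_integral[OF fin ind']) (rule std_normal_expectation_poly(1)[OF d])
  also have "\<dots> = (\<Prod>t\<in>T. gauss_int (P t))"
    by (intro prod.cong refl std_normal_expectation_poly(2)[OF d])
  finally show "(\<integral>\<omega>. (\<Prod>t\<in>T. poly (P t) (Y t \<omega>)) \<partial>M) = (\<Prod>t\<in>T. gauss_int (P t))" .
qed

lemma std_gaussian_vector_measurable:
  "std_gaussian_vector M T Y \<Longrightarrow> t \<in> T \<Longrightarrow> Y t \<in> borel_measurable M"
  by (auto simp: std_gaussian_vector_def indep_vars_def)

lemma std_gaussian_vector_poly_L2:
  assumes "std_gaussian_vector M T Y"
  shows "(\<lambda>\<omega>. \<Prod>t\<in>T. poly (P t) (Y t \<omega>)) \<in> L2_space M"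
proof -
  have "(\<lambda>\<omega>. (\<Prod>t\<in>T. poly (P t) (Y t \<omega>))\<^sup>2) = (\<lambda>\<omega>. \<Prod>t\<in>T. poly ((P t)\<^sup>2) (Y t \<omega>))"
    by (simp add: prod_power_distrib poly_power)
  moreover have "(\<lambda>\<omega>. \<Prod>t\<in>T. poly (P t) (Y t \<omega>)) \<in> borel_measurable M"
    by (intro borel_measurable_prod measurable_compose[OF _ borel_measurable_poly])
      (rule std_gaussian_vector_measurable[OF assms])
  ultimately show ?thesis
    using std_gaussian_vector_poly(1)[OF assms, of "\<lambda>t. (P t)\<^sup>2"] by (simp add: L2_space_def)
qed

end

section \<open>Products of Hermite polynomials in several variables\<close>

definition multi_hermite :: "('t::finite \<Rightarrow> nat) \<Rightarrow> ('t \<Rightarrow> real) \<Rightarrow> real" where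
  "multi_hermite p x = (\<Prod>t\<in>UNIV. poly (hermite (p t)) (x t))"

definition multi_fact :: "('t::finite \<Rightarrow> nat) \<Rightarrow> real" where
  "multi_fact p = (\<Prod>t\<in>UNIV. fact (p t))"

lemma multi_hermite_measurable[measurable]:
  "multi_hermite p \<in> borel_measurable (Pi\<^sub>M UNIV (\<lambda>_. borel))"
  unfolding multi_hermite_def[abs_def]
  by (intro borel_measurable_prod measurable_compose[OF _ borel_measurable_poly] measurable_component_singleton) simp

lemma multi_fact_nonzero: "multi_fact p \<noteq> 0"
  by (simp add: multi_fact_def)

context prob_space
begin

lemma multi_hermite_L2:
  "std_gaussian_vector M UNIV Y \<Longrightarrow> (\<lambda>\<omega>. multi_hermite p (\<lambda>t. Y t \<omega>)) \<in> L2_space M"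
  unfolding multi_hermite_def by (rule std_gaussian_vector_poly_L2)

lemma multi_hermite_orthogonal:
  assumes "std_gaussian_vector M UNIV Y"
  shows "(\<integral>\<omega>. multi_hermite p (\<lambda>t. Y t \<omega>) * multi_hermite q (\<lambda>t. Y t \<omega>) \<partial>M) =
    (if p = q then multi_fact p else 0)"
proof -
  have "(\<integral>\<omega>. multi_hermite p (\<lambda>t. Y t \<omega>) * multi_hermite q (\<lambda>t. Y t \<omega>) \<partial>M) =
    (\<integral>\<omega>. (\<Prod>t\<in>UNIV. poly (hermite (p t) * hermite (q t)) (Y t \<omega>)) \<partial>M)"
    by (simp add: multi_hermite_def prod.distrib)
  also have "\<dots> = (\<Prod>t\<in>UNIV. if p t = q t then fact (q t) else 0)"
    unfolding std_gaussian_vector_poly(2)[OF assms] gauss_int_hermite_mult ..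
  also have "\<dots> = (if p = q then multi_fact p else 0)"
  proof (cases "p = q")
    case False
    then obtain t where "p t \<noteq> q t" by auto
    then show ?thesis using False by (simp add: prod_zero_iff) (metis (full_types))
  qed (simp add: multi_fact_def)
  finally show ?thesis .
qed

end

definition multi_index :: "nat \<Rightarrow> ('t::finite \<Rightarrow> nat) set" where
  "multi_index q = {p. (\<Sum>t\<in>UNIV. p t) = q}"

lemma finite_multi_index[simp]: "finite (multi_index q :: ('t::finite \<Rightarrow> nat) set)"
proof (rule finite_subset)
  show "multi_index q \<subseteq> (UNIV :: 't set) \<rightarrow>\<^sub>E {..q}"
  proof (intro subsetI PiE_I)
    fix p :: "'t \<Rightarrow> nat" and t
    assume "p \<in> multi_index q"
    then show "p t \<in> {..q}" using member_le_sum[of t UNIV p] by (simp add: multi_index_def)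
  qed auto
  show "finite ((UNIV :: 't set) \<rightarrow>\<^sub>E {..q})" by (intro finite_PiE) auto
qed

section \<open>Fourier uniqueness for weighted random vectors\<close>

context prob_space
begin

text \<open>At s = 0 the hypothesis says that the positive and negative parts of \<open>h\<close>
  have the same mass c. If c > 0, dividing by c turns them into densities under which
  \<open>\<eta>\<close> has two probability laws with equal characteristic functions, so Levy
  uniqueness applies; if c = 0, \<open>h\<close> vanishes almost surely.\<close>

lemma fourier_unique_real:
  fixes h :: "'a \<Rightarrow> real"
  assumes h: "integrable M h" and \<eta>[measurable]: "\<eta> \<in> borel_measurable M"
    and zero: "\<And>s. (\<integral>\<omega>. iexp (s * \<eta> \<omega>) * complex_of_real (h \<omega>) \<partial>M) = 0"
    and B[measurable]: "B \<in> sets borel"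
  shows "(\<integral>\<omega>. indicator B (\<eta> \<omega>) * h \<omega> \<partial>M) = 0"
proof -
  note [measurable] = borel_measurable_integrable[OF h]
  define p where "p \<omega> = max (h \<omega>) 0" for \<omega>
  define n where "n \<omega> = max (- h \<omega>) 0" for \<omega>
  have [measurable]: "p \<in> borel_measurable M" "n \<in> borel_measurable M"
    unfolding p_def[abs_def] n_def[abs_def] by measurable
  have p0: "0 \<le> p \<omega>" and n0: "0 \<le> n \<omega>" and hpn: "h \<omega> = p \<omega> - n \<omega>" for \<omega>
    by (auto simp: p_def n_def)
  have pint: "integrable M p" and nint: "integrable M n"
    unfolding p_def[abs_def] n_def[abs_def] using h by auto
  define c where "c = (\<integral>\<omega>. p \<omega> \<partial>M)"
  have "(\<integral>\<omega>. complex_of_real (h \<omega>) \<partial>M) = 0" using zero[of 0] by simp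
  then have "(\<integral>\<omega>. h \<omega> \<partial>M) = 0" by simp
  then have nc: "(\<integral>\<omega>. n \<omega> \<partial>M) = c"
    using pint nint by (simp add: hpn c_def)
  have c0: "0 \<le> c" unfolding c_def using p0 by simp
  show ?thesis
  proof (cases "c = 0")
    case True
    have "AE \<omega> in M. p \<omega> = 0"
      using integral_nonneg_eq_0_iff_AE[OF pint] p0 True by (simp add: c_def)
    moreover have "AE \<omega> in M. n \<omega> = 0"
      using integral_nonneg_eq_0_iff_AE[OF nint] n0 True nc by simp
    ultimately have "AE \<omega> in M. indicator B (\<eta> \<omega>) * h \<omega> = 0"
      by eventually_elim (simp add: hpn)
    then have "(\<integral>\<omega>. indicator B (\<eta> \<omega>) * h \<omega> \<partial>M) = (\<integral>\<omega>. 0 \<partial>M)"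
      by (intro integral_cong_AE) auto
    then show ?thesis by simp
  next
    case False
    then have c: "c > 0" using c0 by simp
    define \<mu> where "\<mu> f = distr (density M (\<lambda>\<omega>. ennreal (f \<omega> / c))) borel \<eta>" for f :: "'a \<Rightarrow> real"
    have rd: "real_distribution (\<mu> f)"
      if [measurable]: "f \<in> borel_measurable M" and f: "\<And>\<omega>. 0 \<le> f \<omega>" "integrable M f" "(\<integral>\<omega>. f \<omega> \<partial>M) = c"
      for f
    proof -
      have "emeasure (density M (\<lambda>\<omega>. ennreal (f \<omega> / c))) (space M) = (\<integral>\<^sup>+\<omega>. ennreal (f \<omega> / c) \<partial>M)"
        by (simp add: emeasure_density cong: nn_integral_cong)
      also have "\<dots> = ennreal (\<integral>\<omega>. f \<omega> / c \<partial>M)"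
        using f c by (intro nn_integral_eq_integral) auto
      also have "\<dots> = 1" using f c by simp
      finally have "prob_space (density M (\<lambda>\<omega>. ennreal (f \<omega> / c)))"
        by (intro prob_spaceI) simp
      then show ?thesis
        unfolding \<mu>_def by (intro prob_space.real_distribution_distr) simp_all
    qed
    have char: "char (\<mu> f) s = (\<integral>\<omega>. iexp (s * \<eta> \<omega>) * complex_of_real (f \<omega>) \<partial>M) / c"
      if [measurable]: "f \<in> borel_measurable M" and f: "\<And>\<omega>. 0 \<le> f \<omega>" for f s
    proof -
      have "char (\<mu> f) s = (\<integral>\<omega>. (f \<omega> / c) *\<^sub>R iexp (s * \<eta> \<omega>) \<partial>M)"
        unfolding char_def \<mu>_def using f c by (simp add: integral_distr integral_density)
      also have "\<dots> = (\<integral>\<omega>. (iexp (s * \<eta> \<omega>) * complex_of_real (f \<omega>)) / c \<partial>M)"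
        by (intro Bochner_Integration.integral_cong refl) (simp add: scaleR_conv_of_real)
      finally show ?thesis by simp
    qed
    have bound: "integrable M (\<lambda>\<omega>. iexp (s * \<eta> \<omega>) * complex_of_real (f \<omega>))" if "integrable M f" for f s
      using that by (intro Bochner_Integration.integrable_bound[OF that]) (auto simp: norm_mult)
    have "char (\<mu> p) = char (\<mu> n)"
    proof
      fix s
      have "(\<integral>\<omega>. iexp (s * \<eta> \<omega>) * complex_of_real (p \<omega>) \<partial>M) -
          (\<integral>\<omega>. iexp (s * \<eta> \<omega>) * complex_of_real (n \<omega>) \<partial>M) = 0"
        using zero[of s] bound[OF pint, of s] bound[OF nint, of s]
        by (simp add: hpn right_diff_distrib)
      then show "char (\<mu> p) s = char (\<mu> n) s"
        using p0 n0 by (simp add: char)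
    qed
    then have eq: "\<mu> p = \<mu> n"
      using p0 n0 pint nint nc by (intro Levy_uniqueness rd) (simp_all add: c_def)
    have val: "(\<integral>x. indicator B x \<partial>\<mu> f) = (\<integral>\<omega>. indicator B (\<eta> \<omega>) * f \<omega> \<partial>M) / c"
      if [measurable]: "f \<in> borel_measurable M" and f: "\<And>\<omega>. 0 \<le> f \<omega>" for f
    proof -
      have "(\<integral>x. indicator B x \<partial>\<mu> f) = (\<integral>\<omega>. (f \<omega> / c) *\<^sub>R (indicator B (\<eta> \<omega>) :: real) \<partial>M)"
        unfolding \<mu>_def using f c by (subst integral_distr, simp, simp, subst integral_density) auto
      also have "\<dots> = (\<integral>\<omega>. (indicator B (\<eta> \<omega>) * f \<omega>) / c \<partial>M)"
        by (intro Bochner_Integration.integral_cong refl) simp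
      finally show ?thesis by simp
    qed
    have iB: "integrable M (\<lambda>\<omega>. indicator B (\<eta> \<omega>) * f \<omega>)" if "integrable M f" for f :: "'a \<Rightarrow> real"
      using that by (intro Bochner_Integration.integrable_bound[OF that])
        (auto simp: abs_mult split: split_indicator)
    have "(\<integral>\<omega>. indicator B (\<eta> \<omega>) * p \<omega> \<partial>M) = (\<integral>\<omega>. indicator B (\<eta> \<omega>) * n \<omega> \<partial>M)"
      using val[of p] val[of n] p0 n0 c by (simp add: eq)
    then show ?thesis
      using iB[OF pint] iB[OF nint] by (simp add: hpn right_diff_distrib)
  qed
qed

text \<open>Complex weights are required because, in the vector version, the characters of the
  remaining coordinates are absorbed into the weight. Conjugating the hypothesis at -s gives it for
  the conjugate weight, hence for real and imaginary parts.\<close>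

lemma fourier_unique:
  fixes H :: "'a \<Rightarrow> complex"
  assumes H: "integrable M H" and \<eta>[measurable]: "\<eta> \<in> borel_measurable M"
    and zero: "\<And>s. (\<integral>\<omega>. iexp (s * \<eta> \<omega>) * H \<omega> \<partial>M) = 0"
    and B[measurable]: "B \<in> sets borel"
  shows "(\<integral>\<omega>. indicator B (\<eta> \<omega>) * H \<omega> \<partial>M) = 0"
proof -
  have Hc: "integrable M (\<lambda>\<omega>. cnj (H \<omega>))" using H by simp
  note [measurable] = borel_measurable_integrable[OF H] borel_measurable_integrable[OF Hc]
  have int: "integrable M (\<lambda>\<omega>. iexp (s * \<eta> \<omega>) * H \<omega>)" for s
    by (intro Bochner_Integration.integrable_bound[OF H]) (auto simp: norm_mult)
  have intc: "integrable M (\<lambda>\<omega>. iexp (s * \<eta> \<omega>) * cnj (H \<omega>))" for s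
    by (intro Bochner_Integration.integrable_bound[OF H]) (auto simp: norm_mult)
  have zeroc: "(\<integral>\<omega>. iexp (s * \<eta> \<omega>) * cnj (H \<omega>) \<partial>M) = 0" for s
  proof -
    have "(\<integral>\<omega>. iexp (s * \<eta> \<omega>) * cnj (H \<omega>) \<partial>M) = (\<integral>\<omega>. cnj (iexp (- s * \<eta> \<omega>) * H \<omega>) \<partial>M)"
      by (intro Bochner_Integration.integral_cong refl) (simp add: exp_cnj)
    also have "\<dots> = cnj (\<integral>\<omega>. iexp (- s * \<eta> \<omega>) * H \<omega> \<partial>M)"
      by (rule Bochner_Integration.integral_cnj)
    finally show ?thesis using zero[of "- s"] by simp
  qed
  have "(\<integral>\<omega>. indicator B (\<eta> \<omega>) * Re (H \<omega>) \<partial>M) = 0"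
  proof (rule fourier_unique_real[OF _ \<eta> _ B])
    fix s
    have "(\<integral>\<omega>. iexp (s * \<eta> \<omega>) * complex_of_real (Re (H \<omega>)) \<partial>M) =
        (\<integral>\<omega>. (iexp (s * \<eta> \<omega>) * H \<omega> + iexp (s * \<eta> \<omega>) * cnj (H \<omega>)) / 2 \<partial>M)"
      by (intro Bochner_Integration.integral_cong refl)
        (simp add: distrib_left[symmetric] complex_add_cnj)
    also have "\<dots> = 0" using int[of s] intc[of s] zero[of s] zeroc[of s] by simp
    finally show "(\<integral>\<omega>. iexp (s * \<eta> \<omega>) * complex_of_real (Re (H \<omega>)) \<partial>M) = 0" .
  qed (use H in auto)
  moreover have "(\<integral>\<omega>. indicator B (\<eta> \<omega>) * Im (H \<omega>) \<partial>M) = 0"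
  proof (rule fourier_unique_real[OF _ \<eta> _ B])
    fix s
    have "(\<integral>\<omega>. iexp (s * \<eta> \<omega>) * complex_of_real (Im (H \<omega>)) \<partial>M) =
        (\<integral>\<omega>. (iexp (s * \<eta> \<omega>) * H \<omega> - iexp (s * \<eta> \<omega>) * cnj (H \<omega>)) / (2 * \<i>) \<partial>M)"
    proof -
      have "complex_of_real (Im w) = (w - cnj w) / (2 * \<i>)" for w
        by (simp add: complex_eq_iff)
      then show ?thesis by (simp only: right_diff_distrib times_divide_eq_right)
    qed
    also have "\<dots> = 0" using int[of s] intc[of s] zero[of s] zeroc[of s] by simp
    finally show "(\<integral>\<omega>. iexp (s * \<eta> \<omega>) * complex_of_real (Im (H \<omega>)) \<partial>M) = 0" .
  qed (use H in auto)
  moreover have iB: "integrable M (\<lambda>\<omega>. indicator B (\<eta> \<omega>) * H \<omega>)"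
    by (intro Bochner_Integration.integrable_bound[OF H]) (auto simp: norm_mult split: split_indicator)
  moreover have "Re (indicator B (\<eta> \<omega>) * H \<omega>) = indicator B (\<eta> \<omega>) * Re (H \<omega>)"
    "Im (indicator B (\<eta> \<omega>) * H \<omega>) = indicator B (\<eta> \<omega>) * Im (H \<omega>)" for \<omega>
    by (auto split: split_indicator)
  ultimately show ?thesis
    using integral_Re[OF iB] integral_Im[OF iB] by (simp add: complex_eq_iff)
qed

text \<open>Coordinate by coordinate, a character is exchanged for an indicator. This shows that the
  positive and negative parts of \<open>h\<close> induce image measures that agree on boxes, hence
  everywhere, and so give the same integral of \<open>F\<close>.\<close>

lemma fourier_unique_vector:
  fixes \<xi> :: "'t::finite \<Rightarrow> 'a \<Rightarrow> real" and h :: "'a \<Rightarrow> real"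
  assumes h: "integrable M h" and \<xi>[measurable]: "\<And>t. \<xi> t \<in> borel_measurable M"
    and zero: "\<And>s. (\<integral>\<omega>. iexp (\<Sum>t\<in>UNIV. s t * \<xi> t \<omega>) * complex_of_real (h \<omega>) \<partial>M) = 0"
    and F[measurable]: "F \<in> borel_measurable (Pi\<^sub>M UNIV (\<lambda>_. borel))"
    and int: "integrable M (\<lambda>\<omega>. F (\<lambda>t. \<xi> t \<omega>) * h \<omega>)"
  shows "(\<integral>\<omega>. F (\<lambda>t. \<xi> t \<omega>) * h \<omega> \<partial>M) = 0"
proof -
  note [measurable] = borel_measurable_integrable[OF h]
  \<comment> \<open>\<open>S\<close> holds the coordinates already converted to indicators. The
    frequencies s of the others stay arbitrary, since converting v uses the induction hypothesis for
    every frequency at v.\<close>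
  have boxes: "(\<integral>\<omega>. (\<Prod>t\<in>S. indicator (B t) (\<xi> t \<omega>)) *
      (iexp (\<Sum>t\<in>-S. s t * \<xi> t \<omega>) * complex_of_real (h \<omega>)) \<partial>M) = 0"
    if B: "\<And>t. B t \<in> sets borel" for S s and B :: "'t \<Rightarrow> real set"
  proof -
    have "finite S" by simp
    then show ?thesis
    proof (induction S arbitrary: s rule: finite_induct)
      case empty
      then show ?case using zero[of s] by simp
    next
      case (insert v S)
      define H where "H \<omega> = (\<Prod>t\<in>S. indicator (B t) (\<xi> t \<omega>)) *
        (iexp (\<Sum>t\<in>-insert v S. s t * \<xi> t \<omega>) * complex_of_real (h \<omega>))" for \<omega>
      have [measurable]: "H \<in> borel_measurable M" unfolding H_def[abs_def] using B by measurable
      have "integrable M H"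
      proof (rule Bochner_Integration.integrable_bound[OF h])
        have "norm (H \<omega>) \<le> norm (h \<omega>)" for \<omega>
        proof -
          have "norm (\<Prod>t\<in>S. indicator (B t) (\<xi> t \<omega>) :: complex) \<le> 1"
            unfolding prod_norm[symmetric] by (intro prod_le_1) (auto split: split_indicator)
          then have "norm (\<Prod>t\<in>S. indicator (B t) (\<xi> t \<omega>) :: complex) * \<bar>h \<omega>\<bar> \<le> 1 * \<bar>h \<omega>\<bar>"
            by (rule mult_right_mono) simp
          then show ?thesis by (simp add: H_def norm_mult)
        qed
        then show "AE \<omega> in M. norm (H \<omega>) \<le> norm (h \<omega>)" by simp
      qed simp
      moreover have "(\<integral>\<omega>. iexp (x * \<xi> v \<omega>) * H \<omega> \<partial>M) = 0" for x
      proof -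
        have "-S = insert v (-insert v S)" using insert by auto
        then have "(\<Sum>t\<in>-S. (s(v := x)) t * \<xi> t \<omega>) =
            x * \<xi> v \<omega> + (\<Sum>t\<in>-insert v S. s t * \<xi> t \<omega>)" for \<omega>
          by (simp add: sum.insert_remove)
        then have "iexp (x * \<xi> v \<omega>) * H \<omega> = (\<Prod>t\<in>S. indicator (B t) (\<xi> t \<omega>)) *
          (iexp (\<Sum>t\<in>-S. (s(v := x)) t * \<xi> t \<omega>) * complex_of_real (h \<omega>))" for \<omega>
          by (simp add: H_def exp_add distrib_left mult_ac)
        then show ?thesis using insert.IH[of "s(v := x)"] by simp
      qed
      ultimately have "(\<integral>\<omega>. indicator (B v) (\<xi> v \<omega>) * H \<omega> \<partial>M) = 0"
        using B by (intro fourier_unique) auto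
      moreover have "indicator (B v) (\<xi> v \<omega>) * H \<omega> = (\<Prod>t\<in>insert v S. indicator (B t) (\<xi> t \<omega>)) *
        (iexp (\<Sum>t\<in>-insert v S. s t * \<xi> t \<omega>) * complex_of_real (h \<omega>))" for \<omega>
        unfolding H_def using insert by (simp add: mult.assoc)
      ultimately show ?case by simp
    qed
  qed
  define p where "p \<omega> = max (h \<omega>) 0" for \<omega>
  define n where "n \<omega> = max (- h \<omega>) 0" for \<omega>
  have [measurable]: "p \<in> borel_measurable M" "n \<in> borel_measurable M"
    unfolding p_def[abs_def] n_def[abs_def] by measurable
  have p0: "0 \<le> p \<omega>" and n0: "0 \<le> n \<omega>" and hpn: "h \<omega> = p \<omega> - n \<omega>" for \<omega>
    by (auto simp: p_def n_def)
  have pint: "integrable M p" and nint: "integrable M n"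
    unfolding p_def[abs_def] n_def[abs_def] using h by auto
  define X where "X \<omega> t = \<xi> t \<omega>" for \<omega> t
  have X[measurable]: "X \<in> measurable M (Pi\<^sub>M UNIV (\<lambda>_. borel))"
    unfolding X_def[abs_def] by (rule measurable_PiM_single') (auto simp: space_PiM)
  define \<mu> where "\<mu> f = distr (density M (\<lambda>\<omega>. ennreal (f \<omega>))) (Pi\<^sub>M UNIV (\<lambda>_. borel)) X"
    for f :: "'a \<Rightarrow> real"
  have emeas: "emeasure (\<mu> f) (Pi\<^sub>E UNIV B) = ennreal (\<integral>\<omega>. (\<Prod>t\<in>UNIV. indicator (B t) (\<xi> t \<omega>)) * f \<omega> \<partial>M)"
    and ibox: "integrable M (\<lambda>\<omega>. (\<Prod>t\<in>UNIV. indicator (B t) (\<xi> t \<omega>)) * f \<omega>)"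
    if [measurable]: "f \<in> borel_measurable M" and f: "\<And>\<omega>. 0 \<le> f \<omega>" "integrable M f"
      and B[measurable]: "\<And>t. B t \<in> sets borel" for f B
  proof -
    have ind: "indicator (X -` Pi\<^sub>E UNIV B \<inter> space M) \<omega> = (\<Prod>t\<in>UNIV. indicator (B t) (\<xi> t \<omega>) :: real)"
      if "\<omega> \<in> space M" for \<omega>
    proof (cases "\<forall>t. \<xi> t \<omega> \<in> B t")
      case True
      then show ?thesis using that by (auto simp: X_def indicator_def PiE_def)
    next
      case False
      then obtain t where "\<xi> t \<omega> \<notin> B t" by auto
      then have "(\<Prod>t\<in>UNIV. indicator (B t) (\<xi> t \<omega>) :: real) = 0" by (intro prod_zero bexI[of _ t]) auto
      then show ?thesis using False that by (auto simp: X_def indicator_def PiE_def)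
    qed
    have PB[measurable]: "Pi\<^sub>E UNIV B \<in> sets (Pi\<^sub>M UNIV (\<lambda>_. borel :: real measure))"
      by (rule sets_PiM_I_finite) auto
    have 0: "0 \<le> (\<Prod>t\<in>UNIV. indicator (B t) (\<xi> t \<omega>) :: real)"
       "(\<Prod>t\<in>UNIV. indicator (B t) (\<xi> t \<omega>) :: real) \<le> 1" for \<omega>
      by (auto intro!: prod_nonneg prod_le_1 split: split_indicator)
    show ib: "integrable M (\<lambda>\<omega>. (\<Prod>t\<in>UNIV. indicator (B t) (\<xi> t \<omega>)) * f \<omega>)"
    proof (rule Bochner_Integration.integrable_bound[OF f(2)])
      show "AE \<omega> in M. norm ((\<Prod>t\<in>UNIV. indicator (B t) (\<xi> t \<omega>)) * f \<omega>) \<le> norm (f \<omega>)"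
        using 0 f(1) by (auto simp: abs_mult intro!: AE_I2 mult_left_le_one_le)
    qed measurable
    have "emeasure (\<mu> f) (Pi\<^sub>E UNIV B) = (\<integral>\<^sup>+\<omega>. ennreal (f \<omega>) * indicator (X -` Pi\<^sub>E UNIV B \<inter> space M) \<omega> \<partial>M)"
      unfolding \<mu>_def by (subst emeasure_distr) (simp_all add: emeasure_density)
    also have "\<dots> = (\<integral>\<^sup>+\<omega>. ennreal ((\<Prod>t\<in>UNIV. indicator (B t) (\<xi> t \<omega>)) * f \<omega>) \<partial>M)"
      using f 0 by (intro nn_integral_cong)
        (simp add: ind[symmetric] ennreal_mult' ennreal_indicator[symmetric] mult.commute)
    also have "\<dots> = ennreal (\<integral>\<omega>. (\<Prod>t\<in>UNIV. indicator (B t) (\<xi> t \<omega>)) * f \<omega> \<partial>M)"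
      using f 0 ib by (intro nn_integral_eq_integral) auto
    finally show "emeasure (\<mu> f) (Pi\<^sub>E UNIV B) =
      ennreal (\<integral>\<omega>. (\<Prod>t\<in>UNIV. indicator (B t) (\<xi> t \<omega>)) * f \<omega> \<partial>M)" .
  qed
  have fin: "emeasure (\<mu> f) (space (Pi\<^sub>M UNIV (\<lambda>_. borel))) \<noteq> \<infinity>"
    if [measurable]: "f \<in> borel_measurable M" and f: "\<And>\<omega>. 0 \<le> f \<omega>" "integrable M f" for f
  proof -
    have "emeasure (\<mu> f) (space (Pi\<^sub>M UNIV (\<lambda>_. borel))) = (\<integral>\<^sup>+\<omega>. ennreal (f \<omega>) \<partial>M)"
      unfolding \<mu>_def using measurable_space[OF X]
      by (subst emeasure_distr) (auto simp: emeasure_density intro!: nn_integral_cong split: split_indicator)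
    also have "\<dots> = ennreal (\<integral>\<omega>. f \<omega> \<partial>M)"
      using f by (intro nn_integral_eq_integral) auto
    finally show "emeasure (\<mu> f) (space (Pi\<^sub>M UNIV (\<lambda>_. borel))) \<noteq> \<infinity>" by simp
  qed
  have eq: "\<mu> p = \<mu> n"
  proof (rule measure_eqI_PiM_finite[where I=UNIV and M="\<lambda>_. borel" and A="\<lambda>_. space (Pi\<^sub>M UNIV (\<lambda>_. borel))"])
    fix B :: "'t \<Rightarrow> real set" assume "\<And>i. i \<in> UNIV \<Longrightarrow> B i \<in> sets borel"
    then have B: "\<And>t. B t \<in> sets borel" by simp
    have "(\<integral>\<omega>. (\<Prod>t\<in>UNIV. indicator (B t) (\<xi> t \<omega>)) * h \<omega> \<partial>M) = 0"
    proof -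
      have "(\<integral>\<omega>. complex_of_real ((\<Prod>t\<in>UNIV. indicator (B t) (\<xi> t \<omega>)) * h \<omega>) \<partial>M) =
         (\<integral>\<omega>. (\<Prod>t\<in>UNIV. indicator (B t) (\<xi> t \<omega>)) * complex_of_real (h \<omega>) \<partial>M)"
        by (intro Bochner_Integration.integral_cong refl)
          (auto intro!: arg_cong2[where f="(*)"] prod.cong split: split_indicator)
      also have "\<dots> = 0" using boxes[of B UNIV, OF B] by simp
      finally show ?thesis by (simp only: integral_complex_of_real of_real_eq_0_iff)
    qed
    then have "(\<integral>\<omega>. (\<Prod>t\<in>UNIV. indicator (B t) (\<xi> t \<omega>)) * p \<omega> \<partial>M) =
        (\<integral>\<omega>. (\<Prod>t\<in>UNIV. indicator (B t) (\<xi> t \<omega>)) * n \<omega> \<partial>M)"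
      using ibox[of p B, OF _ p0 pint B] ibox[of n B, OF _ n0 nint B] by (simp add: hpn right_diff_distrib)
    then show "emeasure (\<mu> p) (Pi\<^sub>E UNIV B) = emeasure (\<mu> n) (Pi\<^sub>E UNIV B)"
      using emeas[of p B, OF _ p0 pint B] emeas[of n B, OF _ n0 nint B] by simp
  next
    have "(\<Pi>\<^sub>E t\<in>UNIV. space borel) \<in> prod_algebra UNIV (\<lambda>_ :: 't. borel :: real measure)"
      by (rule prod_algebraI_finite) auto
    then show "range (\<lambda>_. space (Pi\<^sub>M UNIV (\<lambda>_. borel))) \<subseteq> prod_algebra UNIV (\<lambda>_ :: 't. borel :: real measure)"
      by (auto simp: space_PiM)
  qed (use fin[of p, OF _ p0 pint] in \<open>auto simp: \<mu>_def space_PiM\<close>)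
  have val: "(\<integral>x. F x \<partial>\<mu> f) = (\<integral>\<omega>. F (\<lambda>t. \<xi> t \<omega>) * f \<omega> \<partial>M)"
    if [measurable]: "f \<in> borel_measurable M" and f: "\<And>\<omega>. 0 \<le> f \<omega>" for f
  proof -
    have "(\<integral>x. F x \<partial>\<mu> f) = (\<integral>\<omega>. F (X \<omega>) \<partial>density M (\<lambda>\<omega>. ennreal (f \<omega>)))"
      unfolding \<mu>_def by (rule integral_distr) auto
    also have "\<dots> = (\<integral>\<omega>. f \<omega> *\<^sub>R F (X \<omega>) \<partial>M)"
      using f by (intro integral_density) auto
    finally show ?thesis by (simp add: X_def[abs_def] mult.commute)
  qed
  have [measurable]: "(\<lambda>\<omega>. F (\<lambda>t. \<xi> t \<omega>)) \<in> borel_measurable M"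
    using measurable_compose[OF X F] by (simp add: X_def[abs_def])
  have "integrable M (\<lambda>\<omega>. F (\<lambda>t. \<xi> t \<omega>) * p \<omega>)" "integrable M (\<lambda>\<omega>. F (\<lambda>t. \<xi> t \<omega>) * n \<omega>)"
  proof -
    have "\<bar>p \<omega>\<bar> \<le> \<bar>h \<omega>\<bar>" "\<bar>n \<omega>\<bar> \<le> \<bar>h \<omega>\<bar>" for \<omega> by (auto simp: p_def n_def)
    then show "integrable M (\<lambda>\<omega>. F (\<lambda>t. \<xi> t \<omega>) * p \<omega>)" "integrable M (\<lambda>\<omega>. F (\<lambda>t. \<xi> t \<omega>) * n \<omega>)"
      by (auto simp: abs_mult intro!: Bochner_Integration.integrable_bound[OF int] mult_left_mono AE_I2)
  qed
  then show ?thesis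
    using val[of p] val[of n] p0 n0 eq by (simp add: hpn right_diff_distrib)
qed

end

section \<open>Hermite moments against characters\<close>

text \<open>The second-order Taylor bound for the exponential controls the remainder by (s - t)^2
  times half the mean of |V| Y^2. This is why a second moment is assumed for a first
  derivative.\<close>

lemma (in prob_space) has_vector_derivative_integral_iexp:
  fixes V :: "'a \<Rightarrow> complex"
  assumes Y[measurable]: "Y \<in> borel_measurable M"
    and V: "integrable M V" "integrable M (\<lambda>\<omega>. V \<omega> * complex_of_real (Y \<omega>))"
      "integrable M (\<lambda>\<omega>. V \<omega> * complex_of_real ((Y \<omega>)\<^sup>2))"
  shows "((\<lambda>t. \<integral>\<omega>. V \<omega> * iexp (t * Y \<omega>) \<partial>M) has_vector_derivative
     (\<integral>\<omega>. \<i> * (V \<omega> * complex_of_real (Y \<omega>)) * iexp (t * Y \<omega>) \<partial>M)) (at t)"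
proof -
  note [measurable] = borel_measurable_integrable[OF V(1)]
  define K where "K = (\<integral>\<omega>. norm (V \<omega> * complex_of_real ((Y \<omega>)\<^sup>2)) \<partial>M) / 2"
  let ?f = "\<lambda>t. \<integral>\<omega>. V \<omega> * iexp (t * Y \<omega>) \<partial>M"
  let ?D = "\<integral>\<omega>. \<i> * (V \<omega> * complex_of_real (Y \<omega>)) * iexp (t * Y \<omega>) \<partial>M"
  have i1: "integrable M (\<lambda>\<omega>. V \<omega> * iexp (s * Y \<omega>))" for s
    by (intro Bochner_Integration.integrable_bound[OF V(1)]) (auto simp: norm_mult)
  have i2: "integrable M (\<lambda>\<omega>. \<i> * (V \<omega> * complex_of_real (Y \<omega>)) * iexp (t * Y \<omega>))"
    by (intro Bochner_Integration.integrable_bound[OF V(2)]) (auto simp: norm_mult)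
  have i3: "integrable M (\<lambda>\<omega>. norm (V \<omega> * complex_of_real ((Y \<omega>)\<^sup>2)))"
    using V(3) by (rule integrable_norm)
  have est: "norm (?f s - (?f t + (s - t) *\<^sub>R ?D)) \<le> (s - t)\<^sup>2 * K" for s
  proof -
    have eq: "?f s - (?f t + (s - t) *\<^sub>R ?D) =
      (\<integral>\<omega>. V \<omega> * iexp (s * Y \<omega>) - (V \<omega> * iexp (t * Y \<omega>) +
         (s - t) *\<^sub>R (\<i> * (V \<omega> * complex_of_real (Y \<omega>)) * iexp (t * Y \<omega>))) \<partial>M)"
      using i1[of s] i1[of t] i2 by simp
    have "norm (?f s - (?f t + (s - t) *\<^sub>R ?D)) \<le>
      (\<integral>\<omega>. (s - t)\<^sup>2 / 2 * norm (V \<omega> * complex_of_real ((Y \<omega>)\<^sup>2)) \<partial>M)"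
      unfolding eq
    proof (rule order_trans[OF Bochner_Integration.integral_norm_bound integral_mono])
      fix \<omega>
      define y where "y = Y \<omega>"
      have "V \<omega> * iexp (s * y) - (V \<omega> * iexp (t * y) + (s - t) *\<^sub>R (\<i> * (V \<omega> * complex_of_real y) * iexp (t * y))) =
         V \<omega> * iexp (t * y) * (iexp ((s - t) * y) - (\<Sum>k\<le>1. (\<i> * ((s - t) * y)) ^ k / fact k))"
      proof -
        have "iexp (s * y) = iexp (t * y) * iexp ((s - t) * y)"
          by (simp add: exp_add[symmetric] algebra_simps)
        then show ?thesis by (simp add: scaleR_conv_of_real algebra_simps)
      qed
      then have "norm (V \<omega> * iexp (s * y) - (V \<omega> * iexp (t * y) + (s - t) *\<^sub>R (\<i> * (V \<omega> * complex_of_real y) * iexp (t * y)))) =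
         norm (V \<omega>) * norm (iexp ((s - t) * y) - (\<Sum>k\<le>1. (\<i> * ((s - t) * y)) ^ k / fact k))"
        by (simp only: norm_mult norm_exp_i_times mult_1_right)
      also have "\<dots> \<le> norm (V \<omega>) * (\<bar>(s - t) * y\<bar> ^ Suc 1 / fact (Suc 1))"
        by (intro mult_left_mono iexp_approx1) simp
      also have "\<dots> = (s - t)\<^sup>2 / 2 * norm (V \<omega> * complex_of_real (y\<^sup>2))"
      proof -
        have "\<bar>(s - t) * y\<bar> ^ Suc 1 = (s - t)\<^sup>2 * y\<^sup>2"
          by (simp only: Suc_1 power2_abs power_mult_distrib)
        then show ?thesis by (simp add: norm_mult norm_power)
      qed
      finally show "norm (V \<omega> * iexp (s * Y \<omega>) - (V \<omega> * iexp (t * Y \<omega>) +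
         (s - t) *\<^sub>R (\<i> * (V \<omega> * complex_of_real (Y \<omega>)) * iexp (t * Y \<omega>))))
         \<le> (s - t)\<^sup>2 / 2 * norm (V \<omega> * complex_of_real ((Y \<omega>)\<^sup>2))"
        unfolding y_def .
    qed (use i1[of s] i1[of t] i2 i3 in \<open>auto intro!: integrable_norm\<close>)
    then show ?thesis by (simp add: K_def)
  qed
  show ?thesis
    unfolding has_vector_derivative_def has_derivative_at2
  proof (intro conjI)
    have lim: "((\<lambda>s. \<bar>s - t\<bar> * K) \<longlongrightarrow> 0) (at t)" by (auto intro!: tendsto_eq_intros)
    show "((\<lambda>s. (1 / norm (s - t)) *\<^sub>R (?f s - (?f t + (s - t) *\<^sub>R ?D))) \<longlongrightarrow> 0) (at t)"
    proof (rule Lim_null_comparison[OF _ lim])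
      have "norm ((1 / norm (s - t)) *\<^sub>R (?f s - (?f t + (s - t) *\<^sub>R ?D))) \<le> \<bar>s - t\<bar> * K" if "s \<noteq> t" for s
      proof -
        have "(s - t)\<^sup>2 = \<bar>s - t\<bar> * \<bar>s - t\<bar>" by (simp add: power2_eq_square)
        then have "norm (?f s - (?f t + (s - t) *\<^sub>R ?D)) \<le> \<bar>s - t\<bar> * (\<bar>s - t\<bar> * K)"
          using est[of s] by (simp add: mult.assoc)
        then have "norm (?f s - (?f t + (s - t) *\<^sub>R ?D)) / \<bar>s - t\<bar> \<le> \<bar>s - t\<bar> * K"
          using that by (simp add: pos_divide_le_eq mult_ac)
        then show ?thesis by (simp add: divide_inverse mult.commute)
      qed
      then show "eventually (\<lambda>s. norm ((1 / norm (s - t)) *\<^sub>R (?f s - (?f t + (s - t) *\<^sub>R ?D))) \<le> \<bar>s - t\<bar> * K) (at t)"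
        by (auto simp: eventually_at_filter)
    qed
  qed (rule bounded_linear_scaleR_left)
qed

text \<open>Differentiating the transform in t multiplies by i Y, and Y H_e = H_(e+1) + e H_(e-1),
  so the transform with H_(e+1) follows from the two preceding ones. In use, \<open>Z\<close>
  carries a character and the other Hermite factors, and \<open>\<kappa>\<close> is the covariance
  of \<open>Y\<close> with the exponent of that character.\<close>

lemma (in prob_space) hermite_character_moment:
  fixes Z :: "'a \<Rightarrow> complex" and C :: complex and \<kappa> :: real
  assumes Y: "Y \<in> borel_measurable M"
    and int: "\<And>p. integrable M (\<lambda>\<omega>. Z \<omega> * complex_of_real (poly p (Y \<omega>)))"
    and char: "\<And>t. (\<integral>\<omega>. Z \<omega> * iexp (t * Y \<omega>) \<partial>M) = C * exp (complex_of_real (- t\<^sup>2 / 2 - t * \<kappa>))"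
  shows "(\<integral>\<omega>. Z \<omega> * complex_of_real (poly (hermite d) (Y \<omega>)) * iexp (t * Y \<omega>) \<partial>M) =
     (\<i> * (\<kappa> + t)) ^ d * (C * exp (complex_of_real (- t\<^sup>2 / 2 - t * \<kappa>)))"
proof (induction d arbitrary: t rule: less_induct)
  case (less d)
  note Y[measurable]
  define E where "E t = C * exp (complex_of_real (- t\<^sup>2 / 2 - t * \<kappa>))" for t :: real
  define g where "g d t = (\<integral>\<omega>. Z \<omega> * complex_of_real (poly (hermite d) (Y \<omega>)) * iexp (t * Y \<omega>) \<partial>M)" for d t
  have IH: "g e t = (\<i> * (\<kappa> + t)) ^ e * E t" if "e < d" for e t
    using less[OF that, of t] by (simp add: g_def E_def)
  show ?case
  proof (cases d)
    case 0
    then show ?thesis using char[of t] by simp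
  next
    case (Suc e)
    have intI: "integrable M (\<lambda>\<omega>. Z \<omega> * complex_of_real (poly p (Y \<omega>)) * iexp (t * Y \<omega>))" for p
      by (intro Bochner_Integration.integrable_bound[OF int[of p]])
        (use borel_measurable_integrable[OF int[of p]] in \<open>auto simp: norm_mult\<close>)
    have "(g e has_vector_derivative
      (\<integral>\<omega>. \<i> * (Z \<omega> * complex_of_real (poly (hermite e) (Y \<omega>)) * complex_of_real (Y \<omega>)) * iexp (t * Y \<omega>) \<partial>M)) (at t)"
      unfolding g_def
      using int[of "hermite e"] int[of "hermite e * [:0, 1:]"] int[of "hermite e * [:0, 0, 1:]"]
      by (intro has_vector_derivative_integral_iexp)
         (simp_all add: mult_ac power2_eq_square)
    also have "(\<integral>\<omega>. \<i> * (Z \<omega> * complex_of_real (poly (hermite e) (Y \<omega>)) * complex_of_real (Y \<omega>)) * iexp (t * Y \<omega>) \<partial>M)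
       = \<i> * (g (Suc e) t + real e * g (e - 1) t)"
    proof -
      have "\<i> * (Z \<omega> * complex_of_real (poly (hermite e) (Y \<omega>)) * complex_of_real (Y \<omega>)) * iexp (t * Y \<omega>) =
         \<i> * (Z \<omega> * complex_of_real (poly (hermite (Suc e)) (Y \<omega>)) * iexp (t * Y \<omega>) +
           real e * (Z \<omega> * complex_of_real (poly (hermite (e - 1)) (Y \<omega>)) * iexp (t * Y \<omega>)))" for \<omega>
        by (simp only: hermite_rec[of e]) (simp add: algebra_simps)
      then have "(\<integral>\<omega>. \<i> * (Z \<omega> * complex_of_real (poly (hermite e) (Y \<omega>)) * complex_of_real (Y \<omega>)) * iexp (t * Y \<omega>) \<partial>M) =
        (\<integral>\<omega>. \<i> * (Z \<omega> * complex_of_real (poly (hermite (Suc e)) (Y \<omega>)) * iexp (t * Y \<omega>) +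
           real e * (Z \<omega> * complex_of_real (poly (hermite (e - 1)) (Y \<omega>)) * iexp (t * Y \<omega>))) \<partial>M)"
        by (simp only:)
      also have "\<dots> = \<i> * (g (Suc e) t + real e * g (e - 1) t)"
        using intI[of "hermite (Suc e)"] intI[of "hermite (e - 1)"] by (simp add: g_def del: hermite.simps)
      finally show ?thesis .
    qed
    finally have D1: "(g e has_vector_derivative \<i> * (g (Suc e) t + real e * g (e - 1) t)) (at t)" .
    have d1: "((\<lambda>z. (\<i> * (\<kappa> + z)) ^ e) has_field_derivative
       of_nat e * (\<i> * (\<kappa> + t)) ^ (e - 1) * \<i>) (at (complex_of_real t))"
      by (auto intro!: derivative_eq_intros)
    have d2: "((\<lambda>z. C * exp (- z\<^sup>2 / 2 - z * \<kappa>)) has_field_derivative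
       C * (exp (- (complex_of_real t)\<^sup>2 / 2 - t * \<kappa>) * (- (t + \<kappa>)))) (at (complex_of_real t))"
      by (auto intro!: derivative_eq_intros)
    have "((\<lambda>z. (\<i> * (\<kappa> + z)) ^ e * (C * exp (- z\<^sup>2 / 2 - z * \<kappa>))) has_field_derivative
       (of_nat e * (\<i> * (\<kappa> + t)) ^ (e - 1) * \<i> * E t + (\<i> * (\<kappa> + t)) ^ e * (E t * (- (t + \<kappa>))))) (at (complex_of_real t))"
      using DERIV_mult[OF d1 d2] by (simp add: E_def mult_ac)
    from has_vector_derivative_real_field[OF this]
    have "((\<lambda>s. (\<i> * (\<kappa> + s)) ^ e * E s) has_vector_derivative
       (of_nat e * (\<i> * (\<kappa> + t)) ^ (e - 1) * \<i> * E t + (\<i> * (\<kappa> + t)) ^ e * (E t * (- (t + \<kappa>))))) (at t)"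
      by (simp add: E_def)
    moreover have "g e = (\<lambda>s. (\<i> * (\<kappa> + s)) ^ e * E s)" using IH Suc by auto
    ultimately have D2: "(g e has_vector_derivative
       (of_nat e * (\<i> * (\<kappa> + t)) ^ (e - 1) * \<i> * E t + (\<i> * (\<kappa> + t)) ^ e * (E t * (- (t + \<kappa>))))) (at t)"
      by simp
    have "\<i> * (g (Suc e) t + real e * g (e - 1) t) =
       of_nat e * (\<i> * (\<kappa> + t)) ^ (e - 1) * \<i> * E t + (\<i> * (\<kappa> + t)) ^ e * (E t * (- (t + \<kappa>)))"
      by (rule vector_derivative_unique_at[OF D1 D2])
    \<comment> \<open>The term from differentiating the power cancels against the lower Hermite
      term; what survives is the derivative of the Gaussian factor, which supplies one more factor
      \<open>\<kappa> + t\<close>. For e = 0 both sides here are 0.\<close>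
    moreover have "real e * g (e - 1) t = of_nat e * (\<i> * (\<kappa> + t)) ^ (e - 1) * E t"
      using IH[of "e - 1" t] Suc by simp
    moreover have "\<i> * a = r" if "\<i> * (a + b) = x * \<i> * y + r" "b = x * y" for a b x y r :: complex
      using that by (simp add: distrib_left mult_ac)
    ultimately have "\<i> * g (Suc e) t = (\<i> * (\<kappa> + t)) ^ e * (E t * (- (t + \<kappa>)))"
      by blast
    then have "\<i> * g (Suc e) t = \<i> * ((\<i> * (\<kappa> + t)) ^ Suc e * E t)"
      by (simp add: algebra_simps)
    then have "g (Suc e) t = (\<i> * (\<kappa> + t)) ^ Suc e * E t" by (subst (asm) mult_cancel_left) simp
    then show ?thesis by (simp only: Suc g_def E_def)
  qed
qed

section \<open>Homogeneous polynomial functions\<close>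

definition homogeneous :: "nat \<Rightarrow> (('t::finite \<Rightarrow> real) \<Rightarrow> real) set" where
  "homogeneous q = {f. \<exists>b. \<forall>s. f s = (\<Sum>p\<in>multi_index q. b p * (\<Prod>t\<in>UNIV. s t ^ p t))}"

lemma homogeneous_lincomb:
  assumes "f \<in> homogeneous q" "g \<in> homogeneous q"
  shows "(\<lambda>s. c * f s + d * g s) \<in> homogeneous q"
proof -
  obtain b b' where "\<And>s. f s = (\<Sum>p\<in>multi_index q. b p * (\<Prod>t\<in>UNIV. s t ^ p t))"
    "\<And>s. g s = (\<Sum>p\<in>multi_index q. b' p * (\<Prod>t\<in>UNIV. s t ^ p t))"
    using assms unfolding homogeneous_def by auto
  then have "c * f s + d * g s = (\<Sum>p\<in>multi_index q. (c * b p + d * b' p) * (\<Prod>t\<in>UNIV. s t ^ p t))" for s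
    by (simp add: sum_distrib_left distrib_right sum.distrib mult.assoc)
  then show ?thesis
    unfolding homogeneous_def by (intro CollectI exI[of _ "\<lambda>p. c * b p + d * b' p"]) simp
qed

lemma homogeneous_zero: "(\<lambda>_. 0) \<in> homogeneous q"
  unfolding homogeneous_def by (intro CollectI exI[of _ "\<lambda>_. 0"]) simp

lemma homogeneous_sum:
  assumes "finite I" "\<And>i. i \<in> I \<Longrightarrow> f i \<in> homogeneous q"
  shows "(\<lambda>s. \<Sum>i\<in>I. c i * f i s) \<in> homogeneous q"
  using assms
proof (induction I rule: finite_induct)
  case (insert i I)
  then show ?case
    using homogeneous_lincomb[of "f i" q "\<lambda>s. \<Sum>i\<in>I. c i * f i s" "c i" 1] by simp
qed (simp add: homogeneous_zero)

lemma homogeneous_monomial: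
  assumes "p \<in> multi_index q" shows "(\<lambda>s. \<Prod>t\<in>UNIV. s t ^ p t) \<in> homogeneous q"
  unfolding homogeneous_def
proof (intro CollectI exI[of _ "\<lambda>p'. if p' = p then 1 else 0"] allI)
  fix s :: "'a \<Rightarrow> real"
  have "(\<Sum>p'\<in>multi_index q. (if p' = p then 1 else 0) * (\<Prod>t\<in>UNIV. s t ^ p' t)) =
      (\<Sum>p'\<in>multi_index q. if p' = p then (\<Prod>t\<in>UNIV. s t ^ p t) else 0)"
    by (intro sum.cong) auto
  then show "(\<Prod>t\<in>UNIV. s t ^ p t) = (\<Sum>p'\<in>multi_index q. (if p' = p then 1 else 0) * (\<Prod>t\<in>UNIV. s t ^ p' t))"
    using assms by simp
qed

text \<open>Multiplying a monomial by one coordinate raises one exponent by one; a linear form is a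
  combination of such multiplications.\<close>

lemma homogeneous_linear_mult:
  assumes "f \<in> homogeneous q"
  shows "(\<lambda>s. (\<Sum>t\<in>UNIV. r t * s t) * f s) \<in> homogeneous (Suc q)"
proof -
  obtain b where b: "\<And>s. f s = (\<Sum>p\<in>multi_index q. b p * (\<Prod>t\<in>UNIV. s t ^ p t))"
    using assms unfolding homogeneous_def by auto
  have mono: "(\<lambda>s. \<Prod>v\<in>UNIV. s v ^ (p(t := Suc (p t))) v) \<in> homogeneous (Suc q)"
    if "p \<in> multi_index q" for p :: "'a \<Rightarrow> nat" and t
  proof (rule homogeneous_monomial)
    show "p(t := Suc (p t)) \<in> multi_index (Suc q)"
      using that by (simp add: multi_index_def sum.remove[of UNIV t])
  qed
  have shift: "(\<Prod>v\<in>UNIV. s v ^ (p(t := Suc (p t))) v) = s t * (\<Prod>v\<in>UNIV. s v ^ p v)"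
    for p :: "'a \<Rightarrow> nat" and t and s :: "'a \<Rightarrow> real"
    by (simp add: prod.remove[of UNIV t])
  have "(\<Sum>t\<in>UNIV. r t * s t) * f s =
      (\<Sum>t\<in>UNIV. r t * (\<Sum>p\<in>multi_index q. b p * (\<Prod>v\<in>UNIV. s v ^ (p(t := Suc (p t))) v)))" for s
  proof -
    have "(\<Sum>t\<in>UNIV. r t * s t) * f s = (\<Sum>t\<in>UNIV. r t * (s t * f s))"
      by (simp add: sum_distrib_right mult.assoc)
    also have "\<dots> = (\<Sum>t\<in>UNIV. r t * (\<Sum>p\<in>multi_index q. b p * (s t * (\<Prod>v\<in>UNIV. s v ^ p v))))"
      by (simp only: b) (simp only: sum_distrib_left mult.left_commute)
    finally show ?thesis unfolding shift .
  qed
  moreover have "(\<lambda>s. \<Sum>t\<in>UNIV. r t * (\<Sum>p\<in>multi_index q. b p * (\<Prod>v\<in>UNIV. s v ^ (p(t := Suc (p t))) v)))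
      \<in> homogeneous (Suc q)"
    by (intro homogeneous_sum mono) auto
  ultimately show ?thesis by simp
qed

text \<open>Products of powers of linear forms are what characters yield when paired with a chaos
  generator. Expanding them into monomials provides the coefficients of the replacement in
  \<open>chaos_kernel\<close>.\<close>

lemma homogeneous_prod_linear:
  assumes "finite A"
  shows "(\<lambda>s. \<Prod>a\<in>A. (\<Sum>t\<in>UNIV. r a t * s t) ^ d a) \<in> homogeneous (\<Sum>a\<in>A. d a)"
  using assms
proof (induction A rule: finite_induct)
  case empty
  have "(\<lambda>s. \<Prod>t\<in>UNIV. s t ^ (\<lambda>_. 0) t) \<in> (homogeneous 0 :: (('b \<Rightarrow> real) \<Rightarrow> real) set)"
    by (rule homogeneous_monomial) (simp add: multi_index_def)
  then show ?case by simp
next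
  case (insert a A)
  have "(\<lambda>s. (\<Sum>t\<in>UNIV. r a t * s t) ^ n * (\<Prod>a\<in>A. (\<Sum>t\<in>UNIV. r a t * s t) ^ d a))
      \<in> homogeneous (n + (\<Sum>a\<in>A. d a))" for n
  proof (induction n)
    case (Suc n)
    from homogeneous_linear_mult[OF this, of "r a"] show ?case by (simp add: mult.assoc)
  qed (use insert in simp)
  then show ?case using insert by simp
qed

lemma prod_i_power:
  "(\<Prod>a\<in>I. (\<i> * complex_of_real (x a)) ^ n a) = \<i> ^ (\<Sum>a\<in>I. n a) * complex_of_real (\<Prod>a\<in>I. x a ^ n a)"
  by (simp add: power_mult_distrib prod.distrib power_sum)

section \<open>Gaussian Hilbert spaces and their chaoses\<close>

context prob_space
begin

lemma std_gaussian_vector_subset: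
  "std_gaussian_vector M T Y \<Longrightarrow> A \<subseteq> T \<Longrightarrow> std_gaussian_vector M A Y"
  unfolding std_gaussian_vector_def
  by (auto intro: indep_vars_subset finite_subset)

lemma gauss_int_X: "gauss_int [:0, 1:] = 0" "gauss_int [:0, 0, 1:] = 1"
  using gauss_int_hermite_mult[of 1 0] gauss_int_hermite_mult[of 1 1] by (simp_all add: mult.commute)

lemma std_gaussian_vector_cov:
  assumes Y: "std_gaussian_vector M T Y" and ab: "a \<in> T" "b \<in> T"
  shows "(\<integral>\<omega>. Y a \<omega> * Y b \<omega> \<partial>M) = (if a = b then 1 else 0)"
proof (cases "a = b")
  case True
  have "std_gaussian_vector M {a} Y" by (rule std_gaussian_vector_subset[OF Y]) (use ab in auto)
  from std_gaussian_vector_poly(2)[OF this, of "\<lambda>_. [:0, 0, 1:]"] True show ?thesis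
    by (simp add: gauss_int_X)
next
  case False
  have "std_gaussian_vector M {a, b} Y" by (rule std_gaussian_vector_subset[OF Y]) (use ab in auto)
  from std_gaussian_vector_poly(2)[OF this, of "\<lambda>_. [:0, 1:]"] False show ?thesis
    by (simp add: gauss_int_X)
qed

lemma std_gaussian_vector_L2:
  assumes Y: "std_gaussian_vector M T Y" and a: "a \<in> T"
  shows "Y a \<in> L2_space M"
proof -
  have "std_gaussian_vector M {a} Y" by (rule std_gaussian_vector_subset[OF Y]) (use a in auto)
  from std_gaussian_vector_poly_L2[OF this, of "\<lambda>_. [:0, 1:]"] show ?thesis by simp
qed

end

text \<open>Together with linearity, the character identity says that all finite subfamilies are
  centred and jointly Gaussian. It is chosen over a statement about densities because it covers
  degenerate variables and survives L2 limits.\<close>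

locale gauss_hilbert = prob_space M for M :: "'w measure" +
  fixes \<GG> :: "('w \<Rightarrow> real) set"
  assumes sub_L2: "\<GG> \<subseteq> L2_space M"
    and zero_mem: "(\<lambda>_. 0) \<in> \<GG>"
    and lincomb_mem: "\<And>f g a b. f \<in> \<GG> \<Longrightarrow> g \<in> \<GG> \<Longrightarrow> (\<lambda>\<omega>. a * f \<omega> + b * g \<omega>) \<in> \<GG>"
    and character: "\<And>U. U \<in> \<GG> \<Longrightarrow>
      (\<integral>\<omega>. iexp (U \<omega>) \<partial>M) = exp (complex_of_real (- (\<integral>\<omega>. (U \<omega>)\<^sup>2 \<partial>M) / 2))"
begin

lemma sum_mem:
  "finite I \<Longrightarrow> (\<And>i. i \<in> I \<Longrightarrow> f i \<in> \<GG>) \<Longrightarrow> (\<lambda>\<omega>. \<Sum>i\<in>I. c i * f i \<omega>) \<in> \<GG>"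
proof (induction I rule: finite_induct)
  case (insert i I)
  then show ?case using lincomb_mem[of "f i" "\<lambda>\<omega>. \<Sum>i\<in>I. c i * f i \<omega>" "c i" 1] by simp
qed (simp add: zero_mem)

text \<open>One Hermite factor is added at a time by \<open>hermite_character_moment\<close>. Its
  transform variable t shifts \<open>U\<close> to \<open>U + t * Y b\<close>, which is why
  \<open>U\<close> is generalised: the shift leaves the covariances with the other
  \<open>Y a\<close> unchanged by orthogonality, and changes the variance by 2 t \<kappa> + t^2,
  giving the Gaussian factor required.\<close>

lemma hermite_product_character:
  assumes Y: "std_gaussian_vector M T Y" and YG: "\<And>a. a \<in> T \<Longrightarrow> Y a \<in> \<GG>"
    and A: "finite A" "A \<subseteq> T" and U: "U \<in> \<GG>"
  shows "(\<integral>\<omega>. iexp (U \<omega>) * complex_of_real (\<Prod>a\<in>A. poly (hermite (d a)) (Y a \<omega>)) \<partial>M) =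
    exp (complex_of_real (- (\<integral>\<omega>. (U \<omega>)\<^sup>2 \<partial>M) / 2)) *
      (\<Prod>a\<in>A. (\<i> * complex_of_real (\<integral>\<omega>. U \<omega> * Y a \<omega> \<partial>M)) ^ d a)"
  using A U
proof (induction A arbitrary: U rule: finite_induct)
  case empty
  then show ?case using character by simp
next
  case (insert b A)
  note UL = subsetD[OF sub_L2 insert.prems(2)]
  have bT: "b \<in> T" using insert by auto
  note YbL = std_gaussian_vector_L2[OF Y bT]
  note [measurable] = L2_spaceD(1)[OF UL] L2_spaceD(1)[OF YbL]
  have m: "Y a \<in> borel_measurable M" if "a \<in> A" for a
    using std_gaussian_vector_measurable[OF Y, of a] that insert by auto
  define P where "P \<omega> = (\<Prod>a\<in>A. poly (hermite (d a)) (Y a \<omega>))" for \<omega>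
  have [measurable]: "P \<in> borel_measurable M"
    unfolding P_def[abs_def]
    by (intro borel_measurable_prod measurable_compose[OF _ borel_measurable_poly] m)
  define \<kappa> where "\<kappa> = (\<integral>\<omega>. U \<omega> * Y b \<omega> \<partial>M)"
  define Q where "Q = (\<Prod>a\<in>A. (\<i> * complex_of_real (\<integral>\<omega>. U \<omega> * Y a \<omega> \<partial>M)) ^ d a)"
  define C where "C = exp (complex_of_real (- (\<integral>\<omega>. (U \<omega>)\<^sup>2 \<partial>M) / 2)) * Q"
  have main: "(\<integral>\<omega>. (iexp (U \<omega>) * complex_of_real (P \<omega>)) * complex_of_real (poly (hermite (d b)) (Y b \<omega>)) *
      iexp (0 * Y b \<omega>) \<partial>M) = (\<i> * complex_of_real (\<kappa> + 0)) ^ d b * (C * exp (complex_of_real (- 0\<^sup>2 / 2 - 0 * \<kappa>)))"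
  proof (rule hermite_character_moment)
    fix p
    have "std_gaussian_vector M (insert b A) Y"
      by (rule std_gaussian_vector_subset[OF Y]) (use insert in auto)
    from std_gaussian_vector_poly(1)[OF this, of "\<lambda>a. if a = b then p else hermite (d a)"]
    have "integrable M (\<lambda>\<omega>. poly p (Y b \<omega>) * (\<Prod>a\<in>A. poly (if a = b then p else hermite (d a)) (Y a \<omega>)))"
      using insert by simp
    moreover have "(\<Prod>a\<in>A. poly (if a = b then p else hermite (d a)) (Y a \<omega>)) = P \<omega>" for \<omega>
      unfolding P_def using insert by (intro prod.cong) auto
    ultimately have int: "integrable M (\<lambda>\<omega>. poly p (Y b \<omega>) * P \<omega>)" by simp
    show "integrable M (\<lambda>\<omega>. iexp (U \<omega>) * complex_of_real (P \<omega>) * complex_of_real (poly p (Y b \<omega>)))"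
    proof (rule Bochner_Integration.integrable_bound[OF int])
      have [measurable]: "(\<lambda>\<omega>. poly p (Y b \<omega>)) \<in> borel_measurable M"
        by (rule measurable_compose[OF L2_spaceD(1)[OF YbL] borel_measurable_poly])
      show "(\<lambda>\<omega>. iexp (U \<omega>) * complex_of_real (P \<omega>) * complex_of_real (poly p (Y b \<omega>))) \<in> borel_measurable M"
        by measurable
    qed (simp add: norm_mult abs_mult mult.commute)
  next
    fix t
    define U' where "U' \<omega> = 1 * U \<omega> + t * Y b \<omega>" for \<omega>
    have U'G: "U' \<in> \<GG>" unfolding U'_def[abs_def] by (intro lincomb_mem insert.prems YG bT)
    have cov: "(\<integral>\<omega>. U' \<omega> * Y a \<omega> \<partial>M) = (\<integral>\<omega>. U \<omega> * Y a \<omega> \<partial>M)" if "a \<in> A" for a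
    proof -
      have aT: "a \<in> T" and ab: "b \<noteq> a" using that insert by auto
      note YaL = std_gaussian_vector_L2[OF Y aT]
      have "(\<integral>\<omega>. U' \<omega> * Y a \<omega> \<partial>M) = (\<integral>\<omega>. U \<omega> * Y a \<omega> + t * (Y b \<omega> * Y a \<omega>) \<partial>M)"
        by (simp add: U'_def algebra_simps)
      also have "\<dots> = (\<integral>\<omega>. U \<omega> * Y a \<omega> \<partial>M)"
        using L2_mult_integrable[OF UL YaL] L2_mult_integrable[OF YbL YaL]
          std_gaussian_vector_cov[OF Y bT aT] ab by simp
      finally show ?thesis .
    qed
    have sq: "(\<integral>\<omega>. (U' \<omega>)\<^sup>2 \<partial>M) = (\<integral>\<omega>. (U \<omega>)\<^sup>2 \<partial>M) + 2 * t * \<kappa> + t\<^sup>2"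
    proof -
      have "(\<integral>\<omega>. (U' \<omega>)\<^sup>2 \<partial>M) =
        (\<integral>\<omega>. (U \<omega>)\<^sup>2 + (2 * t) * (U \<omega> * Y b \<omega>) + t\<^sup>2 * (Y b \<omega> * Y b \<omega>) \<partial>M)"
        by (simp add: U'_def algebra_simps power2_eq_square)
      also have "\<dots> = (\<integral>\<omega>. (U \<omega>)\<^sup>2 \<partial>M) + 2 * t * \<kappa> + t\<^sup>2"
        using L2_spaceD[OF UL] L2_mult_integrable[OF UL YbL] L2_mult_integrable[OF YbL YbL]
          std_gaussian_vector_cov[OF Y bT bT] by (simp add: \<kappa>_def)
      finally show ?thesis .
    qed
    have "(\<integral>\<omega>. iexp (U \<omega>) * complex_of_real (P \<omega>) * iexp (t * Y b \<omega>) \<partial>M) =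
        (\<integral>\<omega>. iexp (U' \<omega>) * complex_of_real (\<Prod>a\<in>A. poly (hermite (d a)) (Y a \<omega>)) \<partial>M)"
      by (intro Bochner_Integration.integral_cong refl)
        (simp add: U'_def P_def exp_add distrib_left mult_ac)
    also have "\<dots> = exp (complex_of_real (- (\<integral>\<omega>. (U' \<omega>)\<^sup>2 \<partial>M) / 2)) *
      (\<Prod>a\<in>A. (\<i> * complex_of_real (\<integral>\<omega>. U' \<omega> * Y a \<omega> \<partial>M)) ^ d a)"
      using insert U'G by (intro insert.IH) auto
    also have "(\<Prod>a\<in>A. (\<i> * complex_of_real (\<integral>\<omega>. U' \<omega> * Y a \<omega> \<partial>M)) ^ d a) = Q"
      unfolding Q_def by (intro prod.cong refl) (simp add: cov)
    also have "exp (complex_of_real (- (\<integral>\<omega>. (U' \<omega>)\<^sup>2 \<partial>M) / 2)) =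
      exp (complex_of_real (- (\<integral>\<omega>. (U \<omega>)\<^sup>2 \<partial>M) / 2)) * exp (complex_of_real (- t\<^sup>2 / 2 - t * \<kappa>))"
      unfolding sq by (simp add: exp_add[symmetric] add_divide_distrib diff_divide_distrib algebra_simps)
    finally show "(\<integral>\<omega>. iexp (U \<omega>) * complex_of_real (P \<omega>) * iexp (t * Y b \<omega>) \<partial>M) =
      C * exp (complex_of_real (- t\<^sup>2 / 2 - t * \<kappa>))"
      by (simp add: C_def mult_ac)
  qed measurable
  have "(\<integral>\<omega>. iexp (U \<omega>) * complex_of_real (\<Prod>a\<in>insert b A. poly (hermite (d a)) (Y a \<omega>)) \<partial>M) =
     (\<integral>\<omega>. (iexp (U \<omega>) * complex_of_real (P \<omega>)) * complex_of_real (poly (hermite (d b)) (Y b \<omega>)) * iexp (0 * Y b \<omega>) \<partial>M)"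
    using insert.hyps by (intro Bochner_Integration.integral_cong refl) (simp add: P_def mult_ac)
  also note main
  also have "(\<i> * complex_of_real (\<kappa> + 0)) ^ d b * (C * exp (complex_of_real (- 0\<^sup>2 / 2 - 0 * \<kappa>))) =
    exp (complex_of_real (- (\<integral>\<omega>. (U \<omega>)\<^sup>2 \<partial>M) / 2)) *
      (\<Prod>a\<in>insert b A. (\<i> * complex_of_real (\<integral>\<omega>. U \<omega> * Y a \<omega> \<partial>M)) ^ d a)"
    using insert.hyps by (simp add: C_def Q_def \<kappa>_def mult_ac)
  finally show ?case .
qed

text \<open>Paired with a character of \<open>\<xi>\<close>, the generator gives a product of powers
  of linear forms with covariances as coefficients, while \<open>multi_hermite p\<close> gives the
  monomial with exponents \<open>p\<close>, both times the same Gaussian factor. Expanding into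
  monomials thus yields a combination that represents the conditional expectation of the generator
  given \<open>\<xi>\<close>. The weights \<open>b\<close> depend on the generator alone, so one
  \<open>b\<close> serves all \<open>F\<close>.\<close>

lemma chaos_kernel:
  fixes \<xi> :: "'t::finite \<Rightarrow> 'w \<Rightarrow> real"
  assumes \<xi>: "std_gaussian_vector M UNIV \<xi>" and \<xi>G: "\<And>t. \<xi> t \<in> \<GG>"
    and Y: "std_gaussian_vector M T Y" and YG: "\<And>a. a \<in> T \<Longrightarrow> Y a \<in> \<GG>"
  obtains b where "\<And>F. F \<in> borel_measurable (Pi\<^sub>M UNIV (\<lambda>_. borel)) \<Longrightarrow>
      (\<lambda>\<omega>. F (\<lambda>t. \<xi> t \<omega>)) \<in> L2_space M \<Longrightarrow>
      (\<integral>\<omega>. F (\<lambda>t. \<xi> t \<omega>) * (\<Prod>a\<in>T. poly (hermite (d a)) (Y a \<omega>)) \<partial>M) =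
      (\<Sum>p\<in>multi_index (\<Sum>a\<in>T. d a). b p * (\<integral>\<omega>. F (\<lambda>t. \<xi> t \<omega>) * multi_hermite p (\<lambda>t. \<xi> t \<omega>) \<partial>M))"
proof -
  define q where "q = (\<Sum>a\<in>T. d a)"
  have finT: "finite T" using Y by (simp add: std_gaussian_vector_def)
  define r where "r a t = (\<integral>\<omega>. \<xi> t \<omega> * Y a \<omega> \<partial>M)" for a t
  from homogeneous_prod_linear[OF finT, of r d]
  obtain b where b: "\<And>s. (\<Prod>a\<in>T. (\<Sum>t\<in>UNIV. r a t * s t) ^ d a) =
      (\<Sum>p\<in>multi_index q. b p * (\<Prod>t\<in>UNIV. s t ^ p t))"
    unfolding homogeneous_def q_def by auto
  define P where "P \<omega> = (\<Prod>a\<in>T. poly (hermite (d a)) (Y a \<omega>))" for \<omega>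
  define R where "R \<omega> = (\<Sum>p\<in>multi_index q. b p * multi_hermite p (\<lambda>t. \<xi> t \<omega>))" for \<omega>
  define h where "h \<omega> = P \<omega> - R \<omega>" for \<omega>
  have PL: "P \<in> L2_space M" unfolding P_def[abs_def] by (rule std_gaussian_vector_poly_L2[OF Y])
  have HL: "(\<lambda>\<omega>. multi_hermite p (\<lambda>t. \<xi> t \<omega>)) \<in> L2_space M" for p
    by (rule multi_hermite_L2[OF \<xi>])
  have RL: "R \<in> L2_space M" unfolding R_def[abs_def] by (intro L2_sum HL) simp
  have hL: "h \<in> L2_space M" unfolding h_def[abs_def] by (intro L2_diff PL RL)
  have \<xi>L: "\<xi> t \<in> L2_space M" for t using \<xi>G sub_L2 by auto
  have iexp_int: "integrable M (\<lambda>\<omega>. iexp (U \<omega>) * complex_of_real (f \<omega>))"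
    if "U \<in> borel_measurable M" "f \<in> L2_space M" for U f
    by (intro Bochner_Integration.integrable_bound[OF L2_integrable[OF that(2)]])
      (use that L2_spaceD(1)[OF that(2)] in \<open>auto simp: norm_mult\<close>)
  have zero: "(\<integral>\<omega>. iexp (\<Sum>t\<in>UNIV. s t * \<xi> t \<omega>) * complex_of_real (h \<omega>) \<partial>M) = 0" for s
  proof -
    define U where "U \<omega> = (\<Sum>t\<in>UNIV. s t * \<xi> t \<omega>)" for \<omega>
    have UG: "U \<in> \<GG>" unfolding U_def[abs_def] by (intro sum_mem \<xi>G) simp
    then have Um: "U \<in> borel_measurable M" using sub_L2 by (auto dest: L2_spaceD)
    define e where "e = exp (complex_of_real (- (\<integral>\<omega>. (U \<omega>)\<^sup>2 \<partial>M) / 2))"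
    have UY: "(\<integral>\<omega>. U \<omega> * V \<omega> \<partial>M) = (\<Sum>t\<in>UNIV. s t * (\<integral>\<omega>. \<xi> t \<omega> * V \<omega> \<partial>M))"
      if V: "V \<in> L2_space M" for V
    proof -
      have "(\<integral>\<omega>. U \<omega> * V \<omega> \<partial>M) = (\<integral>\<omega>. (\<Sum>t\<in>UNIV. s t * (\<xi> t \<omega> * V \<omega>)) \<partial>M)"
        by (simp add: U_def sum_distrib_right mult.assoc)
      also have "\<dots> = (\<Sum>t\<in>UNIV. s t * (\<integral>\<omega>. \<xi> t \<omega> * V \<omega> \<partial>M))"
        using L2_mult_integrable[OF \<xi>L V] by (subst Bochner_Integration.integral_sum) auto
      finally show ?thesis .
    qed
    have UYa: "(\<integral>\<omega>. U \<omega> * Y a \<omega> \<partial>M) = (\<Sum>t\<in>UNIV. r a t * s t)" if "a \<in> T" for a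
      using UY[OF std_gaussian_vector_L2[OF Y that]] by (simp add: r_def mult.commute)
    have U\<xi>: "(\<integral>\<omega>. U \<omega> * \<xi> t \<omega> \<partial>M) = s t" for t
      using UY[OF \<xi>L[of t]] std_gaussian_vector_cov[OF \<xi>, of _ t] by (simp add: if_distrib cong: if_cong)
    have "(\<integral>\<omega>. iexp (U \<omega>) * complex_of_real (P \<omega>) \<partial>M) =
        e * (\<Prod>a\<in>T. (\<i> * complex_of_real (\<integral>\<omega>. U \<omega> * Y a \<omega> \<partial>M)) ^ d a)"
      unfolding P_def e_def using hermite_product_character[OF Y YG finT order_refl UG, of d] by simp
    also have "(\<Prod>a\<in>T. (\<i> * complex_of_real (\<integral>\<omega>. U \<omega> * Y a \<omega> \<partial>M)) ^ d a) =
        (\<Prod>a\<in>T. (\<i> * complex_of_real (\<Sum>t\<in>UNIV. r a t * s t)) ^ d a)"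
      by (intro prod.cong refl) (simp only: UYa)
    also have "\<dots> = \<i> ^ q * complex_of_real (\<Sum>p\<in>multi_index q. b p * (\<Prod>t\<in>UNIV. s t ^ p t))"
      by (simp only: prod_i_power b q_def[symmetric])
    finally have 1: "(\<integral>\<omega>. iexp (U \<omega>) * complex_of_real (P \<omega>) \<partial>M) =
      e * (\<i> ^ q * complex_of_real (\<Sum>p\<in>multi_index q. b p * (\<Prod>t\<in>UNIV. s t ^ p t)))" .
    have H: "(\<integral>\<omega>. iexp (U \<omega>) * complex_of_real (multi_hermite p (\<lambda>t. \<xi> t \<omega>)) \<partial>M) =
       e * (\<i> ^ q * complex_of_real (\<Prod>t\<in>UNIV. s t ^ p t))" if "p \<in> multi_index q" for p
    proof -
      have "(\<integral>\<omega>. iexp (U \<omega>) * complex_of_real (multi_hermite p (\<lambda>t. \<xi> t \<omega>)) \<partial>M) =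
          e * (\<Prod>t\<in>UNIV. (\<i> * complex_of_real (\<integral>\<omega>. U \<omega> * \<xi> t \<omega> \<partial>M)) ^ p t)"
        unfolding multi_hermite_def e_def
        using hermite_product_character[OF \<xi> \<xi>G finite[of UNIV] order_refl UG, of p] by simp
      also have "\<dots> = e * (\<i> ^ q * complex_of_real (\<Prod>t\<in>UNIV. s t ^ p t))"
        using that by (simp only: U\<xi> prod_i_power) (simp add: multi_index_def)
      finally show ?thesis .
    qed
    have "(\<integral>\<omega>. iexp (U \<omega>) * complex_of_real (R \<omega>) \<partial>M) =
      (\<integral>\<omega>. (\<Sum>p\<in>multi_index q. complex_of_real (b p) * (iexp (U \<omega>) * complex_of_real (multi_hermite p (\<lambda>t. \<xi> t \<omega>)))) \<partial>M)"
      by (simp add: R_def sum_distrib_left mult_ac)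
    also have "\<dots> = (\<Sum>p\<in>multi_index q. complex_of_real (b p) * (e * (\<i> ^ q * complex_of_real (\<Prod>t\<in>UNIV. s t ^ p t))))"
      using iexp_int[OF Um HL] H
      by (subst Bochner_Integration.integral_sum) (auto intro!: sum.cong)
    also have "\<dots> = e * (\<i> ^ q * complex_of_real (\<Sum>p\<in>multi_index q. b p * (\<Prod>t\<in>UNIV. s t ^ p t)))"
      by (simp add: sum_distrib_left mult_ac)
    finally have "(\<integral>\<omega>. iexp (U \<omega>) * complex_of_real (h \<omega>) \<partial>M) = 0"
      using 1 iexp_int[OF Um PL] iexp_int[OF Um RL] by (simp add: h_def right_diff_distrib)
    then show ?thesis by (simp add: U_def)
  qed
  show thesis
  proof (rule that[of b])
    fix F :: "('t \<Rightarrow> real) \<Rightarrow> real"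
    assume F: "F \<in> borel_measurable (Pi\<^sub>M UNIV (\<lambda>_. borel))" and FL: "(\<lambda>\<omega>. F (\<lambda>t. \<xi> t \<omega>)) \<in> L2_space M"
    have "(\<integral>\<omega>. F (\<lambda>t. \<xi> t \<omega>) * h \<omega> \<partial>M) = 0"
      by (rule fourier_unique_vector[OF L2_integrable[OF hL] L2_spaceD(1)[OF \<xi>L] zero F L2_mult_integrable[OF FL hL]])
    then have "(\<integral>\<omega>. F (\<lambda>t. \<xi> t \<omega>) * P \<omega> \<partial>M) = (\<integral>\<omega>. F (\<lambda>t. \<xi> t \<omega>) * R \<omega> \<partial>M)"
      using L2_mult_integrable[OF FL PL] L2_mult_integrable[OF FL RL] by (simp add: h_def right_diff_distrib)
    also have "\<dots> = (\<integral>\<omega>. (\<Sum>p\<in>multi_index q. b p * (F (\<lambda>t. \<xi> t \<omega>) * multi_hermite p (\<lambda>t. \<xi> t \<omega>))) \<partial>M)"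
      by (simp add: R_def sum_distrib_left mult_ac)
    also have "\<dots> = (\<Sum>p\<in>multi_index q. b p * (\<integral>\<omega>. F (\<lambda>t. \<xi> t \<omega>) * multi_hermite p (\<lambda>t. \<xi> t \<omega>) \<partial>M))"
      using L2_mult_integrable[OF FL HL] by (subst Bochner_Integration.integral_sum) auto
    finally show "(\<integral>\<omega>. F (\<lambda>t. \<xi> t \<omega>) * (\<Prod>a\<in>T. poly (hermite (d a)) (Y a \<omega>)) \<partial>M) =
      (\<Sum>p\<in>multi_index (\<Sum>a\<in>T. d a). b p * (\<integral>\<omega>. F (\<lambda>t. \<xi> t \<omega>) * multi_hermite p (\<lambda>t. \<xi> t \<omega>) \<partial>M))"
      by (simp add: P_def q_def)
  qed
qed

definition chaos_gen :: "nat \<Rightarrow> ('w \<Rightarrow> real) set" where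
  "chaos_gen q = {\<lambda>\<omega>. \<Prod>a<m. poly (hermite (d a)) (Y a \<omega>) | (m::nat) d Y.
        1 \<le> m \<and> (\<Sum>a<m. d a) = q \<and> (\<forall>a<m. Y a \<in> \<GG>) \<and> std_gaussian_vector M {..<m} Y}"

lemma wiener_chaos_eq: "wiener_chaos M \<GG> q = L2_closure M (lin_span (chaos_gen q))"
  by (simp add: wiener_chaos_def chaos_gen_def)

lemma chaos_gen_L2: "chaos_gen q \<subseteq> L2_space M"
  unfolding chaos_gen_def by (auto intro!: std_gaussian_vector_poly_L2)

lemma wiener_chaos_L2: "f \<in> wiener_chaos M \<GG> q \<Longrightarrow> f \<in> L2_space M"
  unfolding wiener_chaos_eq by (auto simp: L2_closure_def)

definition hermite_part :: "('t::finite \<Rightarrow> 'w \<Rightarrow> real) \<Rightarrow> (('t \<Rightarrow> real) \<Rightarrow> real) \<Rightarrow> nat \<Rightarrow> 'w \<Rightarrow> real" where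
  "hermite_part \<xi> F q \<omega> = (\<Sum>p\<in>multi_index q.
     (\<integral>\<omega>. F (\<lambda>t. \<xi> t \<omega>) * multi_hermite p (\<lambda>t. \<xi> t \<omega>) \<partial>M) / multi_fact p * multi_hermite p (\<lambda>t. \<xi> t \<omega>))"

text \<open>It suffices to test generators. The kernel weights are used twice: with \<open>F\<close>
  itself, and with each \<open>multi_hermite p\<close> in place of \<open>F\<close>.\<close>

lemma hermite_part_orthogonal:
  fixes \<xi> :: "'t::finite \<Rightarrow> 'w \<Rightarrow> real"
  assumes \<xi>: "std_gaussian_vector M UNIV \<xi>" and \<xi>G: "\<And>t. \<xi> t \<in> \<GG>"
    and F: "F \<in> borel_measurable (Pi\<^sub>M UNIV (\<lambda>_. borel))" and FL: "(\<lambda>\<omega>. F (\<lambda>t. \<xi> t \<omega>)) \<in> L2_space M"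
    and y: "y \<in> wiener_chaos M \<GG> q"
  shows "(\<integral>\<omega>. (F (\<lambda>t. \<xi> t \<omega>) - hermite_part \<xi> F q \<omega>) * y \<omega> \<partial>M) = 0"
proof -
  define c where "c p = (\<integral>\<omega>. F (\<lambda>t. \<xi> t \<omega>) * multi_hermite p (\<lambda>t. \<xi> t \<omega>) \<partial>M)" for p
  have HL: "(\<lambda>\<omega>. multi_hermite p (\<lambda>t. \<xi> t \<omega>)) \<in> L2_space M" for p
    by (rule multi_hermite_L2[OF \<xi>])
  have part: "hermite_part \<xi> F q = (\<lambda>\<omega>. \<Sum>p\<in>multi_index q. c p / multi_fact p * multi_hermite p (\<lambda>t. \<xi> t \<omega>))"
    by (auto simp: hermite_part_def c_def)
  have partL: "hermite_part \<xi> F q \<in> L2_space M"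
    unfolding part by (intro L2_sum HL) simp
  show ?thesis
  proof (rule L2_closure_span_orthogonal[OF chaos_gen_L2 _ _ y[unfolded wiener_chaos_eq]])
    show "(\<lambda>\<omega>. F (\<lambda>t. \<xi> t \<omega>) - hermite_part \<xi> F q \<omega>) \<in> L2_space M"
      by (intro L2_diff FL partL)
    fix g assume "g \<in> chaos_gen q"
    then obtain m d Y where g: "g = (\<lambda>\<omega>. \<Prod>a<m. poly (hermite (d a)) (Y a \<omega>))"
      and dq: "(\<Sum>a<(m::nat). d a) = q" and YG: "\<And>a. a \<in> {..<m} \<Longrightarrow> Y a \<in> \<GG>" and Y: "std_gaussian_vector M {..<m} Y"
      unfolding chaos_gen_def by auto
    have gL: "g \<in> L2_space M" using \<open>g \<in> chaos_gen q\<close> chaos_gen_L2 by auto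
    obtain b where b: "\<And>F. F \<in> borel_measurable (Pi\<^sub>M UNIV (\<lambda>_. borel)) \<Longrightarrow>
      (\<lambda>\<omega>. F (\<lambda>t. \<xi> t \<omega>)) \<in> L2_space M \<Longrightarrow>
      (\<integral>\<omega>. F (\<lambda>t. \<xi> t \<omega>) * (\<Prod>a<m. poly (hermite (d a)) (Y a \<omega>)) \<partial>M) =
      (\<Sum>p\<in>multi_index (\<Sum>a<m. d a). b p * (\<integral>\<omega>. F (\<lambda>t. \<xi> t \<omega>) * multi_hermite p (\<lambda>t. \<xi> t \<omega>) \<partial>M))"
      using chaos_kernel[OF \<xi> \<xi>G Y YG, of d] by blast
    have bg: "(\<integral>\<omega>. F (\<lambda>t. \<xi> t \<omega>) * g \<omega> \<partial>M) = (\<Sum>p\<in>multi_index q. b p * c p)"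
      using b[OF F FL] by (simp add: g dq c_def)
    \<comment> \<open>Orthogonality isolates a single weight, times the squared norm
      \<open>multi_fact p\<close>. The division in \<open>hermite_part\<close> cancels that norm, so
      both pairings with \<open>g\<close> become the sum of \<open>b p * c p\<close>.\<close>
    have Hg: "(\<integral>\<omega>. multi_hermite p (\<lambda>t. \<xi> t \<omega>) * g \<omega> \<partial>M) = b p * multi_fact p" if "p \<in> multi_index q" for p
      using b[OF multi_hermite_measurable HL, of p] that
      by (simp add: g dq multi_hermite_orthogonal[OF \<xi>] if_distrib[of "\<lambda>x. _ * x"] cong: if_cong)
    have "(\<integral>\<omega>. hermite_part \<xi> F q \<omega> * g \<omega> \<partial>M) =
        (\<integral>\<omega>. (\<Sum>p\<in>multi_index q. c p / multi_fact p * (multi_hermite p (\<lambda>t. \<xi> t \<omega>) * g \<omega>)) \<partial>M)"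
      by (simp add: part sum_distrib_right mult.assoc)
    also have "\<dots> = (\<Sum>p\<in>multi_index q. c p / multi_fact p * (\<integral>\<omega>. multi_hermite p (\<lambda>t. \<xi> t \<omega>) * g \<omega> \<partial>M))"
      using L2_mult_integrable[OF HL gL] by (subst Bochner_Integration.integral_sum) auto
    also have "\<dots> = (\<Sum>p\<in>multi_index q. b p * c p)"
      by (intro sum.cong refl) (simp add: Hg multi_fact_nonzero)
    finally show "(\<integral>\<omega>. (F (\<lambda>t. \<xi> t \<omega>) - hermite_part \<xi> F q \<omega>) * g \<omega> \<partial>M) = 0"
      using bg L2_mult_integrable[OF FL gL] L2_mult_integrable[OF partL gL] by (simp add: left_diff_distrib)
  qed
qed

text \<open>Generators are enumerated by \<open>{..<m}\<close>, so the family is transported along a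
  bijection from there to its index type, independence included. All coordinates are kept, with
  degree 0 where needed, so m is the cardinality of the type and hence at least 1.\<close>

lemma multi_hermite_in_chaos:
  fixes \<xi> :: "'t::finite \<Rightarrow> 'w \<Rightarrow> real"
  assumes \<xi>: "std_gaussian_vector M UNIV \<xi>" and \<xi>G: "\<And>t. \<xi> t \<in> \<GG>" and p: "p \<in> multi_index q"
  shows "(\<lambda>\<omega>. multi_hermite p (\<lambda>t. \<xi> t \<omega>)) \<in> wiener_chaos M \<GG> q"
proof -
  define m where "m = CARD('t)"
  obtain f where f: "bij_betw f {..<m} (UNIV :: 't set)"
    using ex_bij_betw_nat_finite[OF finite[of UNIV]] unfolding m_def atLeast0LessThan by blast
  have ind: "indep_vars (\<lambda>_. borel) \<xi> UNIV" and dist: "\<And>t. distributed M lborel (\<xi> t) std_normal_density"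
    using \<xi> by (auto simp: std_gaussian_vector_def)
  have "indep_vars (\<lambda>_. borel) (\<lambda>a. \<xi> (f a)) {..<m}"
    unfolding indep_vars_def
  proof (intro conjI ballI)
    show "\<xi> (f a) \<in> borel_measurable M" for a
      using std_gaussian_vector_measurable[OF \<xi>] by auto
    show "indep_sets (\<lambda>a. sigma_sets (space M) {\<xi> (f a) -` A \<inter> space M |A. A \<in> sets borel}) {..<m}"
    proof (rule indep_setsI)
      show "sigma_sets (space M) {\<xi> (f a) -` A \<inter> space M |A. A \<in> sets borel} \<subseteq> events" for a
        using std_gaussian_vector_measurable[OF \<xi>, of "f a"]
        by (intro sets.sigma_sets_subset) (auto simp: measurable_sets)
    next
      fix A J assume J: "J \<noteq> {}" "J \<subseteq> {..<m}" "finite J"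
        and A: "\<forall>a\<in>J. A a \<in> sigma_sets (space M) {\<xi> (f a) -` A \<inter> space M |A. A \<in> sets borel}"
      have indep: "indep_sets (\<lambda>t. sigma_sets (space M) {\<xi> t -` A \<inter> space M |A. A \<in> sets borel}) UNIV"
        using ind by (simp add: indep_vars_def)
      have inj: "inj_on f J" using f J by (meson bij_betw_def inj_on_subset)
      define g where "g = the_inv_into J f"
      have g: "g (f a) = a" if "a \<in> J" for a using the_inv_into_f_f[OF inj that] by (simp add: g_def)
      have "prob (\<Inter>t\<in>f ` J. A (g t)) = (\<Prod>t\<in>f ` J. prob (A (g t)))"
        using A g J by (intro indep_setsD[OF indep]) auto
      then show "prob (\<Inter>a\<in>J. A a) = (\<Prod>a\<in>J. prob (A a))"
        using g by (simp add: prod.reindex[OF inj])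
    qed
  qed
  then have std: "std_gaussian_vector M {..<m} (\<lambda>a. \<xi> (f a))"
    using dist by (simp add: std_gaussian_vector_def)
  have re: "(\<lambda>\<omega>. multi_hermite p (\<lambda>t. \<xi> t \<omega>)) = (\<lambda>\<omega>. \<Prod>a<m. poly (hermite (p (f a))) (\<xi> (f a) \<omega>))"
    unfolding multi_hermite_def by (intro ext prod.reindex_bij_betw[OF f, symmetric])
  have "(\<Sum>a<m. p (f a)) = q"
    using p sum.reindex_bij_betw[OF f, of p] by (simp add: multi_index_def)
  then have "(\<lambda>\<omega>. multi_hermite p (\<lambda>t. \<xi> t \<omega>)) \<in> chaos_gen q"
    unfolding re chaos_gen_def using std \<xi>G
    by (intro CollectI exI[of _ m] exI[of _ "\<lambda>a. p (f a)"] exI[of _ "\<lambda>a. \<xi> (f a)"])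
      (simp add: m_def Suc_le_eq)
  then show ?thesis
    unfolding wiener_chaos_eq
    by (intro L2_closure_superset lin_span_superset multi_hermite_L2[OF \<xi>])
qed

lemma hermite_part_in_chaos:
  fixes \<xi> :: "'t::finite \<Rightarrow> 'w \<Rightarrow> real"
  assumes "std_gaussian_vector M UNIV \<xi>" "\<And>t. \<xi> t \<in> \<GG>"
  shows "hermite_part \<xi> F q \<in> wiener_chaos M \<GG> q"
proof -
  have "(\<lambda>\<omega>. \<Sum>p\<in>multi_index q. (\<integral>\<omega>. F (\<lambda>t. \<xi> t \<omega>) * multi_hermite p (\<lambda>t. \<xi> t \<omega>) \<partial>M) / multi_fact p *
      multi_hermite p (\<lambda>t. \<xi> t \<omega>)) \<in> wiener_chaos M \<GG> q"
    using multi_hermite_in_chaos[OF assms] unfolding wiener_chaos_eq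
    by (intro L2_closure_span_sum) auto
  then show ?thesis by (simp add: hermite_part_def[abs_def])
qed

text \<open>The difference of two candidates lies in the chaos; testing both orthogonality relations
  with it shows that its norm is zero.\<close>

lemma chaos_proj_unique:
  assumes "is_chaos_proj M \<GG> q F R" "is_chaos_proj M \<GG> q F R'"
  shows "AE \<omega> in M. R \<omega> = R' \<omega>"
proof -
  have F: "F \<in> L2_space M" and R: "R \<in> wiener_chaos M \<GG> q" and R': "R' \<in> wiener_chaos M \<GG> q"
    using assms by (auto simp: is_chaos_proj_def)
  define D where "D \<omega> = 1 * R \<omega> + (-1) * R' \<omega>" for \<omega>
  have D: "D \<in> wiener_chaos M \<GG> q"
    unfolding D_def[abs_def] using R R' unfolding wiener_chaos_eq by (rule L2_closure_span_lincomb)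
  note L = wiener_chaos_L2[OF R] wiener_chaos_L2[OF R'] wiener_chaos_L2[OF D]
  have "(\<integral>\<omega>. (F \<omega> - R' \<omega>) * D \<omega> \<partial>M) - (\<integral>\<omega>. (F \<omega> - R \<omega>) * D \<omega> \<partial>M) = 0"
    using assms D by (simp add: is_chaos_proj_def)
  moreover have "(\<integral>\<omega>. (F \<omega> - R' \<omega>) * D \<omega> \<partial>M) - (\<integral>\<omega>. (F \<omega> - R \<omega>) * D \<omega> \<partial>M) =
      (\<integral>\<omega>. (F \<omega> - R' \<omega>) * D \<omega> - (F \<omega> - R \<omega>) * D \<omega> \<partial>M)"
    using L2_mult_integrable[OF L2_diff[OF F L(2)] L(3)] L2_mult_integrable[OF L2_diff[OF F L(1)] L(3)]
    by simp
  moreover have "(F \<omega> - R' \<omega>) * D \<omega> - (F \<omega> - R \<omega>) * D \<omega> = (D \<omega>)\<^sup>2" for \<omega>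
    by (simp add: D_def power2_eq_square algebra_simps)
  ultimately have "(\<integral>\<omega>. (D \<omega>)\<^sup>2 \<partial>M) = 0" by simp
  from L2_norm_zero_AE[OF L(3) this] show ?thesis by (simp add: D_def)
qed

lemma chaos_proj_AE_cong:
  assumes "is_chaos_proj M \<GG> q F R" "R' \<in> borel_measurable M" "AE \<omega> in M. R \<omega> = R' \<omega>"
  shows "is_chaos_proj M \<GG> q F R'"
proof -
  have F: "F \<in> L2_space M" and R: "R \<in> wiener_chaos M \<GG> q"
    using assms by (auto simp: is_chaos_proj_def)
  have R': "R' \<in> wiener_chaos M \<GG> q"
    using L2_closure_AE_cong[OF R[unfolded wiener_chaos_eq] assms(2,3)] by (simp add: wiener_chaos_eq)
  have "(\<integral>\<omega>. (F \<omega> - R' \<omega>) * y \<omega> \<partial>M) = (\<integral>\<omega>. (F \<omega> - R \<omega>) * y \<omega> \<partial>M)"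
    if "y \<in> wiener_chaos M \<GG> q" for y
    using assms(2,3) L2_spaceD(1)[OF F] L2_spaceD(1)[OF wiener_chaos_L2[OF R]] L2_spaceD(1)[OF wiener_chaos_L2[OF that]]
    by (intro integral_cong_AE) auto
  then show ?thesis using assms(1) R' by (simp add: is_chaos_proj_def)
qed

end

section \<open>Gaussian random variables and limits of characters\<close>

lemma norm_iexp_diff_le: "norm (iexp a - iexp b) \<le> \<bar>a - b\<bar>"
proof -
  have "iexp a - iexp b = iexp b * (iexp (a - b) - 1)"
    by (simp add: right_diff_distrib exp_add[symmetric] algebra_simps)
  then have "norm (iexp a - iexp b) = norm (iexp (a - b) - 1)"
    by (simp only: norm_mult norm_exp_i_times mult_1_left)
  also have "\<dots> \<le> \<bar>a - b\<bar>" using iexp_approx1[of "a - b" 0] by simp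
  finally show ?thesis .
qed

context prob_space
begin

text \<open>Centring makes the parameter m zero in both alternatives; a degenerate variable then
  fits the same formula with variance 0.\<close>

lemma gaussian_rv_character:
  assumes Y: "gaussian_rv M Y" and mean: "(\<integral>\<omega>. Y \<omega> \<partial>M) = 0"
  shows "(\<integral>\<omega>. iexp (Y \<omega>) \<partial>M) = exp (complex_of_real (- (\<integral>\<omega>. (Y \<omega>)\<^sup>2 \<partial>M) / 2))"
proof -
  have m[measurable]: "Y \<in> borel_measurable M" using Y by (simp add: gaussian_rv_def)
  consider m s where "s > 0" "distributed M lborel Y (normal_density m s)" | m where "AE \<omega> in M. Y \<omega> = m"
    using Y by (auto simp: gaussian_rv_def)
  then show ?thesis
  proof cases
    case (1 m s)
    have "m = 0" using normal_distributed_expectation[OF 1] mean by simp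
    with 1 have D: "distributed M lborel Y (normal_density 0 s)" by simp
    have var: "(\<integral>\<omega>. (Y \<omega>)\<^sup>2 \<partial>M) = s\<^sup>2"
      using normal_distributed_variance[OF 1(1) D] mean by simp
    have "distributed M lborel (\<lambda>\<omega>. (Y \<omega> - 0) / s) std_normal_density"
      using normal_standard_normal_convert[OF 1(1)] D by simp
    then have Z: "distributed M lborel (\<lambda>\<omega>. Y \<omega> / s) std_normal_density" by simp
    then have std: "distr M lborel (\<lambda>\<omega>. Y \<omega> / s) = std_normal_distribution"
      by (simp add: distributed_def)
    have "char std_normal_distribution s = (\<integral>\<omega>. iexp (s * (Y \<omega> / s)) \<partial>M)"
      unfolding char_def std[symmetric]
      by (rule integral_distr) (use Z in \<open>auto simp: distributed_def\<close>)
    also have "\<dots> = (\<integral>\<omega>. iexp (Y \<omega>) \<partial>M)" using 1(1) by simp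
    finally show ?thesis by (simp add: char_std_normal_distribution var exp_of_real[symmetric])
  next
    case (2 m)
    have "(\<integral>\<omega>. Y \<omega> \<partial>M) = (\<integral>\<omega>. m \<partial>M)" using 2 by (intro integral_cong_AE) auto
    then have m0: "m = 0" using mean by (simp add: prob_space)
    have "(\<integral>\<omega>. (Y \<omega>)\<^sup>2 \<partial>M) = (\<integral>\<omega>. 0 \<partial>M)"
      using 2 m0 by (intro integral_cong_AE) auto
    moreover have "(\<integral>\<omega>. iexp (Y \<omega>) \<partial>M) = (\<integral>\<omega>. 1 \<partial>M)"
      using 2 m0 by (intro integral_cong_AE) auto
    ultimately show ?thesis by (simp add: prob_space)
  qed
qed

lemma L2_tendsto_norm:
  assumes "L2_tendsto M f g F"
  shows "((\<lambda>e. \<integral>\<omega>. (f e \<omega>)\<^sup>2 \<partial>M) \<longlongrightarrow> (\<integral>\<omega>. (g \<omega>)\<^sup>2 \<partial>M)) F"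
proof -
  have gL: "g \<in> L2_space M" and ev: "eventually (\<lambda>e. f e \<in> L2_space M) F"
    and lim: "((\<lambda>e. \<integral>\<omega>. (f e \<omega> - g \<omega>)\<^sup>2 \<partial>M) \<longlongrightarrow> 0) F"
    using assms by (auto simp: L2_tendsto_def)
  have "((\<lambda>e. (\<integral>\<omega>. (f e \<omega> - g \<omega>)\<^sup>2 \<partial>M) + 2 * (\<integral>\<omega>. f e \<omega> * g \<omega> \<partial>M) - (\<integral>\<omega>. (g \<omega>)\<^sup>2 \<partial>M))
      \<longlongrightarrow> 0 + 2 * (\<integral>\<omega>. g \<omega> * g \<omega> \<partial>M) - (\<integral>\<omega>. (g \<omega>)\<^sup>2 \<partial>M)) F"
    by (intro tendsto_intros lim L2_tendsto_integral_mult[OF assms gL])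
  also have "0 + 2 * (\<integral>\<omega>. g \<omega> * g \<omega> \<partial>M) - (\<integral>\<omega>. (g \<omega>)\<^sup>2 \<partial>M) = (\<integral>\<omega>. (g \<omega>)\<^sup>2 \<partial>M)"
    by (simp add: power2_eq_square)
  finally show ?thesis
  proof (rule Lim_transform_eventually)
    show "eventually (\<lambda>e. (\<integral>\<omega>. (f e \<omega> - g \<omega>)\<^sup>2 \<partial>M) + 2 * (\<integral>\<omega>. f e \<omega> * g \<omega> \<partial>M) - (\<integral>\<omega>. (g \<omega>)\<^sup>2 \<partial>M)
        = (\<integral>\<omega>. (f e \<omega>)\<^sup>2 \<partial>M)) F"
      using ev
    proof eventually_elim
      case (elim e)
      have "(\<integral>\<omega>. (f e \<omega> - g \<omega>)\<^sup>2 \<partial>M) = (\<integral>\<omega>. (f e \<omega>)\<^sup>2 + (g \<omega>)\<^sup>2 - 2 * (f e \<omega> * g \<omega>) \<partial>M)"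
        by (simp add: power2_diff mult.assoc)
      then show ?case
        using L2_spaceD[OF elim] L2_spaceD[OF gL] L2_mult_integrable[OF elim gL] by simp
    qed
  qed
qed

text \<open>The map x |-> exp(i x) is 1-Lipschitz, and the L1 distance is at most the L2 distance on
  a probability space.\<close>

lemma L2_tendsto_character:
  assumes "L2_tendsto M f g F"
  shows "((\<lambda>e. \<integral>\<omega>. iexp (f e \<omega>) \<partial>M) \<longlongrightarrow> (\<integral>\<omega>. iexp (g \<omega>) \<partial>M)) F"
proof -
  have gL: "g \<in> L2_space M" and ev: "eventually (\<lambda>e. f e \<in> L2_space M) F"
    and lim: "((\<lambda>e. \<integral>\<omega>. (f e \<omega> - g \<omega>)\<^sup>2 \<partial>M) \<longlongrightarrow> 0) F"
    using assms by (auto simp: L2_tendsto_def)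
  have lim': "((\<lambda>e. sqrt (\<integral>\<omega>. (f e \<omega> - g \<omega>)\<^sup>2 \<partial>M)) \<longlongrightarrow> 0) F"
    using tendsto_real_sqrt[OF lim] by simp
  have "eventually (\<lambda>e. norm ((\<integral>\<omega>. iexp (f e \<omega>) \<partial>M) - (\<integral>\<omega>. iexp (g \<omega>) \<partial>M))
      \<le> sqrt (\<integral>\<omega>. (f e \<omega> - g \<omega>)\<^sup>2 \<partial>M)) F"
    using ev
  proof eventually_elim
    case (elim e)
    note [measurable] = L2_spaceD(1)[OF elim] L2_spaceD(1)[OF gL]
    have int: "integrable M (\<lambda>\<omega>. iexp (h \<omega>))" if [measurable]: "h \<in> borel_measurable M" for h :: "'a \<Rightarrow> real"
      by (rule integrable_const_bound[of _ 1]) auto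
    note D = L2_diff[OF elim gL]
    note absD = integrable_abs[OF L2_integrable[OF D]]
    have aL: "(\<lambda>\<omega>. \<bar>f e \<omega> - g \<omega>\<bar>) \<in> L2_space M" using L2_spaceD[OF D] by (simp add: L2_space_def)
    have "norm ((\<integral>\<omega>. iexp (f e \<omega>) \<partial>M) - (\<integral>\<omega>. iexp (g \<omega>) \<partial>M)) = norm (\<integral>\<omega>. iexp (f e \<omega>) - iexp (g \<omega>) \<partial>M)"
      using int[of "f e"] int[of g] by simp
    also have "\<dots> \<le> (\<integral>\<omega>. norm (iexp (f e \<omega>) - iexp (g \<omega>)) \<partial>M)" by (rule integral_norm_bound)
    also have "\<dots> \<le> (\<integral>\<omega>. \<bar>f e \<omega> - g \<omega>\<bar> \<partial>M)"
      using int[of "f e"] int[of g] absD norm_iexp_diff_le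
      by (intro integral_mono integrable_norm Bochner_Integration.integrable_diff) auto
    also have "\<dots> \<le> sqrt (\<integral>\<omega>. (f e \<omega> - g \<omega>)\<^sup>2 \<partial>M)"
      using L2_Cauchy_Schwarz[OF aL L2_const[of 1]] by (intro real_le_rsqrt) (simp add: prob_space)
    finally show ?case .
  qed
  from Lim_null_comparison[OF this lim'] show ?thesis by (rule LIM_zero_cancel)
qed

end

lemma L2_closure_sequence:
  assumes "f \<in> L2_closure M S"
  obtains g where "\<And>n::nat. g n \<in> S" "L2_tendsto M g f sequentially"
proof -
  have "\<exists>h. h \<in> S \<inter> L2_space M \<and> (\<integral>\<omega>. (f \<omega> - h \<omega>)\<^sup>2 \<partial>M) < 1 / real (Suc n)" for n
    using assms unfolding L2_closure_def by (auto dest!: spec[of _ "1 / real (Suc n)"])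
  then obtain g where g: "\<And>n. g n \<in> S \<inter> L2_space M" "\<And>n. (\<integral>\<omega>. (f \<omega> - g n \<omega>)\<^sup>2 \<partial>M) < 1 / real (Suc n)"
    by metis
  have "(\<lambda>n. \<integral>\<omega>. (g n \<omega> - f \<omega>)\<^sup>2 \<partial>M) \<longlonglongrightarrow> 0"
  proof (rule tendsto_sandwich[OF _ _ tendsto_const])
    show "(\<lambda>n. 1 / real (Suc n)) \<longlonglongrightarrow> 0" using LIMSEQ_inverse_real_of_nat by (simp add: inverse_eq_divide)
    show "eventually (\<lambda>n. (\<integral>\<omega>. (g n \<omega> - f \<omega>)\<^sup>2 \<partial>M) \<le> 1 / real (Suc n)) sequentially"
      using g(2) by (intro always_eventually allI less_imp_le) (simp add: power2_commute)
  qed auto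
  then have "L2_tendsto M g f sequentially"
    using g assms by (auto simp: L2_tendsto_def L2_closure_def)
  then show ?thesis using that g by blast
qed

section \<open>The Gaussian field\<close>

text \<open>The common law of all vectors \<open>\<xi> z\<close>. Taking Hermite coefficients under
  this law makes their independence of z visible in the notation.\<close>

definition std_gauss :: "('t \<Rightarrow> real) measure" where
  "std_gauss = Pi\<^sub>M UNIV (\<lambda>_. std_normal_distribution)"

lemma sets_std_gauss[measurable_cong]: "sets (std_gauss :: ('t \<Rightarrow> real) measure) = sets (Pi\<^sub>M UNIV (\<lambda>_. borel))"
  unfolding std_gauss_def by (intro sets_PiM_cong) auto

lemma (in prob_space) std_gaussian_vector_distr:
  fixes Y :: "'t::finite \<Rightarrow> 'a \<Rightarrow> real"
  assumes Y: "std_gaussian_vector M UNIV Y"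
  shows "distr M (Pi\<^sub>M UNIV (\<lambda>_. borel)) (\<lambda>\<omega> t. Y t \<omega>) = std_gauss"
proof -
  have d: "distr M borel (Y t) = std_normal_distribution" for t
  proof -
    have "distr M borel (Y t) = distr M lborel (Y t)" by (rule distr_cong) auto
    also have "\<dots> = std_normal_distribution"
      using Y by (simp add: std_gaussian_vector_def distributed_def)
    finally show ?thesis .
  qed
  have "distr M (Pi\<^sub>M UNIV (\<lambda>_. borel)) (\<lambda>\<omega>. \<lambda>t\<in>UNIV. Y t \<omega>) = Pi\<^sub>M UNIV (\<lambda>t. distr M borel (Y t))"
    using Y std_gaussian_vector_measurable[OF Y]
    by (subst indep_vars_iff_distr_eq_PiM[symmetric]) (auto simp: std_gaussian_vector_def)
  then show ?thesis by (simp add: d std_gauss_def restrict_def)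
qed

locale gaussian_field = pair_prob_space N M
  for N :: "'z measure" and M :: "'w measure" +
  fixes X :: "'l::finite \<Rightarrow> 'k::finite option \<Rightarrow> 'z \<Rightarrow> 'w \<Rightarrow> real"
  assumes joint_measurable:
      "\<And>i c. (\<lambda>(z, \<omega>). X i c z \<omega>) \<in> borel_measurable (N \<Otimes>\<^sub>M M)"
    and gaussian: "\<And>i. gaussian_family M (UNIV \<times> space N) (\<lambda>(c, z). X i c z)"
    and standard: "\<And>i z. z \<in> space N \<Longrightarrow> std_gaussian_vector M UNIV (\<lambda>c. X i c z)"
    and independent:
      "prob_space.indep_vars M (\<lambda>_. PiM (UNIV \<times> space N) (\<lambda>_. borel))
         (\<lambda>i \<omega>. \<lambda>(c, z)\<in>UNIV \<times> space N. X i c z \<omega>) UNIV"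
begin

definition \<GG> :: "('w \<Rightarrow> real) set" where
  "\<GG> = gauss_space M N X"

definition \<xi> :: "'z \<Rightarrow> 'l \<times> 'k option \<Rightarrow> 'w \<Rightarrow> real" where
  "\<xi> z t \<omega> = X (fst t) (snd t) z \<omega>"

definition gens :: "('w \<Rightarrow> real) set" where
  "gens = {X i c z | i c z. z \<in> space N}"

lemma \<GG>_eq: "\<GG> = L2_closure M (lin_span gens)"
  by (simp add: \<GG>_def gauss_space_def gens_def)

lemma X_L2: "z \<in> space N \<Longrightarrow> X i c z \<in> L2_space M"
  using M2.std_gaussian_vector_L2[OF standard, of z c] by simp

lemma gens_L2: "gens \<subseteq> L2_space M"
  by (auto simp: gens_def X_L2)

lemma X_mean: "z \<in> space N \<Longrightarrow> (\<integral>\<omega>. X i c z \<omega> \<partial>M) = 0"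
  using standard[of z i] by (auto simp: std_gaussian_vector_def intro: M2.standard_normal_distributed_expectation)

text \<open>Gaussianity is assumed within each row only. Joint Gaussianity across rows comes from
  independence: grouping a linear combination by rows gives independent centred Gaussian summands,
  whose characters multiply and whose variances add.\<close>

lemma span_character:
  assumes U: "U \<in> lin_span gens"
  shows "(\<integral>\<omega>. iexp (U \<omega>) \<partial>M) = exp (complex_of_real (- (\<integral>\<omega>. (U \<omega>)\<^sup>2 \<partial>M) / 2))"
proof -
  obtain T a where T: "U = (\<lambda>\<omega>. \<Sum>f\<in>T. a f * f \<omega>)" "finite T" "T \<subseteq> gens"
    using U unfolding lin_span_def by blast
  \<comment> \<open>A generator is a function and may have several presentations as
    \<open>X i c z\<close>; \<open>\<tau>\<close> fixes one, so that each term belongs to exactly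
    one row.\<close>
  have "\<exists>\<tau>. \<forall>f\<in>T. \<exists>i c z. \<tau> f = (i, c, z) \<and> z \<in> space N \<and> f = X i c z"
  proof (intro bchoice ballI)
    fix f assume "f \<in> T"
    then obtain i c z where "z \<in> space N" "f = X i c z" using T(3) unfolding gens_def by blast
    then show "\<exists>y i c z. y = (i, c, z) \<and> z \<in> space N \<and> f = X i c z" by blast
  qed
  then obtain \<tau> where \<tau>: "\<And>f. f \<in> T \<Longrightarrow> snd (snd (\<tau> f)) \<in> space N"
    "\<And>f. f \<in> T \<Longrightarrow> f = X (fst (\<tau> f)) (fst (snd (\<tau> f))) (snd (snd (\<tau> f)))"
    by (metis fst_conv snd_conv)
  define Ti where "Ti i = {f \<in> T. fst (\<tau> f) = i}" for i
  have fin: "finite (Ti i)" for i using T(2) by (simp add: Ti_def)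
  define V where "V i \<omega> = (\<Sum>f\<in>Ti i. a f * f \<omega>)" for i \<omega>
  have fL: "f \<in> L2_space M" if "f \<in> T" for f using that T(3) gens_L2 by auto
  have VL: "V i \<in> L2_space M" for i
    unfolding V_def[abs_def] using fin by (intro L2_sum) (auto simp: Ti_def fL)
  have Usum: "U \<omega> = (\<Sum>i\<in>UNIV. V i \<omega>)" for \<omega>
    unfolding T(1) V_def Ti_def using T(2)
    by (subst sum.group[where g="\<lambda>f. fst (\<tau> f)"]) auto
  have mean: "(\<integral>\<omega>. V i \<omega> \<partial>M) = 0" for i
  proof -
    have "(\<integral>\<omega>. V i \<omega> \<partial>M) = (\<Sum>f\<in>Ti i. a f * (\<integral>\<omega>. f \<omega> \<partial>M))"
      unfolding V_def using fL M2.L2_integrable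
      by (subst Bochner_Integration.integral_sum) (auto simp: Ti_def)
    also have "\<dots> = 0"
    proof (intro sum.neutral ballI)
      fix f assume "f \<in> Ti i"
      then have "f \<in> T" by (simp add: Ti_def)
      then show "a f * (\<integral>\<omega>. f \<omega> \<partial>M) = 0"
        using X_mean[OF \<tau>(1)] \<tau>(2) by (metis mult_zero_right)
    qed
    finally show ?thesis .
  qed
  \<comment> \<open>Within row i the pair (c, z) determines the function, so sums over functions may
    be rewritten as sums over the index set of the Gaussian family.\<close>
  have inj: "inj_on (\<lambda>f. snd (\<tau> f)) (Ti i)" for i
  proof (rule inj_onI)
    fix f g assume "f \<in> Ti i" "g \<in> Ti i" "snd (\<tau> f) = snd (\<tau> g)"
    then show "f = g" using \<tau>(2)[of f] \<tau>(2)[of g] by (simp add: Ti_def)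
  qed
  define S where "S i = (\<lambda>f. snd (\<tau> f)) ` Ti i" for i
  define b where "b i t = a (X i (fst t) (snd t))" for i t
  have S: "finite (S i)" "S i \<subseteq> UNIV \<times> space N" for i
  proof -
    show "finite (S i)" using fin by (simp add: S_def)
    show "S i \<subseteq> UNIV \<times> space N" unfolding S_def Ti_def by (intro image_subsetI) (simp add: mem_Times_iff \<tau>(1))
  qed
  have VS: "V i \<omega> = (\<Sum>t\<in>S i. b i t * X i (fst t) (snd t) \<omega>)" for i \<omega>
  proof -
    have "X i (fst (snd (\<tau> f))) (snd (snd (\<tau> f))) = f" if "f \<in> Ti i" for f
      using \<tau>(2)[of f] that by (simp add: Ti_def)
    then show ?thesis
      unfolding S_def V_def b_def by (subst sum.reindex[OF inj]) (auto intro!: sum.cong)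
  qed
  have gauss: "gaussian_rv M (V i)" for i
  proof -
    have "gaussian_rv M (\<lambda>\<omega>. \<Sum>t\<in>S i. b i t * (\<lambda>(c, z). X i c z) t \<omega>)"
      using gaussian[of i] S[of i] unfolding gaussian_family_def by blast
    then show ?thesis by (simp add: VS[abs_def] case_prod_unfold)
  qed
  have indV: "M2.indep_vars (\<lambda>_. borel) V UNIV"
  proof -
    have "M2.indep_vars (\<lambda>_. borel) (\<lambda>i \<omega>. (\<lambda>x. \<Sum>t\<in>S i. b i t * x t)
        (\<lambda>(c, z)\<in>UNIV \<times> space N. X i c z \<omega>)) UNIV"
    proof (rule M2.indep_vars_compose2[OF independent])
      fix i
      show "(\<lambda>x. \<Sum>t\<in>S i. b i t * x t) \<in> borel_measurable (Pi\<^sub>M (UNIV \<times> space N) (\<lambda>_. borel))"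
        using S(2)[of i]
        by (intro borel_measurable_sum borel_measurable_times borel_measurable_const measurable_component_singleton) auto
    qed
    moreover have "(\<Sum>t\<in>S i. b i t * (\<lambda>(c, z)\<in>UNIV \<times> space N. X i c z \<omega>) t) = V i \<omega>" for i \<omega>
      unfolding VS using S(2)[of i] by (intro sum.cong refl) (auto simp: mem_Times_iff case_prod_unfold)
    ultimately show ?thesis by simp
  qed
  have cov: "(\<integral>\<omega>. V i \<omega> * V j \<omega> \<partial>M) = 0" if "i \<noteq> j" for i j
  proof -
    have "M2.indep_vars (\<lambda>_. borel) V {i, j}" by (rule M2.indep_vars_subset[OF indV]) auto
    from M2.indep_vars_lebesgue_integral[OF _ this] M2.L2_integrable[OF VL] that mean
    show ?thesis by simp
  qed
  have sq: "(\<integral>\<omega>. (U \<omega>)\<^sup>2 \<partial>M) = (\<Sum>i\<in>UNIV. \<integral>\<omega>. (V i \<omega>)\<^sup>2 \<partial>M)"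
  proof -
    have "(\<integral>\<omega>. (U \<omega>)\<^sup>2 \<partial>M) = (\<integral>\<omega>. (\<Sum>i\<in>UNIV. \<Sum>j\<in>UNIV. V i \<omega> * V j \<omega>) \<partial>M)"
      by (simp add: Usum power2_eq_square sum_product)
    also have "\<dots> = (\<Sum>i\<in>UNIV. \<Sum>j\<in>UNIV. \<integral>\<omega>. V i \<omega> * V j \<omega> \<partial>M)"
      using L2_mult_integrable[OF VL VL] by (simp add: Bochner_Integration.integral_sum)
    also have "\<dots> = (\<Sum>i\<in>UNIV. \<Sum>j\<in>UNIV. if j = i then \<integral>\<omega>. (V i \<omega>)\<^sup>2 \<partial>M else 0)"
      using cov by (intro sum.cong refl) (auto simp: power2_eq_square)
    finally show ?thesis by simp
  qed
  have indE: "M2.indep_vars (\<lambda>_. borel) (\<lambda>i \<omega>. iexp (V i \<omega>)) UNIV"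
    by (rule M2.indep_vars_compose2[OF indV]) (auto intro!: borel_measurable_continuous_onI continuous_intros)
  have "(\<integral>\<omega>. iexp (U \<omega>) \<partial>M) = (\<integral>\<omega>. (\<Prod>i\<in>UNIV. iexp (V i \<omega>)) \<partial>M)"
    by (simp add: Usum exp_sum sum_distrib_left)
  also have "\<dots> = (\<Prod>i\<in>UNIV. \<integral>\<omega>. iexp (V i \<omega>) \<partial>M)"
    using L2_spaceD(1)[OF VL]
    by (intro M2.indep_vars_lebesgue_integral[OF _ indE] M2.integrable_iexp) auto
  also have "\<dots> = (\<Prod>i\<in>UNIV. exp (complex_of_real (- (\<integral>\<omega>. (V i \<omega>)\<^sup>2 \<partial>M) / 2)))"
    by (intro prod.cong refl M2.gaussian_rv_character gauss mean)
  also have "\<dots> = exp (complex_of_real (- (\<integral>\<omega>. (U \<omega>)\<^sup>2 \<partial>M) / 2))"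
    by (simp add: sq exp_sum[symmetric] sum_negf sum_divide_distrib)
  finally show ?thesis .
qed

text \<open>The character identity holds on the span, and both of its sides are continuous along L2
  limits: the left by \<open>L2_tendsto_character\<close>, the right by convergence of second
  moments.\<close>

sublocale G: gauss_hilbert M \<GG>
proof
  show "\<GG> \<subseteq> L2_space M" by (auto simp: \<GG>_eq L2_closure_def)
  show "(\<lambda>_. 0) \<in> \<GG>" unfolding \<GG>_eq by (rule zero_in_L2_closure_span)
  show "(\<lambda>\<omega>. a * f \<omega> + b * g \<omega>) \<in> \<GG>" if "f \<in> \<GG>" "g \<in> \<GG>" for f g a b
    using that unfolding \<GG>_eq by (rule L2_closure_span_lincomb)
  fix U assume "U \<in> \<GG>"
  then obtain V where V: "\<And>n::nat. V n \<in> lin_span gens" "L2_tendsto M V U sequentially"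
    unfolding \<GG>_eq using L2_closure_sequence by blast
  have 1: "(\<lambda>n. exp (complex_of_real (- (\<integral>\<omega>. (V n \<omega>)\<^sup>2 \<partial>M) / 2)))
      \<longlonglongrightarrow> exp (complex_of_real (- (\<integral>\<omega>. (U \<omega>)\<^sup>2 \<partial>M) / 2))"
    by (intro tendsto_intros M2.L2_tendsto_norm V) simp
  have 2: "(\<lambda>n. exp (complex_of_real (- (\<integral>\<omega>. (V n \<omega>)\<^sup>2 \<partial>M) / 2))) \<longlonglongrightarrow> (\<integral>\<omega>. iexp (U \<omega>) \<partial>M)"
    using M2.L2_tendsto_character[OF V(2)] by (simp only: span_character[OF V(1)])
  show "(\<integral>\<omega>. iexp (U \<omega>) \<partial>M) = exp (complex_of_real (- (\<integral>\<omega>. (U \<omega>)\<^sup>2 \<partial>M) / 2))"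
    by (rule LIMSEQ_unique[OF 2 1])
qed

lemma \<xi>_in_\<GG>: "z \<in> space N \<Longrightarrow> \<xi> z t \<in> \<GG>"
  unfolding \<GG>_eq \<xi>_def[abs_def]
  by (intro L2_closure_superset lin_span_superset X_L2) (auto simp: gens_def)

text \<open>With finitely many coordinates, independence reduces to a product formula for boxes. It
  factors first across rows, by independence of whole row processes, and then within each row, by
  standardness at z.\<close>

lemma \<xi>_std:
  assumes z: "z \<in> space N"
  shows "std_gaussian_vector M UNIV (\<xi> z)"
proof -
  have dist: "distributed M lborel (\<xi> z t) std_normal_density" for t
    using standard[OF z, of "fst t"] by (simp add: \<xi>_def[abs_def] std_gaussian_vector_def)
  have meas[measurable]: "\<xi> z t \<in> borel_measurable M" for t
    using M2.std_gaussian_vector_measurable[OF standard[OF z, of "fst t"]] by (simp add: \<xi>_def[abs_def])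
  have "M2.indep_vars (\<lambda>_. borel) (\<xi> z) UNIV"
  proof (subst M2.indep_vars_finite[where E="\<lambda>_. sets borel"])
    show "\<forall>A\<in>UNIV \<rightarrow> sets borel. M2.prob (\<Inter>t\<in>UNIV. \<xi> z t -` A t \<inter> space M) =
        (\<Prod>t\<in>UNIV. M2.prob (\<xi> z t -` A t \<inter> space M))"
    proof
      fix A :: "'l \<times> 'k option \<Rightarrow> real set" assume "A \<in> UNIV \<rightarrow> sets borel"
      then have A: "A t \<in> sets borel" for t by auto
      define fam where "fam i \<omega> = (\<lambda>(c, z)\<in>UNIV \<times> space N. X i c z \<omega>)" for i \<omega>
      \<comment> \<open>A cylinder set in the path space of row i constraining only the coordinates
        at z. This expresses the box event through the row processes to which independence
        refers.\<close>
      define B where "B i = {x \<in> space (Pi\<^sub>M (UNIV \<times> space N) (\<lambda>_. borel :: real measure)). \<forall>c\<in>UNIV. x (c, z) \<in> A (i, c)}" for i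
      have B: "B i \<in> sets (Pi\<^sub>M (UNIV \<times> space N) (\<lambda>_. borel))" for i
      proof -
        have m: "(\<lambda>x. x (c, z)) \<in> borel_measurable (Pi\<^sub>M (UNIV \<times> space N) (\<lambda>_. borel :: real measure))" for c :: "'k option"
          using z by (intro measurable_component_singleton) auto
        have "{x \<in> space (Pi\<^sub>M (UNIV \<times> space N) (\<lambda>_. borel :: real measure)). x (c, z) \<in> A (i, c)} \<in>
            sets (Pi\<^sub>M (UNIV \<times> space N) (\<lambda>_. borel))" for c :: "'k option"
          using measurable_sets[OF m[of c] A[of "(i, c)"]] by (simp add: vimage_def Int_def conj_commute)
        then show ?thesis unfolding B_def by (intro sets.sets_Collect_finite_All) auto
      qed
      have famB: "fam i -` B i \<inter> space M = (\<Inter>c\<in>UNIV. X i c z -` A (i, c) \<inter> space M)" for i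
        using z by (auto simp: fam_def B_def space_PiM)
      have "(\<Inter>t\<in>UNIV. \<xi> z t -` A t \<inter> space M) = (\<Inter>i\<in>UNIV. fam i -` B i \<inter> space M)"
        by (auto simp: famB \<xi>_def)
      also have "M2.prob \<dots> = (\<Prod>i\<in>UNIV. M2.prob (fam i -` B i \<inter> space M))"
        using B unfolding fam_def by (intro M2.indep_varsD_finite[OF independent]) auto
      also have "\<dots> = (\<Prod>i\<in>UNIV. \<Prod>c\<in>UNIV. M2.prob (X i c z -` A (i, c) \<inter> space M))"
        unfolding famB using standard[OF z] A
        by (intro prod.cong refl M2.indep_varsD_finite) (auto simp: std_gaussian_vector_def)
      also have "\<dots> = (\<Prod>t\<in>UNIV. M2.prob (\<xi> z t -` A t \<inter> space M))"
        by (simp add: prod.cartesian_product \<xi>_def[abs_def] case_prod_unfold)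
      finally show "M2.prob (\<Inter>t\<in>UNIV. \<xi> z t -` A t \<inter> space M) = (\<Prod>t\<in>UNIV. M2.prob (\<xi> z t -` A t \<inter> space M))" .
    qed
  qed (auto simp: Int_stable_def sets.sigma_sets_eq[of borel, simplified])
  then show ?thesis using dist by (simp add: std_gaussian_vector_def)
qed

lemma \<xi>_measurable[measurable]: "(\<lambda>p. \<xi> (fst p) t (snd p)) \<in> borel_measurable (N \<Otimes>\<^sub>M M)"
  using joint_measurable[of "fst t" "snd t"] by (simp add: \<xi>_def case_prod_unfold)

lemma \<xi>_vec_measurable: "(\<lambda>p t. \<xi> (fst p) t (snd p)) \<in> measurable (N \<Otimes>\<^sub>M M) (Pi\<^sub>M UNIV (\<lambda>_. borel))"
  by (rule measurable_PiM_single') (auto simp: space_PiM)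

lemma \<xi>_vec_measurable1:
  "z \<in> space N \<Longrightarrow> (\<lambda>\<omega> t. \<xi> z t \<omega>) \<in> measurable M (Pi\<^sub>M UNIV (\<lambda>_. borel))"
  using M2.std_gaussian_vector_measurable[OF \<xi>_std] by (intro measurable_PiM_single') (auto simp: space_PiM)

lemma \<xi>_integral:
  fixes F :: "_ \<Rightarrow> real"
  assumes z: "z \<in> space N" and F: "F \<in> borel_measurable (Pi\<^sub>M UNIV (\<lambda>_. borel))"
  shows "(\<integral>\<omega>. F (\<lambda>t. \<xi> z t \<omega>) \<partial>M) = (\<integral>x. F x \<partial>std_gauss)"
  unfolding M2.std_gaussian_vector_distr[OF \<xi>_std[OF z], symmetric]
  by (rule integral_distr[symmetric, OF \<xi>_vec_measurable1[OF z] F])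

lemma \<xi>_integrable:
  fixes F :: "_ \<Rightarrow> real"
  assumes z: "z \<in> space N" and F: "F \<in> borel_measurable (Pi\<^sub>M UNIV (\<lambda>_. borel))"
  shows "integrable M (\<lambda>\<omega>. F (\<lambda>t. \<xi> z t \<omega>)) \<longleftrightarrow> integrable std_gauss F"
  unfolding M2.std_gaussian_vector_distr[OF \<xi>_std[OF z], symmetric]
  by (rule integrable_distr_eq[symmetric, OF \<xi>_vec_measurable1[OF z] F])

text \<open>The uniform bound is the squared norm of \<open>F\<close> under the common law, attained
  at every z.\<close>

lemma \<xi>_field:
  assumes F: "F \<in> L2_space std_gauss"
  shows "L2_field N M (\<lambda>z \<omega>. F (\<lambda>t. \<xi> z t \<omega>))"
  unfolding L2_field_def
proof (intro conjI ballI exI)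
  have Fm[measurable]: "F \<in> borel_measurable (Pi\<^sub>M UNIV (\<lambda>_. borel))"
    using L2_spaceD(1)[OF F] by simp
  show "(\<lambda>(z, \<omega>). F (\<lambda>t. \<xi> z t \<omega>)) \<in> borel_measurable (N \<Otimes>\<^sub>M M)"
    using measurable_compose[OF \<xi>_vec_measurable Fm] by (simp add: case_prod_unfold)
  fix z assume z: "z \<in> space N"
  have sqm: "(\<lambda>x. (F x)\<^sup>2) \<in> borel_measurable (Pi\<^sub>M UNIV (\<lambda>_. borel))" by measurable
  show "(\<lambda>\<omega>. F (\<lambda>t. \<xi> z t \<omega>)) \<in> L2_space M"
    using measurable_compose[OF \<xi>_vec_measurable1[OF z] Fm] \<xi>_integrable[OF z sqm] L2_spaceD(2)[OF F]
    by (simp add: L2_space_def)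
  show "(\<integral>\<omega>. (F (\<lambda>t. \<xi> z t \<omega>))\<^sup>2 \<partial>M) \<le> (\<integral>x. (F x)\<^sup>2 \<partial>std_gauss)"
    using \<xi>_integral[OF z sqm] by simp
qed

section \<open>The \<sigma>-algebra generated by the Gaussian space\<close>

abbreviation \<Sigma> :: "'w measure" where "\<Sigma> \<equiv> gauss_sigma M \<GG>"

lemma gauss_sigma_space[simp]: "space \<Sigma> = space M"
  by (simp add: gauss_sigma_def space_measure_of_conv)

lemma gauss_sigma_gen: "f \<in> \<GG> \<Longrightarrow> A \<in> sets borel \<Longrightarrow> f -` A \<inter> space M \<in> sets \<Sigma>"
proof -
  have sub: "{f -` A \<inter> space M | f A. f \<in> \<GG> \<and> A \<in> sets borel} \<subseteq> Pow (space M)" by auto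
  assume "f \<in> \<GG>" "A \<in> sets borel"
  then show ?thesis
    unfolding gauss_sigma_def sets_measure_of[OF sub] by (intro sigma_sets.Basic) auto
qed

lemma gauss_sigma_subalgebra: "subalgebra M \<Sigma>"
proof -
  have sub: "{f -` A \<inter> space M | f A. f \<in> \<GG> \<and> A \<in> sets borel} \<subseteq> Pow (space M)" by auto
  have "sets \<Sigma> \<subseteq> sets M"
    unfolding gauss_sigma_def sets_measure_of[OF sub]
    using G.sub_L2 by (intro sets.sigma_sets_subset) (auto dest!: subsetD L2_spaceD(1) simp: measurable_sets)
  then show ?thesis by (simp add: subalgebra_def)
qed

lemma gauss_sigma_measurable: "f \<in> \<GG> \<Longrightarrow> f \<in> borel_measurable \<Sigma>"
  by (intro measurableI) (auto intro: gauss_sigma_gen)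

lemma gauss_sigma_null:
  assumes "A \<in> null_sets M" shows "A \<in> sets \<Sigma>"
proof -
  have A: "A \<in> sets M" "A \<subseteq> space M" using assms sets.sets_into_space by auto
  have ind: "(indicator A :: 'w \<Rightarrow> real) \<in> borel_measurable M" using A by simp
  have "AE \<omega> in M. 0 = (indicator A \<omega> :: real)"
    using AE_not_in[OF assms] by eventually_elim simp
  then have "(indicator A :: 'w \<Rightarrow> real) \<in> \<GG>"
    using L2_closure_AE_cong[OF zero_in_L2_closure_span ind] unfolding \<GG>_eq by blast
  from gauss_sigma_gen[OF this, of "{1}"] have "(indicator A :: 'w \<Rightarrow> real) -` {1} \<inter> space M \<in> sets \<Sigma>" by simp
  also have "(indicator A :: 'w \<Rightarrow> real) -` {1} \<inter> space M = A" using A by (auto simp: indicator_def)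
  finally show ?thesis .
qed

lemma gauss_sigma_AE_measurable:
  fixes f g :: "'w \<Rightarrow> real"
  assumes g: "g \<in> borel_measurable \<Sigma>" and f: "f \<in> borel_measurable M" and ae: "AE \<omega> in M. f \<omega> = g \<omega>"
  shows "f \<in> borel_measurable \<Sigma>"
proof (rule measurableI)
  fix A :: "real set" assume A: "A \<in> sets borel"
  obtain E where E: "{\<omega> \<in> space M. f \<omega> \<noteq> g \<omega>} \<subseteq> E" "E \<in> null_sets M"
    using ae by (auto simp: eventually_ae_filter)
  have E': "E \<in> sets \<Sigma>" by (rule gauss_sigma_null[OF E(2)])
  have "E \<inter> (f -` A \<inter> space M) \<in> null_sets M"
    using E(2) measurable_sets[OF f A] by (rule null_set_Int2)
  then have 1: "E \<inter> (f -` A \<inter> space M) \<in> sets \<Sigma>" by (rule gauss_sigma_null)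
  have 2: "g -` A \<inter> space M \<in> sets \<Sigma>" using measurable_sets[OF g A] by simp
  have "f -` A \<inter> space \<Sigma> = ((g -` A \<inter> space M) - E) \<union> (E \<inter> (f -` A \<inter> space M))"
    using E(1) by auto
  then show "f -` A \<inter> space \<Sigma> \<in> sets \<Sigma>"
    using 1 2 E' by (simp only: sets.Un sets.Diff)
qed simp

lemma \<xi>_gauss_sigma_measurable:
  assumes z: "z \<in> space N" and F: "F \<in> borel_measurable (Pi\<^sub>M UNIV (\<lambda>_. borel))"
  shows "(\<lambda>\<omega>. F (\<lambda>t. \<xi> z t \<omega>)) \<in> borel_measurable \<Sigma>"
proof -
  have "(\<lambda>\<omega> t. \<xi> z t \<omega>) \<in> measurable \<Sigma> (Pi\<^sub>M UNIV (\<lambda>_. borel))"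
    using gauss_sigma_measurable[OF \<xi>_in_\<GG>[OF z]]
    by (intro measurable_PiM_single') (auto simp: space_PiM)
  from measurable_compose[OF this F] show ?thesis .
qed

text \<open>The limit is tested against indicators: by Fubini, averaging over \<open>z\<close> commutes with
  conditioning on \<open>\<Sigma>\<close>.\<close>

lemma average_limit_gauss_sigma_measurable:
  assumes f: "\<And>e. e \<in> E \<Longrightarrow> L2_field N M (f e)"
    and meas: "\<And>e z. e \<in> E \<Longrightarrow> z \<in> space N \<Longrightarrow> f e z \<in> borel_measurable \<Sigma>"
    and lim: "L2_tendsto M (\<lambda>e \<omega>. \<integral>z. f e z \<omega> \<partial>N) J F"
    and F: "F \<noteq> bot" "eventually (\<lambda>e. e \<in> E) F"
  shows "J \<in> borel_measurable \<Sigma>"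
proof -
  interpret S: finite_measure_subalgebra M \<Sigma>
    by unfold_locales (rule gauss_sigma_subalgebra)
  have JL: "J \<in> L2_space M" using lim by (simp add: L2_tendsto_def)
  note Jint = M2.L2_integrable[OF JL]
  note [measurable] = L2_spaceD(1)[OF JL]
  \<comment> \<open>It suffices that \<open>J\<close> agrees almost surely with its conditional
    expectation, because \<open>\<Sigma>\<close> contains all null sets of \<open>M\<close>.\<close>
  define J' where "J' = real_cond_exp M \<Sigma> J"
  have J'int: "integrable M J'" unfolding J'_def by (rule S.real_cond_exp_int(1)[OF Jint])
  have "AE \<omega> in M. J \<omega> = J' \<omega>"
  proof (rule density_unique_real[OF Jint J'int])
    fix B assume B[measurable]: "B \<in> sets M"
    define h where "h = (indicator B :: 'w \<Rightarrow> real)"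
    define h' where "h' = real_cond_exp M \<Sigma> h"
    have hm[measurable]: "h \<in> borel_measurable M" by (simp add: h_def)
    have hint: "integrable M h" unfolding h_def using B by (intro M2.integrable_const_bound[of _ 1]) auto
    have hL: "h \<in> L2_space M"
      unfolding L2_space_def h_def using B
      by (auto intro!: M2.integrable_const_bound[of _ 1] simp: indicator_def)
    have [measurable]: "h' \<in> borel_measurable M" unfolding h'_def by simp
    have h01: "AE \<omega> in M. h \<omega> \<ge> 0" "AE \<omega> in M. h \<omega> \<le> 1" by (auto simp: h_def)
    have "AE \<omega> in M. h' \<omega> \<ge> 0"
      unfolding h'_def by (rule S.real_cond_exp_ge_c[OF hint h01(1)])
    moreover have "AE \<omega> in M. h' \<omega> \<le> 1"
      unfolding h'_def by (rule S.real_cond_exp_le_c[OF hint h01(2)])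
    ultimately have "AE \<omega> in M. norm ((h' \<omega>)\<^sup>2) \<le> 1"
      by eventually_elim (simp add: power_le_one)
    then have h'L: "h' \<in> L2_space M"
      unfolding L2_space_def by (auto intro!: M2.integrable_const_bound[of _ 1])
    have intg: "(\<integral>\<omega>. g \<omega> * h' \<omega> \<partial>M) = (\<integral>\<omega>. g \<omega> * h \<omega> \<partial>M)"
      if "g \<in> borel_measurable \<Sigma>" "integrable M (\<lambda>\<omega>. g \<omega> * h \<omega>)" for g
      unfolding h'_def using that hm by (intro S.real_cond_exp_intg(2)) auto
    \<comment> \<open>For fixed z the variable \<open>f e z\<close> is
      \<open>\<Sigma>\<close>-measurable, so pairing it with \<open>h\<close> or with the
      conditional expectation \<open>h'\<close> is the same. Fubini transfers this to the average,
      whose own measurability for \<open>\<Sigma>\<close> is not known at this point.\<close>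
    have eq: "(\<integral>\<omega>. (\<integral>z. f e z \<omega> \<partial>N) * h' \<omega> \<partial>M) = (\<integral>\<omega>. (\<integral>z. f e z \<omega> \<partial>N) * h \<omega> \<partial>M)" if e: "e \<in> E" for e
      unfolding L2_field_integral_mult(1)[OF f[OF e] h'L] L2_field_integral_mult(1)[OF f[OF e] hL]
      using L2_fieldD(2)[OF f[OF e]] meas[OF e] L2_mult_integrable[OF _ hL]
      by (intro Bochner_Integration.integral_cong refl intg) auto
    have "((\<lambda>e. \<integral>\<omega>. (\<integral>z. f e z \<omega> \<partial>N) * h' \<omega> \<partial>M) \<longlongrightarrow> (\<integral>\<omega>. J \<omega> * h' \<omega> \<partial>M)) F"
      by (rule L2_tendsto_integral_mult[OF lim h'L])
    moreover have "((\<lambda>e. \<integral>\<omega>. (\<integral>z. f e z \<omega> \<partial>N) * h' \<omega> \<partial>M) \<longlongrightarrow> (\<integral>\<omega>. J \<omega> * h \<omega> \<partial>M)) F"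
      by (rule Lim_transform_eventually[OF L2_tendsto_integral_mult[OF lim hL]])
        (use F(2) eq in \<open>auto elim: eventually_mono\<close>)
    ultimately have 1: "(\<integral>\<omega>. J \<omega> * h' \<omega> \<partial>M) = (\<integral>\<omega>. J \<omega> * h \<omega> \<partial>M)"
      using tendsto_unique[OF F(1)] by blast
    have 2: "(\<integral>\<omega>. h' \<omega> * J' \<omega> \<partial>M) = (\<integral>\<omega>. h' \<omega> * J \<omega> \<partial>M)"
      unfolding J'_def using L2_mult_integrable[OF h'L JL]
      by (intro S.real_cond_exp_intg(2)) (auto simp: h'_def)
    have iJ'h: "integrable M (\<lambda>\<omega>. J' \<omega> * h \<omega>)"
      using J'int by (intro Bochner_Integration.integrable_bound[OF J'int])
        (auto simp: h_def abs_mult split: split_indicator)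
    have 3: "(\<integral>\<omega>. J' \<omega> * h' \<omega> \<partial>M) = (\<integral>\<omega>. J' \<omega> * h \<omega> \<partial>M)"
      by (rule intg[OF _ iJ'h]) (simp add: J'_def)
    have "(\<integral>\<omega>. J \<omega> * h \<omega> \<partial>M) = (\<integral>\<omega>. J' \<omega> * h \<omega> \<partial>M)"
      using 1 2 3 by (simp add: mult.commute)
    then show "(\<integral>\<omega>\<in>B. J \<omega> \<partial>M) = (\<integral>\<omega>\<in>B. J' \<omega> \<partial>M)"
      by (simp add: set_lebesgue_integral_def h_def mult.commute)
  qed
  from gauss_sigma_AE_measurable[OF _ L2_spaceD(1)[OF JL] this] show ?thesis
    by (simp add: J'_def)
qed

end

section \<open>Projections of averages over the field\<close>

text \<open>Unnormalised Hermite coefficients: the expansion divides by \<open>multi_fact p\<close>,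
  the squared norm of \<open>multi_hermite p\<close>.\<close>

definition coef :: "(('t::finite \<Rightarrow> real) \<Rightarrow> real) \<Rightarrow> ('t \<Rightarrow> nat) \<Rightarrow> real" where
  "coef F p = (\<integral>x. F x * multi_hermite p x \<partial>std_gauss)"

context gaussian_field
begin

lemma space_N_nonempty: "\<exists>z. z \<in> space N"
  using M1.not_empty by auto

lemma multi_hermite_L2_std: "multi_hermite p \<in> L2_space (std_gauss :: ('l \<times> 'k option \<Rightarrow> real) measure)"
proof -
  obtain z where z: "z \<in> space N" using space_N_nonempty by auto
  have "(\<lambda>x. (multi_hermite p x)\<^sup>2) \<in> borel_measurable (Pi\<^sub>M (UNIV :: ('l \<times> 'k option) set) (\<lambda>_. borel))"
    by measurable
  from \<xi>_integrable[OF z this] L2_spaceD(2)[OF M2.multi_hermite_L2[OF \<xi>_std[OF z]], of p]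
  show ?thesis by (simp add: L2_space_def)
qed

lemma hermite_part_coef:
  assumes z: "z \<in> space N" and F: "F \<in> borel_measurable (Pi\<^sub>M UNIV (\<lambda>_. borel))"
  shows "G.hermite_part (\<xi> z) F q \<omega> =
    (\<Sum>p\<in>multi_index q. coef F p / multi_fact p * multi_hermite p (\<lambda>t. \<xi> z t \<omega>))"
proof -
  have "(\<lambda>x. F x * multi_hermite p x) \<in> borel_measurable (Pi\<^sub>M UNIV (\<lambda>_. borel))" for p
    using F by measurable
  then show ?thesis
    unfolding G.hermite_part_def coef_def by (simp add: \<xi>_integral[OF z, symmetric])
qed

definition hermite_average :: "('l \<times> 'k option \<Rightarrow> nat) \<Rightarrow> 'w \<Rightarrow> real" where
  "hermite_average p \<omega> = (\<integral>z. multi_hermite p (\<lambda>t. \<xi> z t \<omega>) \<partial>N)"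

lemma hermite_average_in_chaos:
  assumes "p \<in> multi_index q"
  shows "hermite_average p \<in> wiener_chaos M \<GG> q"
  unfolding G.wiener_chaos_eq hermite_average_def[abs_def]
  using G.multi_hermite_in_chaos[OF \<xi>_std \<xi>_in_\<GG> assms] G.wiener_chaos_eq
  by (intro L2_field_integral_in_closure \<xi>_field multi_hermite_L2_std) auto

text \<open>By Fubini the pairing is computed at fixed z, where the remainder of the degree q
  Hermite part is orthogonal to \<open>y\<close>. The coefficients do not depend on z, so they leave
  the average and only averages of Hermite polynomials remain.\<close>

lemma average_times_chaos:
  assumes F: "F \<in> L2_space std_gauss" and y: "y \<in> wiener_chaos M \<GG> q"
  shows "(\<integral>\<omega>. (\<integral>z. F (\<lambda>t. \<xi> z t \<omega>) \<partial>N) * y \<omega> \<partial>M) =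
    (\<Sum>p\<in>multi_index q. coef F p / multi_fact p * (\<integral>\<omega>. hermite_average p \<omega> * y \<omega> \<partial>M))"
proof -
  have Fm: "F \<in> borel_measurable (Pi\<^sub>M UNIV (\<lambda>_. borel))" using L2_spaceD(1)[OF F] by simp
  have yL: "y \<in> L2_space M" by (rule G.wiener_chaos_L2[OF y])
  define e where "e p z = (\<integral>\<omega>. multi_hermite p (\<lambda>t. \<xi> z t \<omega>) * y \<omega> \<partial>M)" for p z
  have eint: "integrable N (e p)" and eval: "(\<integral>z. e p z \<partial>N) = (\<integral>\<omega>. hermite_average p \<omega> * y \<omega> \<partial>M)" for p
    using L2_field_integral_mult[OF \<xi>_field[OF multi_hermite_L2_std[of p]] yL]
    by (simp_all add: e_def[abs_def] hermite_average_def)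
  have pt: "(\<integral>\<omega>. F (\<lambda>t. \<xi> z t \<omega>) * y \<omega> \<partial>M) = (\<Sum>p\<in>multi_index q. coef F p / multi_fact p * e p z)"
    if z: "z \<in> space N" for z
  proof -
    have FL: "(\<lambda>\<omega>. F (\<lambda>t. \<xi> z t \<omega>)) \<in> L2_space M" by (rule L2_fieldD(2)[OF \<xi>_field[OF F] z])
    have HL: "(\<lambda>\<omega>. multi_hermite p (\<lambda>t. \<xi> z t \<omega>)) \<in> L2_space M" for p
      by (rule L2_fieldD(2)[OF \<xi>_field[OF multi_hermite_L2_std] z])
    have PL: "G.hermite_part (\<xi> z) F q \<in> L2_space M"
      using G.hermite_part_in_chaos[OF \<xi>_std[OF z] \<xi>_in_\<GG>[OF z]] by (rule G.wiener_chaos_L2)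
    have "(\<integral>\<omega>. (F (\<lambda>t. \<xi> z t \<omega>) - G.hermite_part (\<xi> z) F q \<omega>) * y \<omega> \<partial>M) = 0"
      by (rule G.hermite_part_orthogonal[OF \<xi>_std[OF z] \<xi>_in_\<GG>[OF z] Fm FL y])
    then have "(\<integral>\<omega>. F (\<lambda>t. \<xi> z t \<omega>) * y \<omega> \<partial>M) = (\<integral>\<omega>. G.hermite_part (\<xi> z) F q \<omega> * y \<omega> \<partial>M)"
      using L2_mult_integrable[OF FL yL] L2_mult_integrable[OF PL yL] by (simp add: left_diff_distrib)
    also have "\<dots> = (\<integral>\<omega>. (\<Sum>p\<in>multi_index q. coef F p / multi_fact p * (multi_hermite p (\<lambda>t. \<xi> z t \<omega>) * y \<omega>)) \<partial>M)"
      by (simp add: hermite_part_coef[OF z Fm] sum_distrib_right mult.assoc)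
    also have "\<dots> = (\<Sum>p\<in>multi_index q. coef F p / multi_fact p * e p z)"
      using L2_mult_integrable[OF HL yL]
      by (subst Bochner_Integration.integral_sum) (auto simp: e_def)
    finally show ?thesis .
  qed
  have "(\<integral>\<omega>. (\<integral>z. F (\<lambda>t. \<xi> z t \<omega>) \<partial>N) * y \<omega> \<partial>M) =
      (\<integral>z. (\<integral>\<omega>. F (\<lambda>t. \<xi> z t \<omega>) * y \<omega> \<partial>M) \<partial>N)"
    by (rule L2_field_integral_mult(1)[OF \<xi>_field[OF F] yL])
  also have "\<dots> = (\<integral>z. (\<Sum>p\<in>multi_index q. coef F p / multi_fact p * e p z) \<partial>N)"
    by (intro Bochner_Integration.integral_cong refl pt)
  also have "\<dots> = (\<Sum>p\<in>multi_index q. coef F p / multi_fact p * (\<integral>\<omega>. hermite_average p \<omega> * y \<omega> \<partial>M))"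
    using eint by (subst Bochner_Integration.integral_sum) (auto simp: eval)
  finally show ?thesis .
qed

text \<open>For fixed \<open>y\<close> in the chaos, the pairing converges to that of
  \<open>J\<close> by L2 convergence, and equals a finite sum whose coefficients converge to
  \<open>c\<close>. Uniqueness of the limit identifies the projection; convergence is asked of the
  averages and of the coefficients, while the functions \<open>F e\<close> themselves may
  diverge.\<close>

lemma limit_projection:
  assumes F: "\<And>e. e > 0 \<Longrightarrow> F e \<in> L2_space std_gauss"
    and lim: "L2_tendsto M (\<lambda>e \<omega>. \<integral>z. F e (\<lambda>t. \<xi> z t \<omega>) \<partial>N) J (at_right 0)"
    and c: "\<And>p. ((\<lambda>e. coef (F e) p) \<longlongrightarrow> c p) (at_right (0::real))"
  shows "is_chaos_proj M \<GG> q J (\<lambda>\<omega>. \<Sum>p\<in>multi_index q. c p / multi_fact p * hermite_average p \<omega>)"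
  unfolding is_chaos_proj_def
proof (intro conjI ballI)
  show JL: "J \<in> L2_space M" using lim by (simp add: L2_tendsto_def)
  have pos: "eventually (\<lambda>e. e > (0::real)) (at_right 0)"
    by (simp add: eventually_at_right_less)
  show "J \<in> borel_measurable \<Sigma>"
  proof (rule average_limit_gauss_sigma_measurable[where E="{0<..}", OF _ _ lim])
    show "L2_field N M (\<lambda>z \<omega>. F e (\<lambda>t. \<xi> z t \<omega>))" if "e \<in> {0<..}" for e
      using that by (intro \<xi>_field F) auto
    show "(\<lambda>\<omega>. F e (\<lambda>t. \<xi> z t \<omega>)) \<in> borel_measurable \<Sigma>" if "e \<in> {0<..}" "z \<in> space N" for e z
      using that L2_spaceD(1)[OF F[of e]] by (intro \<xi>_gauss_sigma_measurable) auto
  qed (use pos in \<open>auto elim: eventually_mono\<close>)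
  show R: "(\<lambda>\<omega>. \<Sum>p\<in>multi_index q. c p / multi_fact p * hermite_average p \<omega>) \<in> wiener_chaos M \<GG> q"
    using hermite_average_in_chaos unfolding G.wiener_chaos_eq by (intro L2_closure_span_sum) auto
  fix y assume y: "y \<in> wiener_chaos M \<GG> q"
  have yL: "y \<in> L2_space M" by (rule G.wiener_chaos_L2[OF y])
  have IL: "hermite_average p \<in> L2_space M" if "p \<in> multi_index q" for p
    by (rule G.wiener_chaos_L2[OF hermite_average_in_chaos[OF that]])
  have "((\<lambda>e. \<Sum>p\<in>multi_index q. coef (F e) p / multi_fact p * (\<integral>\<omega>. hermite_average p \<omega> * y \<omega> \<partial>M)) \<longlongrightarrow>
     (\<Sum>p\<in>multi_index q. c p / multi_fact p * (\<integral>\<omega>. hermite_average p \<omega> * y \<omega> \<partial>M))) (at_right 0)"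
    by (intro tendsto_intros c multi_fact_nonzero)
  then have "((\<lambda>e. \<integral>\<omega>. (\<integral>z. F e (\<lambda>t. \<xi> z t \<omega>) \<partial>N) * y \<omega> \<partial>M) \<longlongrightarrow>
     (\<Sum>p\<in>multi_index q. c p / multi_fact p * (\<integral>\<omega>. hermite_average p \<omega> * y \<omega> \<partial>M))) (at_right 0)"
    by (rule Lim_transform_eventually)
      (use pos in \<open>auto elim!: eventually_mono simp: average_times_chaos[OF F y]\<close>)
  then have "(\<integral>\<omega>. J \<omega> * y \<omega> \<partial>M) =
      (\<Sum>p\<in>multi_index q. c p / multi_fact p * (\<integral>\<omega>. hermite_average p \<omega> * y \<omega> \<partial>M))"
    using L2_tendsto_integral_mult[OF lim yL] tendsto_unique trivial_limit_at_right_real by blast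
  also have "\<dots> = (\<integral>\<omega>. (\<Sum>p\<in>multi_index q. c p / multi_fact p * (hermite_average p \<omega> * y \<omega>)) \<partial>M)"
    using L2_mult_integrable[OF IL yL] by (subst Bochner_Integration.integral_sum) auto
  also have "\<dots> = (\<integral>\<omega>. (\<Sum>p\<in>multi_index q. c p / multi_fact p * hermite_average p \<omega>) * y \<omega> \<partial>M)"
    by (simp add: sum_distrib_right mult.assoc)
  finally show "(\<integral>\<omega>. (J \<omega> - (\<Sum>p\<in>multi_index q. c p / multi_fact p * hermite_average p \<omega>)) * y \<omega> \<partial>M) = 0"
    using L2_mult_integrable[OF JL yL] L2_mult_integrable[OF G.wiener_chaos_L2[OF R] yL]
    by (simp add: left_diff_distrib)
qed

end

section \<open>Hermite coefficients of localised functionals\<close>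

text \<open>The integrand H_j times the normal density is continuous, so its mean over a window
  shrinking to u tends to its value at u. This is the origin of
  \<open>hermite_coeff\<close>.\<close>

lemma window_limit:
  "((\<lambda>e. \<integral>y. inverse (2 * e) * indicator {-e..e} (y - u) * poly (hermite j) y \<partial>std_normal_distribution)
     \<longlongrightarrow> hermite_coeff u j) (at_right 0)"
proof -
  define h where "h y = poly (hermite j) y * std_normal_density y" for y
  have hc: "continuous_on UNIV h"
    unfolding h_def[abs_def] normal_density_def by (intro continuous_intros) auto
  have hint: "integrable lborel h"
    using integrable_std_normal_poly[of "hermite j"] by (simp add: h_def[abs_def] mult.commute)
  define w where "w e = (\<integral>y. inverse (2 * e) * indicator {-e..e} (y - u) * poly (hermite j) y \<partial>std_normal_distribution)" for e
  have w: "w e = (\<integral>y. inverse (2 * e) * (indicator {u - e..u + e} y * h y) \<partial>lborel)" for e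
  proof -
    have [measurable]: "(\<lambda>y. poly (hermite j) y) \<in> borel_measurable borel" by (rule borel_measurable_poly)
    have "w e = (\<integral>y. std_normal_density y *\<^sub>R (inverse (2 * e) * indicator {-e..e} (y - u) * poly (hermite j) y) \<partial>lborel)"
      unfolding w_def by (rule integral_density) auto
    also have "\<dots> = (\<integral>y. inverse (2 * e) * (indicator {u - e..u + e} y * h y) \<partial>lborel)"
      by (intro Bochner_Integration.integral_cong refl) (auto simp: h_def indicator_def)
    finally show ?thesis .
  qed
  have "(w \<longlongrightarrow> h u) (at_right 0)"
  proof (rule tendstoI)
    fix r :: real assume r: "r > 0"
    have "\<exists>d>0. \<forall>y. dist y u < d \<longrightarrow> dist (h y) (h u) < r / 2"
      using hc[unfolded continuous_on_iff, rule_format, of u "r / 2"] r by simp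
    then obtain d where d: "d > 0" "\<And>y. dist y u < d \<Longrightarrow> dist (h y) (h u) < r / 2" by auto
    have "dist (w e) (h u) < r" if e: "0 < e" "e < d" for e
    proof -
      have ind: "integrable lborel (indicator {u - e..u + e} :: real \<Rightarrow> real)"
        by (rule integrable_real_indicator) (simp_all add: emeasure_lborel_Icc_eq)
      have ih: "integrable lborel (\<lambda>y. indicator {u - e..u + e} y * h y)"
        using integrable_mult_indicator[OF _ hint, of "{u - e..u + e}"] by simp
      have one: "(\<integral>y. indicator {u - e..u + e} y \<partial>lborel) = 2 * e" using e by simp
      have "w e - h u = (\<integral>y. inverse (2 * e) * (indicator {u - e..u + e} y * (h y - h u)) \<partial>lborel)"
      proof -
        have "(\<integral>y. inverse (2 * e) * (indicator {u - e..u + e} y * (h y - h u)) \<partial>lborel) =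
          (\<integral>y. inverse (2 * e) * (indicator {u - e..u + e} y * h y) - inverse (2 * e) * h u * indicator {u - e..u + e} y \<partial>lborel)"
          by (intro Bochner_Integration.integral_cong refl) (simp add: algebra_simps)
        also have "\<dots> = (\<integral>y. inverse (2 * e) * (indicator {u - e..u + e} y * h y) \<partial>lborel)
            - inverse (2 * e) * h u * (\<integral>y. indicator {u - e..u + e} y \<partial>lborel)"
          using ih ind by (subst Bochner_Integration.integral_diff) auto
        also have "\<dots> = w e - h u" using e unfolding w one by simp
        finally show ?thesis ..
      qed
      then have "\<bar>w e - h u\<bar> \<le> (\<integral>y. \<bar>inverse (2 * e) * (indicator {u - e..u + e} y * (h y - h u))\<bar> \<partial>lborel)"
        by (simp only: integral_abs_bound)
      also have "\<dots> \<le> (\<integral>y. inverse (2 * e) * (r / 2) * indicator {u - e..u + e} y \<partial>lborel)"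
      proof (rule integral_mono)
        have "integrable lborel (\<lambda>y. inverse (2 * e) * (indicator {u - e..u + e} y * h y) - inverse (2 * e) * h u * indicator {u - e..u + e} y)"
          using ih ind by (intro Bochner_Integration.integrable_diff) auto
        then have "integrable lborel (\<lambda>y. inverse (2 * e) * (indicator {u - e..u + e} y * (h y - h u)))"
          by (simp add: algebra_simps)
        then show "integrable lborel (\<lambda>y. \<bar>inverse (2 * e) * (indicator {u - e..u + e} y * (h y - h u))\<bar>)"
          by (rule integrable_abs)
        fix y
        show "\<bar>inverse (2 * e) * (indicator {u - e..u + e} y * (h y - h u))\<bar> \<le> inverse (2 * e) * (r / 2) * indicator {u - e..u + e} y"
        proof (cases "y \<in> {u - e..u + e}")
          case True
          then have "dist y u < d" using e by (auto simp: dist_real_def)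
          from d(2)[OF this] have "\<bar>h y - h u\<bar> \<le> r / 2" by (simp add: dist_real_def)
          then show ?thesis using True e by (simp add: abs_mult divide_right_mono)
        qed simp
      qed (use ind in auto)
      also have "\<dots> = r / 2" using e by (simp add: field_simps)
      finally show ?thesis using r by (simp add: dist_real_def)
    qed
    then show "eventually (\<lambda>e. dist (w e) (h u) < r) (at_right 0)"
      unfolding eventually_at_right_field using d(1) by (intro exI[of _ d]) auto
  qed
  then show ?thesis by (simp add: w_def[abs_def] h_def hermite_coeff_def)
qed

text \<open>Independence of the coordinates in \<open>I\<close> from the others, obtained by folding
  the product measure along \<open>I\<close> and its complement.\<close>

lemma std_gauss_product_split:
  fixes f :: "'t::finite \<Rightarrow> real \<Rightarrow> real" and g :: "('t \<Rightarrow> real) \<Rightarrow> real"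
  assumes f: "\<And>t. t \<in> I \<Longrightarrow> integrable std_normal_distribution (f t)"
    and g: "integrable std_gauss g" and fg: "integrable std_gauss (\<lambda>x. (\<Prod>t\<in>I. f t (x t)) * g x)"
    and indep: "\<And>x y. (\<And>t. t \<notin> I \<Longrightarrow> x t = y t) \<Longrightarrow> g x = g y"
  shows "(\<integral>x. (\<Prod>t\<in>I. f t (x t)) * g x \<partial>std_gauss) =
    (\<Prod>t\<in>I. \<integral>y. f t y \<partial>std_normal_distribution) * (\<integral>x. g x \<partial>std_gauss)"
proof -
  interpret P: product_prob_space "\<lambda>_ :: 't. std_normal_distribution"
    by (rule product_prob_spaceI) (rule prob_space_normal_density, simp)
  have U: "I \<union> (-I) = UNIV" by auto
  \<comment> \<open>The value 0 is an arbitrary filler: \<open>g\<close> does not see the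
    coordinates in \<open>I\<close>.\<close>
  define h where "h y = g (merge I (-I) (\<lambda>_. 0, y))" for y
  have gm: "g (merge I (-I) (x, y)) = h y" for x y
    unfolding h_def by (rule indep) (simp add: merge_def)
  have fold: "(\<integral>x. k x \<partial>std_gauss) = (\<integral>x. (\<integral>y. k (merge I (-I) (x, y)) \<partial>Pi\<^sub>M (-I) (\<lambda>_. std_normal_distribution))
       \<partial>Pi\<^sub>M I (\<lambda>_. std_normal_distribution))" if "integrable std_gauss k" for k :: "('t \<Rightarrow> real) \<Rightarrow> real"
    using P.product_integral_fold[of I "-I" k] that unfolding std_gauss_def U by simp
  have PI: "prob_space (Pi\<^sub>M I (\<lambda>_ :: 't. std_normal_distribution))"
    by (rule prob_space_PiM) (rule prob_space_normal_density, simp)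
  have gi: "(\<integral>x. g x \<partial>std_gauss) = (\<integral>y. h y \<partial>Pi\<^sub>M (-I) (\<lambda>_. std_normal_distribution))"
    unfolding fold[OF g] gm by (simp add: prob_space.prob_space[OF PI])
  have m: "(\<Prod>t\<in>I. f t (merge I (-I) (x, y) t)) = (\<Prod>t\<in>I. f t (x t))" for x y
    by (intro prod.cong refl) (simp add: merge_def)
  have "(\<integral>x. (\<Prod>t\<in>I. f t (x t)) * g x \<partial>std_gauss) =
     (\<integral>x. (\<Prod>t\<in>I. f t (x t)) * (\<integral>x. g x \<partial>std_gauss) \<partial>Pi\<^sub>M I (\<lambda>_. std_normal_distribution))"
    unfolding fold[OF fg] gm m gi by simp
  also have "\<dots> = (\<integral>x. (\<Prod>t\<in>I. f t (x t)) \<partial>Pi\<^sub>M I (\<lambda>_. std_normal_distribution)) * (\<integral>x. g x \<partial>std_gauss)"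
    by simp
  also have "(\<integral>x. (\<Prod>t\<in>I. f t (x t)) \<partial>Pi\<^sub>M I (\<lambda>_. std_normal_distribution)) =
     (\<Prod>t\<in>I. \<integral>y. f t y \<partial>std_normal_distribution)"
    by (rule P.product_integral_prod) (auto intro: f)
  finally show ?thesis .
qed

lemma prod_option_split:
  fixes f :: "'l::finite \<times> 'k::finite option \<Rightarrow> 'b::comm_monoid_mult"
  shows "(\<Prod>t\<in>UNIV. f t) = (\<Prod>i\<in>UNIV. f (i, None)) * (\<Prod>i\<in>UNIV. \<Prod>j\<in>UNIV. f (i, Some j))"
proof -
  have "(\<Prod>t\<in>UNIV. f t) = (\<Prod>i\<in>UNIV. \<Prod>c\<in>UNIV. f (i, c))"
    by (simp add: prod.cartesian_product)
  also have "\<dots> = (\<Prod>i\<in>UNIV. f (i, None) * (\<Prod>j\<in>UNIV. f (i, Some j)))"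
    by (simp add: UNIV_option_conv prod.reindex)
  finally show ?thesis by (simp add: prod.distrib)
qed

lemma sum_option_split:
  fixes f :: "'l::finite \<times> 'k::finite option \<Rightarrow> 'b::comm_monoid_add"
  shows "(\<Sum>t\<in>UNIV. f t) = (\<Sum>i\<in>UNIV. f (i, None)) + (\<Sum>i\<in>UNIV. \<Sum>j\<in>UNIV. f (i, Some j))"
proof -
  have "(\<Sum>t\<in>UNIV. f t) = (\<Sum>i\<in>UNIV. \<Sum>c\<in>UNIV. f (i, c))"
    by (simp add: sum.cartesian_product)
  also have "\<dots> = (\<Sum>i\<in>UNIV. f (i, None) + (\<Sum>j\<in>UNIV. f (i, Some j)))"
    by (simp add: UNIV_option_conv sum.reindex)
  finally show ?thesis by (simp add: sum.distrib)
qed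

text \<open>\<open>tail_index\<close> erases the degrees in the localised coordinates
  \<open>None\<close>, and \<open>join_index\<close> inserts new ones there. They separate the
  Hermite factors in the field \<open>G\<close> from those in the weight \<open>W\<close>.\<close>

definition tail_index :: "('l \<times> 'k option \<Rightarrow> nat) \<Rightarrow> 'l \<times> 'k option \<Rightarrow> nat" where
  "tail_index p t = (if snd t = None then 0 else p t)"

definition join_index :: "('l \<Rightarrow> nat) \<Rightarrow> ('l \<times> 'k option \<Rightarrow> nat) \<Rightarrow> 'l \<times> 'k option \<Rightarrow> nat" where
  "join_index j p t = (if snd t = None then j (fst t) else p t)"

lemma multi_hermite_split:
  fixes p :: "'l::finite \<times> 'k::finite option \<Rightarrow> nat"
  shows "multi_hermite p x = (\<Prod>i\<in>UNIV. poly (hermite (p (i, None))) (x (i, None))) * multi_hermite (tail_index p) x"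
  unfolding multi_hermite_def prod_option_split by (simp add: tail_index_def)

lemma multi_fact_split:
  fixes p :: "'l::finite \<times> 'k::finite option \<Rightarrow> nat"
  shows "multi_fact p = (\<Prod>i\<in>UNIV. fact (p (i, None))) * multi_fact (tail_index p)"
  unfolding multi_fact_def prod_option_split by (simp add: tail_index_def)

text \<open>The general chaos formula rests on the two properties assumed here; the second says that
  the weight ignores the localised coordinates. The symmetries of \<Phi> enter later, in the low and
  odd degrees.\<close>

locale gaussian_functional = gaussian_field N M X
  for N :: "'z measure" and M :: "'w measure" and X :: "'l::finite \<Rightarrow> 'k::finite option \<Rightarrow> 'z \<Rightarrow> 'w \<Rightarrow> real" +
  fixes \<Psi> :: "('l \<times> 'k option \<Rightarrow> real) \<Rightarrow> real"
  assumes \<Psi>_L2: "\<Psi> \<in> L2_space std_gauss"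
    and \<Psi>_tail: "\<And>x y. (\<And>i j. x (i, Some j) = y (i, Some j)) \<Longrightarrow> \<Psi> x = \<Psi> y"
begin

lemma \<Psi>_measurable[measurable]: "\<Psi> \<in> borel_measurable (Pi\<^sub>M UNIV (\<lambda>_. borel))"
  using L2_spaceD(1)[OF \<Psi>_L2] by simp

lemma weighted_L2:
  fixes w :: "'l \<Rightarrow> real \<Rightarrow> real"
  assumes w: "\<And>i. w i \<in> borel_measurable borel" and B: "\<And>i y. \<bar>w i y\<bar> \<le> B"
  shows "(\<lambda>x. (\<Prod>i\<in>UNIV. w i (x (i, None))) * \<Psi> x) \<in> L2_space std_gauss"
proof -
  have m: "(\<lambda>x. (\<Prod>i\<in>UNIV. w i (x (i, None))) * \<Psi> x) \<in> borel_measurable (Pi\<^sub>M UNIV (\<lambda>_. borel))"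
    by (intro borel_measurable_times borel_measurable_prod measurable_compose[OF _ w] measurable_component_singleton \<Psi>_measurable) simp
  have bound: "\<bar>\<Prod>i\<in>UNIV. w i (x (i, None))\<bar> \<le> B ^ CARD('l)" for x :: "'l \<times> 'k option \<Rightarrow> real"
  proof -
    have "\<bar>\<Prod>i\<in>UNIV. w i (x (i, None))\<bar> \<le> (\<Prod>i\<in>(UNIV :: 'l set). B)"
      unfolding abs_prod using B by (intro prod_mono) auto
    then show ?thesis by simp
  qed
  have "integrable std_gauss (\<lambda>x. ((\<Prod>i\<in>UNIV. w i (x (i, None))) * \<Psi> x)\<^sup>2)"
  proof (rule Bochner_Integration.integrable_bound)
    show "integrable std_gauss (\<lambda>x. (B ^ CARD('l))\<^sup>2 * (\<Psi> x)\<^sup>2)" using L2_spaceD(2)[OF \<Psi>_L2] by simp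
    show "(\<lambda>x. ((\<Prod>i\<in>UNIV. w i (x (i, None))) * \<Psi> x)\<^sup>2) \<in> borel_measurable std_gauss"
      using m by simp
    have "(\<Prod>i\<in>UNIV. w i (x (i, None)))\<^sup>2 \<le> (B ^ CARD('l))\<^sup>2" for x :: "'l \<times> 'k option \<Rightarrow> real"
      using bound[of x] by (simp add: abs_le_square_iff[symmetric])
    then show "AE x in std_gauss. norm (((\<Prod>i\<in>UNIV. w i (x (i, None))) * \<Psi> x)\<^sup>2) \<le> norm ((B ^ CARD('l))\<^sup>2 * (\<Psi> x)\<^sup>2)"
      by (auto simp: power_mult_distrib abs_mult intro!: mult_right_mono AE_I2)
  qed
  then show ?thesis using m by (simp add: L2_space_def)
qed

text \<open>The \<open>None\<close> coordinates are independent of those that \<Psi> uses, so the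
  coefficient factors. Boundedness of the weights keeps every function involved square
  integrable.\<close>

lemma coef_weighted:
  fixes w :: "'l \<Rightarrow> real \<Rightarrow> real"
  assumes w: "\<And>i. w i \<in> borel_measurable borel" and B: "\<And>i y. \<bar>w i y\<bar> \<le> B"
  shows "coef (\<lambda>x. (\<Prod>i\<in>UNIV. w i (x (i, None))) * \<Psi> x) p =
    (\<Prod>i\<in>UNIV. \<integral>y. w i y * poly (hermite (p (i, None))) y \<partial>std_normal_distribution) * coef \<Psi> (tail_index p)"
proof -
  define I where "I = range (\<lambda>i :: 'l. (i, None :: 'k option))"
  have inj: "inj (\<lambda>i :: 'l. (i, None :: 'k option))" by (auto intro: injI)
  define f where "f t y = w (fst t) y * poly (hermite (p t)) y" for t y
  define g where "g x = \<Psi> x * multi_hermite (tail_index p) x" for x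
  have eq: "(\<Prod>i\<in>UNIV. w i (x (i, None))) * \<Psi> x * multi_hermite p x = (\<Prod>t\<in>I. f t (x t)) * g x" for x
    unfolding I_def prod.reindex[OF inj] f_def g_def
    by (subst multi_hermite_split) (simp add: prod.distrib)
  have polyint: "integrable std_normal_distribution (poly P)" for P :: "real poly"
    using integrable_std_normal_poly[of P] by (simp add: integrable_density)
  have "coef (\<lambda>x. (\<Prod>i\<in>UNIV. w i (x (i, None))) * \<Psi> x) p = (\<integral>x. (\<Prod>t\<in>I. f t (x t)) * g x \<partial>std_gauss)"
    unfolding coef_def eq ..
  also have "\<dots> = (\<Prod>t\<in>I. \<integral>y. f t y \<partial>std_normal_distribution) * (\<integral>x. g x \<partial>std_gauss)"
  proof (rule std_gauss_product_split)
    fix t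
    show "integrable std_normal_distribution (f t)"
    proof (rule Bochner_Integration.integrable_bound)
      show "integrable std_normal_distribution (\<lambda>y. B * poly (hermite (p t)) y)" using polyint by simp
      have "0 \<le> B" using B[of undefined 0] by linarith
      then show "AE y in std_normal_distribution. norm (f t y) \<le> norm (B * poly (hermite (p t)) y)"
        using B by (auto simp: f_def abs_mult intro!: mult_right_mono AE_I2)
      show "f t \<in> borel_measurable std_normal_distribution"
        using w unfolding f_def[abs_def] by (auto intro!: borel_measurable_times borel_measurable_poly)
    qed
  next
    show "integrable std_gauss g"
      unfolding g_def[abs_def] by (rule L2_mult_integrable[OF \<Psi>_L2 multi_hermite_L2_std])
    show "integrable std_gauss (\<lambda>x. (\<Prod>t\<in>I. f t (x t)) * g x)"
      unfolding eq[symmetric] by (rule L2_mult_integrable[OF weighted_L2[OF w B] multi_hermite_L2_std])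
  next
    fix x y :: "'l \<times> 'k option \<Rightarrow> real" assume xy: "\<And>t. t \<notin> I \<Longrightarrow> x t = y t"
    have "\<Psi> x = \<Psi> y" by (rule \<Psi>_tail) (auto intro!: xy simp: I_def)
    moreover have "multi_hermite (tail_index p) x = multi_hermite (tail_index p) y"
      unfolding multi_hermite_def
    proof (intro prod.cong refl)
      fix t
      show "poly (hermite (tail_index p t)) (x t) = poly (hermite (tail_index p t)) (y t)"
        using xy[of t] by (cases "snd t"; cases t) (auto simp: tail_index_def I_def image_iff)
    qed
    ultimately show "g x = g y" by (simp add: g_def)
  qed
  finally show ?thesis
    unfolding I_def prod.reindex[OF inj] f_def g_def coef_def by simp
qed

text \<open>The factorisation with all weights equal to 1: a Hermite polynomial of positive degree
  has Gaussian mean 0.\<close>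

lemma coef_\<Psi>_head:
  assumes "p (i, None) \<noteq> 0"
  shows "coef \<Psi> p = 0"
proof -
  have z: "(\<integral>y. poly (hermite n) y \<partial>std_normal_distribution) = 0" if "n \<noteq> 0" for n
  proof -
    have "(\<integral>y. poly (hermite n) y \<partial>std_normal_distribution) = gauss_int (hermite n * hermite 0)"
      unfolding gauss_int_def by (subst integral_density) (auto intro!: borel_measurable_poly)
    then show ?thesis using that by (simp only: gauss_int_hermite_mult) simp
  qed
  have "coef \<Psi> p = coef (\<lambda>x. (\<Prod>i\<in>(UNIV :: 'l set). 1) * \<Psi> x) p" by simp
  also have "\<dots> = (\<Prod>i\<in>UNIV. \<integral>y. 1 * poly (hermite (p (i, None))) y \<partial>std_normal_distribution) * coef \<Psi> (tail_index p)"
    by (rule coef_weighted[of "\<lambda>_ _. 1" 1]) auto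
  also have "(\<Prod>i\<in>UNIV. \<integral>y. 1 * poly (hermite (p (i, None))) y \<partial>std_normal_distribution) = 0"
    using z[OF assms] by (intro prod_zero) (auto intro!: bexI[of _ i])
  finally show ?thesis by simp
qed

definition local_functional :: "('l \<Rightarrow> real) \<Rightarrow> real \<Rightarrow> ('l \<times> 'k option \<Rightarrow> real) \<Rightarrow> real" where
  "local_functional u e x = inverse ((2 * e) ^ CARD('l)) *
     (\<Prod>i\<in>UNIV. indicator {-e..e} (x (i, None) - u i)) * \<Psi> x"

definition local_coef :: "('l \<Rightarrow> real) \<Rightarrow> ('l \<times> 'k option \<Rightarrow> nat) \<Rightarrow> real" where
  "local_coef u p = (\<Prod>i\<in>UNIV. hermite_coeff (u i) (p (i, None))) * coef \<Psi> (tail_index p)"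

lemma local_functional_eq:
  "local_functional u e = (\<lambda>x. (\<Prod>i\<in>UNIV. inverse (2 * e) * indicator {-e..e} (x (i, None) - u i)) * \<Psi> x)"
  by (simp only: local_functional_def[abs_def] prod.distrib prod_constant power_inverse)

lemma window_weight:
  fixes u y :: real
  assumes "e > 0"
  shows "(\<lambda>y. inverse (2 * e) * indicator {-e..e} (y - u)) \<in> borel_measurable borel"
    and "\<bar>inverse (2 * e) * indicator {-e..e} (y - u)\<bar> \<le> inverse (2 * e)"
  using assms by (auto simp: abs_mult split: split_indicator)

lemma local_functional_L2: "e > 0 \<Longrightarrow> local_functional u e \<in> L2_space std_gauss"
  unfolding local_functional_eq by (rule weighted_L2[where B="inverse (2 * e)"]) (rule window_weight, assumption)+

lemma local_coef_limit: "((\<lambda>e. coef (local_functional u e) p) \<longlongrightarrow> local_coef u p) (at_right 0)"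
proof -
  have "((\<lambda>e. (\<Prod>i\<in>UNIV. \<integral>y. inverse (2 * e) * indicator {-e..e} (y - u i) * poly (hermite (p (i, None))) y
     \<partial>std_normal_distribution) * coef \<Psi> (tail_index p)) \<longlongrightarrow> local_coef u p) (at_right 0)"
    unfolding local_coef_def by (intro tendsto_intros window_limit)
  moreover have "eventually (\<lambda>e. (\<Prod>i\<in>UNIV. \<integral>y. inverse (2 * e) * indicator {-e..e} (y - u i) * poly (hermite (p (i, None))) y
     \<partial>std_normal_distribution) * coef \<Psi> (tail_index p) = coef (local_functional u e) p) (at_right 0)"
    using eventually_at_right_less[of 0]
  proof eventually_elim
    case (elim e)
    show ?case
      unfolding local_functional_eq
      by (rule coef_weighted[symmetric, where B="inverse (2 * e)"]) (rule window_weight[OF elim])+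
  qed
  ultimately show ?thesis by (rule Lim_transform_eventually)
qed

lemma chaos_proj_J:
  assumes "L2_tendsto M (\<lambda>e \<omega>. \<integral>z. local_functional u e (\<lambda>t. \<xi> z t \<omega>) \<partial>N) J (at_right 0)"
  shows "is_chaos_proj M \<GG> q J (\<lambda>\<omega>. \<Sum>p\<in>multi_index q. local_coef u p / multi_fact p * hermite_average p \<omega>)"
  using local_functional_L2 assms local_coef_limit by (rule limit_projection)

text \<open>An explicit jointly measurable version of the projections of the weight, proving that
  projection fields exist and serving as reference for every other version.\<close>

definition W_part :: "nat \<Rightarrow> 'z \<Rightarrow> 'w \<Rightarrow> real" where
  "W_part r z \<omega> = (\<Sum>p\<in>multi_index r. coef \<Psi> p / multi_fact p * multi_hermite p (\<lambda>t. \<xi> z t \<omega>))"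

lemma W_part_measurable[measurable]: "(\<lambda>(z, \<omega>). W_part r z \<omega>) \<in> borel_measurable (N \<Otimes>\<^sub>M M)"
  unfolding W_part_def
  using measurable_compose[OF \<xi>_vec_measurable multi_hermite_measurable] by (simp add: case_prod_unfold)

lemma W_part_field:
  "is_chaos_proj_field M N \<GG> r (\<lambda>z \<omega>. \<Psi> (\<lambda>t. \<xi> z t \<omega>)) (W_part r)"
  unfolding is_chaos_proj_field_def
proof (intro conjI ballI W_part_measurable)
  fix z assume z: "z \<in> space N"
  have part: "W_part r z = G.hermite_part (\<xi> z) \<Psi> r"
    by (auto simp: W_part_def hermite_part_coef[OF z \<Psi>_measurable])
  have L: "(\<lambda>\<omega>. \<Psi> (\<lambda>t. \<xi> z t \<omega>)) \<in> L2_space M"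
    by (rule L2_fieldD(2)[OF \<xi>_field[OF \<Psi>_L2] z])
  show "is_chaos_proj M \<GG> r (\<lambda>\<omega>. \<Psi> (\<lambda>t. \<xi> z t \<omega>)) (W_part r z)"
    unfolding is_chaos_proj_def part
    by (intro conjI ballI L \<xi>_gauss_sigma_measurable z \<Psi>_measurable G.hermite_part_in_chaos
      G.hermite_part_orthogonal \<xi>_std \<xi>_in_\<GG>)
qed

text \<open>Only multi-indices without degree in the \<open>None\<close> coordinates have nonzero
  coefficients. For these, multiplying by Hermite polynomials in exactly those coordinates produces
  a single multivariate Hermite polynomial.\<close>

lemma hermite_times_W_part:
  "(\<Prod>i\<in>UNIV. poly (hermite (j i)) (\<xi> z (i, None) \<omega>)) * W_part r z \<omega> =
    (\<Sum>p\<in>multi_index r. coef \<Psi> p / multi_fact p * multi_hermite (join_index j p) (\<lambda>t. \<xi> z t \<omega>))"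
  unfolding W_part_def sum_distrib_left
proof (intro sum.cong refl)
  fix p :: "'l \<times> 'k option \<Rightarrow> nat"
  let ?x = "\<lambda>t. \<xi> z t \<omega>"
  show "(\<Prod>i\<in>UNIV. poly (hermite (j i)) (\<xi> z (i, None) \<omega>)) * (coef \<Psi> p / multi_fact p * multi_hermite p ?x) =
     coef \<Psi> p / multi_fact p * multi_hermite (join_index j p) ?x"
  proof (cases "\<exists>i. p (i, None) \<noteq> 0")
    case True
    then show ?thesis using coef_\<Psi>_head by auto
  next
    case False
    then have "tail_index (join_index j p) = p"
    proof (intro ext)
      fix t
      show "tail_index (join_index j p) t = p t"
        using False by (cases t; cases "snd t") (auto simp: tail_index_def join_index_def)
    qed
    then have "multi_hermite (join_index j p) ?x = (\<Prod>i\<in>UNIV. poly (hermite (j i)) (\<xi> z (i, None) \<omega>)) * multi_hermite p ?x"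
      by (subst multi_hermite_split) (simp add: join_index_def)
    then show ?thesis by simp
  qed
qed

lemma finite_index_pairs: "finite {(j :: 'l \<Rightarrow> nat, r). (\<Sum>i\<in>UNIV. j i) + r = q}"
proof (rule finite_subset)
  show "{(j :: 'l \<Rightarrow> nat, r). (\<Sum>i\<in>UNIV. j i) + r = q} \<subseteq> (\<Union>n\<le>q. multi_index n) \<times> {..q}"
    by (auto simp: multi_index_def)
  show "finite ((\<Union>n\<le>q. multi_index n) \<times> {..q} :: (('l \<Rightarrow> nat) \<times> nat) set)" by auto
qed

text \<open>Splitting a multi-index into its head degrees j and its tail of degree r is a bijection
  once tails with head degrees, whose coefficients vanish, are discarded. Factorials and limit
  coefficients split accordingly. \<open>A\<close> is left free so that pathwise averages can be
  inserted.\<close>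

lemma index_pairs_sum:
  fixes A :: "('l \<times> 'k option \<Rightarrow> nat) \<Rightarrow> real"
  shows "(\<Sum>(j, r) \<in> {(j, r). (\<Sum>i\<in>UNIV. j i) + r = q}.
      (\<Prod>i\<in>UNIV. hermite_coeff (u i) (j i)) / (\<Prod>i\<in>UNIV. fact (j i)) *
      (\<Sum>p\<in>multi_index r. coef \<Psi> p / multi_fact p * A (join_index j p))) =
    (\<Sum>p\<in>multi_index q. local_coef u p / multi_fact p * A p)"
proof -
  define S where "S = {(j :: 'l \<Rightarrow> nat, r). (\<Sum>i\<in>UNIV. j i) + r = q}"
  define K where "K r = {p :: 'l \<times> 'k option \<Rightarrow> nat. p \<in> multi_index r \<and> tail_index p = p}" for r :: nat
  have finK: "finite (K r)" for r by (rule finite_subset[of _ "multi_index r"]) (auto simp: K_def)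
  have on_tails: "(\<Sum>p\<in>multi_index r. coef \<Psi> p / multi_fact p * A (join_index j p)) =
      (\<Sum>p\<in>K r. coef \<Psi> p / multi_fact p * A (join_index j p))" for j r
  proof (rule sum.mono_neutral_right)
    show "\<forall>p\<in>multi_index r - K r. coef \<Psi> p / multi_fact p * A (join_index j p) = 0"
    proof
      fix p :: "'l \<times> 'k option \<Rightarrow> nat" assume "p \<in> multi_index r - K r"
      then have "tail_index p \<noteq> p" by (auto simp: K_def)
      then obtain t where "tail_index p t \<noteq> p t" by (metis ext)
      then have "p (fst t, None) \<noteq> 0" by (cases t) (auto simp: tail_index_def split: if_splits)
      then show "coef \<Psi> p / multi_fact p * A (join_index j p) = 0" using coef_\<Psi>_head by simp
    qed
  qed (auto simp: K_def)
  have "(\<Sum>(j, r) \<in> S. (\<Prod>i\<in>UNIV. hermite_coeff (u i) (j i)) / (\<Prod>i\<in>UNIV. fact (j i)) *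
      (\<Sum>p\<in>multi_index r. coef \<Psi> p / multi_fact p * A (join_index j p))) =
    (\<Sum>s\<in>S. \<Sum>p\<in>K (snd s). (\<Prod>i\<in>UNIV. hermite_coeff (u i) (fst s i)) / (\<Prod>i\<in>UNIV. fact (fst s i)) *
      (coef \<Psi> p / multi_fact p * A (join_index (fst s) p)))"
    unfolding on_tails by (simp add: case_prod_unfold sum_distrib_left)
  also have "\<dots> = (\<Sum>(s, p)\<in>(SIGMA s:S. K (snd s)). (\<Prod>i\<in>UNIV. hermite_coeff (u i) (fst s i)) / (\<Prod>i\<in>UNIV. fact (fst s i)) *
      (coef \<Psi> p / multi_fact p * A (join_index (fst s) p)))"
    using finK finite_index_pairs[of q] by (subst sum.Sigma) (auto simp: S_def)
  also have "\<dots> = (\<Sum>p\<in>multi_index q. local_coef u p / multi_fact p * A p)"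
  \<comment> \<open>The degree r is recovered as the total degree in the \<open>Some\<close>
    coordinates, since a tail in \<open>K r\<close> has no other degree.\<close>
  proof (rule sum.reindex_bij_witness[where
      i="\<lambda>p. ((\<lambda>i. p (i, None), \<Sum>i\<in>UNIV. \<Sum>k\<in>UNIV. p (i, Some k)), tail_index p)" and
      j="\<lambda>(s, p). join_index (fst s) p"])
    fix a assume "a \<in> (SIGMA s:S. K (snd s))"
    then obtain j r p where a: "a = ((j, r), p)" "(\<Sum>i\<in>UNIV. j i) + r = q" "p \<in> multi_index r" "tail_index p = p"
      by (auto simp: S_def K_def)
    have p0: "p (i, None) = 0" for i using fun_cong[OF a(4), of "(i, None)"] by (simp add: tail_index_def)
    have r: "(\<Sum>i\<in>UNIV. \<Sum>k\<in>UNIV. p (i, Some k)) = r"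
      using a(3) unfolding multi_index_def sum_option_split by (simp add: p0)
    have tj: "tail_index (join_index j p) = p"
    proof (intro ext)
      fix t
      show "tail_index (join_index j p) t = p t"
        using p0 by (cases t; cases "snd t") (auto simp: tail_index_def join_index_def)
    qed
    show "(\<lambda>p. ((\<lambda>i. p (i, None), \<Sum>i\<in>UNIV. \<Sum>k\<in>UNIV. p (i, Some k)), tail_index p)) ((\<lambda>(s, p). join_index (fst s) p) a) = a"
      using r tj by (simp add: a(1)) (simp add: join_index_def)
    show "(\<lambda>(s, p). join_index (fst s) p) a \<in> multi_index q"
      using r a(2) unfolding multi_index_def sum_option_split by (simp add: a(1) join_index_def)
    show "local_coef u ((\<lambda>(s, p). join_index (fst s) p) a) / multi_fact ((\<lambda>(s, p). join_index (fst s) p) a) *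
        A ((\<lambda>(s, p). join_index (fst s) p) a) =
      (case a of (s, p) \<Rightarrow> (\<Prod>i\<in>UNIV. hermite_coeff (u i) (fst s i)) / (\<Prod>i\<in>UNIV. fact (fst s i)) *
        (coef \<Psi> p / multi_fact p * A (join_index (fst s) p)))"
      unfolding a(1) local_coef_def
      by (simp add: multi_fact_split[of "join_index j p"] tj) (simp add: join_index_def)
  next
    fix p :: "'l \<times> 'k option \<Rightarrow> nat" assume p: "p \<in> multi_index q"
    show "(\<lambda>(s, p). join_index (fst s) p) ((\<lambda>i. p (i, None), \<Sum>i\<in>UNIV. \<Sum>k\<in>UNIV. p (i, Some k)), tail_index p) = p"
      by (auto simp: join_index_def tail_index_def fun_eq_iff)
    show "((\<lambda>i. p (i, None), \<Sum>i\<in>UNIV. \<Sum>k\<in>UNIV. p (i, Some k)), tail_index p) \<in> (SIGMA s:S. K (snd s))"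
      using p unfolding S_def K_def multi_index_def sum_option_split
      by (auto simp: tail_index_def fun_eq_iff)
  qed
  finally show ?thesis by (simp add: S_def)
qed

text \<open>The projection is first known in multi-index form, with the explicit field
  \<open>W_part\<close>. Other versions differ from it for each z on a null set of outcomes
  depending on z, so exchanging the two almost-everywhere quantifiers is needed to compare pathwise
  integrals.\<close>

lemma chaos_proj_J_fields:
  assumes J: "L2_tendsto M (\<lambda>e \<omega>. \<integral>z. local_functional u e (\<lambda>t. \<xi> z t \<omega>) \<partial>N) J (at_right 0)"
    and V: "\<And>r. is_chaos_proj_field M N \<GG> r (\<lambda>z \<omega>. \<Psi> (\<lambda>t. \<xi> z t \<omega>)) (V r)"
  shows "AE \<omega> in M. integrable N (\<lambda>z. (\<Prod>i\<in>UNIV. poly (hermite (j i)) (\<xi> z (i, None) \<omega>)) * V r z \<omega>)"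
    and "is_chaos_proj M \<GG> q J
          (\<lambda>\<omega>. \<Sum>(j, r) \<in> {(j, r). (\<Sum>i\<in>UNIV. j i) + r = q}.
             (\<Prod>i\<in>UNIV. hermite_coeff (u i) (j i)) / (\<Prod>i\<in>UNIV. fact (j i)) *
             (\<integral>z. (\<Prod>i\<in>UNIV. poly (hermite (j i)) (\<xi> z (i, None) \<omega>)) * V r z \<omega> \<partial>N))"
proof -
  have Vm[measurable]: "(\<lambda>(z, \<omega>). V r z \<omega>) \<in> borel_measurable (N \<Otimes>\<^sub>M M)" for r
    using V by (simp add: is_chaos_proj_field_def)
  \<comment> \<open>Joint measurability of both fields makes their agreement set measurable in the
    product, which permits the exchange.\<close>
  have VW: "AE \<omega> in M. AE z in N. V r z \<omega> = W_part r z \<omega>" for r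
  proof (subst AE_commute[symmetric])
    have "Measurable.pred (N \<Otimes>\<^sub>M M) (\<lambda>x. (\<lambda>(z, \<omega>). V r z \<omega>) x = (\<lambda>(z, \<omega>). W_part r z \<omega>) x)"
      by measurable
    then show "{x \<in> space (N \<Otimes>\<^sub>M M). V r (fst x) (snd x) = W_part r (fst x) (snd x)} \<in> sets (N \<Otimes>\<^sub>M M)"
      by (simp add: pred_def case_prod_unfold)
    show "AE z in N. AE \<omega> in M. V r z \<omega> = W_part r z \<omega>"
    proof (rule AE_I2)
      fix z assume "z \<in> space N"
      then show "AE \<omega> in M. V r z \<omega> = W_part r z \<omega>"
        using V[of r] W_part_field[of r] unfolding is_chaos_proj_field_def
        by (intro G.chaos_proj_unique) auto
    qed
  qed
  have Hint: "AE \<omega> in M. integrable N (\<lambda>z. multi_hermite p (\<lambda>t. \<xi> z t \<omega>))" for p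
    by (rule L2_field_AE_integrable[OF \<xi>_field[OF multi_hermite_L2_std]])
  have Vm': "(\<lambda>z. V r z \<omega>) \<in> borel_measurable N" if "\<omega> \<in> space M" for r \<omega>
    using measurable_compose[OF measurable_Pair2'[OF that] Vm[of r]] by simp
  have \<xi>m': "(\<lambda>z. \<xi> z t \<omega>) \<in> borel_measurable N" if "\<omega> \<in> space M" for t \<omega>
    using measurable_compose[OF measurable_Pair2'[OF that] \<xi>_measurable[of t]] by simp
  have key: "AE \<omega> in M. integrable N (\<lambda>z. (\<Prod>i\<in>UNIV. poly (hermite (j i)) (\<xi> z (i, None) \<omega>)) * V r z \<omega>) \<and>
      (\<integral>z. (\<Prod>i\<in>UNIV. poly (hermite (j i)) (\<xi> z (i, None) \<omega>)) * V r z \<omega> \<partial>N) =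
      (\<Sum>p\<in>multi_index r. coef \<Psi> p / multi_fact p * hermite_average (join_index j p) \<omega>)" for j r
  proof -
    have "AE \<omega> in M. \<forall>p\<in>multi_index r. integrable N (\<lambda>z. multi_hermite (join_index j p) (\<lambda>t. \<xi> z t \<omega>))"
      using Hint by (intro AE_finite_allI) auto
    with VW[of r] AE_space show ?thesis
    proof eventually_elim
      case (elim \<omega>)
      let ?f = "\<lambda>z. (\<Prod>i\<in>UNIV. poly (hermite (j i)) (\<xi> z (i, None) \<omega>)) * V r z \<omega>"
      let ?g = "\<lambda>z. \<Sum>p\<in>multi_index r. coef \<Psi> p / multi_fact p * multi_hermite (join_index j p) (\<lambda>t. \<xi> z t \<omega>)"
      have gi: "integrable N ?g" using elim by auto
      have fm: "?f \<in> borel_measurable N"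
        using elim by (intro borel_measurable_times borel_measurable_prod Vm' measurable_compose[OF \<xi>m' borel_measurable_poly])
      have ae: "AE z in N. ?f z = ?g z"
        using elim(1) by eventually_elim (simp only: hermite_times_W_part[symmetric])
      have "integrable N ?f"
        using gi by (subst integrable_cong_AE[OF fm borel_measurable_integrable[OF gi] ae])
      moreover have "(\<integral>z. ?f z \<partial>N) = (\<integral>z. ?g z \<partial>N)"
        by (rule integral_cong_AE[OF fm borel_measurable_integrable[OF gi] ae])
      moreover have "(\<integral>z. ?g z \<partial>N) = (\<Sum>p\<in>multi_index r. coef \<Psi> p / multi_fact p * hermite_average (join_index j p) \<omega>)"
        using elim by (subst Bochner_Integration.integral_sum) (auto simp: hermite_average_def)
      ultimately show ?case by simp
    qed
  qed
  show "AE \<omega> in M. integrable N (\<lambda>z. (\<Prod>i\<in>UNIV. poly (hermite (j i)) (\<xi> z (i, None) \<omega>)) * V r z \<omega>)"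
    using key[of j r] by eventually_elim simp
  let ?S = "{(j :: 'l \<Rightarrow> nat, r). (\<Sum>i\<in>UNIV. j i) + r = q}"
  let ?R = "\<lambda>\<omega>. \<Sum>(j, r) \<in> ?S. (\<Prod>i\<in>UNIV. hermite_coeff (u i) (j i)) / (\<Prod>i\<in>UNIV. fact (j i)) *
             (\<integral>z. (\<Prod>i\<in>UNIV. poly (hermite (j i)) (\<xi> z (i, None) \<omega>)) * V r z \<omega> \<partial>N)"
  show "is_chaos_proj M \<GG> q J ?R"
  proof (rule G.chaos_proj_AE_cong[OF chaos_proj_J[OF J]])
    have m: "(\<lambda>\<omega>. \<integral>z. (\<Prod>i\<in>UNIV. poly (hermite (j i)) (\<xi> z (i, None) \<omega>)) * V r z \<omega> \<partial>N) \<in> borel_measurable M" for j r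
    proof (rule M1.borel_measurable_lebesgue_integral)
      have "(\<lambda>p. (\<Prod>i\<in>UNIV. poly (hermite (j i)) (\<xi> (fst p) (i, None) (snd p))) * V r (fst p) (snd p)) \<in> borel_measurable (N \<Otimes>\<^sub>M M)"
        using Vm[of r] by (intro borel_measurable_times borel_measurable_prod measurable_compose[OF \<xi>_measurable borel_measurable_poly])
          (simp add: case_prod_unfold)
      from measurable_compose[OF measurable_pair_swap' this]
      show "(\<lambda>(\<omega>, z). (\<Prod>i\<in>UNIV. poly (hermite (j i)) (\<xi> z (i, None) \<omega>)) * V r z \<omega>) \<in> borel_measurable (M \<Otimes>\<^sub>M N)"
        by (simp add: case_prod_unfold)
    qed
    show "?R \<in> borel_measurable M"
      unfolding case_prod_unfold by (intro borel_measurable_sum borel_measurable_times borel_measurable_const m)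
    have "AE \<omega> in M. \<forall>s\<in>?S. (\<integral>z. (\<Prod>i\<in>UNIV. poly (hermite (fst s i)) (\<xi> z (i, None) \<omega>)) * V (snd s) z \<omega> \<partial>N) =
      (\<Sum>p\<in>multi_index (snd s). coef \<Psi> p / multi_fact p * hermite_average (join_index (fst s) p) \<omega>)"
    proof (rule AE_finite_allI[OF finite_index_pairs])
      fix s
      show "AE \<omega> in M. (\<integral>z. (\<Prod>i\<in>UNIV. poly (hermite (fst s i)) (\<xi> z (i, None) \<omega>)) * V (snd s) z \<omega> \<partial>N) =
        (\<Sum>p\<in>multi_index (snd s). coef \<Psi> p / multi_fact p * hermite_average (join_index (fst s) p) \<omega>)"
        using key[of "fst s" "snd s"] by eventually_elim simp
    qed
    then show "AE \<omega> in M. (\<Sum>p\<in>multi_index q. local_coef u p / multi_fact p * hermite_average p \<omega>) = ?R \<omega>"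
    proof eventually_elim
      case (elim \<omega>)
      show ?case
        unfolding index_pairs_sum[where q=q and u=u and A="\<lambda>p. hermite_average p \<omega>", symmetric]
        using elim by (intro sum.cong refl) (auto simp: case_prod_unfold)
    qed
  qed
qed

end

section \<open>Symmetries of the standard Gaussian measure\<close>

lemma prob_space_std_normal: "prob_space std_normal_distribution"
  by (rule prob_space_normal_density) simp

lemma prob_space_std_gauss: "prob_space (std_gauss :: ('t \<Rightarrow> real) measure)"
  unfolding std_gauss_def by (rule prob_space_PiM) (rule prob_space_std_normal)

lemma distr_std_normal_scale:
  assumes "s \<noteq> 0"
  shows "distr std_normal_distribution borel (\<lambda>y. s * y) = density lborel (normal_density 0 \<bar>s\<bar>)"
proof -
  interpret prob_space std_normal_distribution by (rule prob_space_std_normal)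
  have "distributed std_normal_distribution lborel (\<lambda>y. y) std_normal_density"
    by (simp add: distributed_def distr_id2)
  from normal_density_affine[OF this _ assms, of 0]
  have "distr std_normal_distribution lborel (\<lambda>y. s * y) = density lborel (normal_density 0 \<bar>s\<bar>)"
    by (simp add: distributed_def)
  moreover have "distr std_normal_distribution borel (\<lambda>y. s * y) = distr std_normal_distribution lborel (\<lambda>y. s * y)"
    by (rule distr_cong) auto
  ultimately show ?thesis by simp
qed

lemma std_gauss_scale_measurable:
  "(\<lambda>x t. s t * x t) \<in> measurable std_gauss (Pi\<^sub>M UNIV (\<lambda>_. borel :: real measure))"
proof (rule measurable_PiM_single')
  fix t :: 'a
  have "(\<lambda>x. x t) \<in> borel_measurable (Pi\<^sub>M UNIV (\<lambda>_. borel :: real measure))"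
    by (rule measurable_component_singleton) simp
  then have "(\<lambda>x. s t * x t) \<in> borel_measurable (Pi\<^sub>M UNIV (\<lambda>_. borel :: real measure))" by simp
  then show "(\<lambda>x. s t * x t) \<in> borel_measurable std_gauss" by simp
qed (auto simp: space_PiM)

lemma distr_std_gauss_scale:
  fixes s :: "'t::finite \<Rightarrow> real"
  assumes s: "\<And>t. s t \<noteq> 0"
  shows "distr std_gauss (Pi\<^sub>M UNIV (\<lambda>_. borel)) (\<lambda>x t. s t * x t) =
    Pi\<^sub>M UNIV (\<lambda>t. density lborel (normal_density 0 \<bar>s t\<bar>))"
proof -
  let ?n = "\<lambda>t. density lborel (\<lambda>y. ennreal (normal_density 0 \<bar>s t\<bar> y))"
  interpret P: product_prob_space ?n
    by (rule product_prob_spaceI) (rule prob_space_normal_density, simp add: s)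
  interpret S: product_prob_space "\<lambda>_ :: 't. std_normal_distribution"
    by (rule product_prob_spaceI) (rule prob_space_std_normal)
  show ?thesis
  proof (rule P.PiM_eqI)
    show "sets (distr std_gauss (Pi\<^sub>M UNIV (\<lambda>_. borel)) (\<lambda>x t. s t * x t)) = sets (Pi\<^sub>M UNIV ?n)"
      by (simp cong: sets_PiM_cong)
    fix B :: "'t \<Rightarrow> real set" assume "\<And>t. t \<in> UNIV \<Longrightarrow> B t \<in> sets (?n t)"
    then have B: "B t \<in> sets borel" for t by simp
    have PB: "Pi\<^sub>E UNIV B \<in> sets (Pi\<^sub>M UNIV (\<lambda>_. borel))" using B by (intro sets_PiM_I_finite) auto
    have m1: "(\<lambda>y. s t * y) \<in> measurable std_normal_distribution borel" for t by simp
    have B': "(\<lambda>y. s t * y) -` B t \<in> sets std_normal_distribution" for t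
      using measurable_sets[OF m1 B] by simp
    have "(\<lambda>x t. s t * x t) -` Pi\<^sub>E UNIV B \<inter> space std_gauss = Pi\<^sub>E UNIV (\<lambda>t. (\<lambda>y. s t * y) -` B t)"
      by (auto simp: std_gauss_def space_PiM)
    then have "emeasure (distr std_gauss (Pi\<^sub>M UNIV (\<lambda>_. borel)) (\<lambda>x t. s t * x t)) (Pi\<^sub>E UNIV B) =
        emeasure std_gauss (Pi\<^sub>E UNIV (\<lambda>t. (\<lambda>y. s t * y) -` B t))"
      by (simp only: emeasure_distr[OF std_gauss_scale_measurable PB])
    also have "\<dots> = (\<Prod>t\<in>UNIV. emeasure std_normal_distribution ((\<lambda>y. s t * y) -` B t))"
      unfolding std_gauss_def using B' by (intro S.emeasure_PiM) auto
    also have "\<dots> = (\<Prod>t\<in>UNIV. emeasure (?n t) (B t))"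
      using emeasure_distr[OF m1 B] by (simp add: distr_std_normal_scale[OF s, symmetric])
    finally show "emeasure (distr std_gauss (Pi\<^sub>M UNIV (\<lambda>_. borel)) (\<lambda>x t. s t * x t)) (Pi\<^sub>E UNIV B) =
       (\<Prod>t\<in>UNIV. emeasure (?n t) (B t))" .
  qed simp
qed

lemma std_gauss_sign:
  fixes s :: "'t::finite \<Rightarrow> real" and F :: "('t \<Rightarrow> real) \<Rightarrow> real"
  assumes s: "\<And>t. \<bar>s t\<bar> = 1" and F: "F \<in> borel_measurable (Pi\<^sub>M UNIV (\<lambda>_. borel))"
  shows "(\<integral>x. F (\<lambda>t. s t * x t) \<partial>std_gauss) = (\<integral>x. F x \<partial>std_gauss)"
proof -
  have "s t \<noteq> 0" for t using s[of t] by auto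
  then have "distr std_gauss (Pi\<^sub>M UNIV (\<lambda>_. borel)) (\<lambda>x t. s t * x t) = std_gauss"
    using distr_std_gauss_scale[of s] by (simp add: s std_gauss_def)
  then have "(\<integral>x. F x \<partial>std_gauss) = (\<integral>x. F x \<partial>distr std_gauss (Pi\<^sub>M UNIV (\<lambda>_. borel)) (\<lambda>x t. s t * x t))"
    by simp
  also have "\<dots> = (\<integral>x. F (\<lambda>t. s t * x t) \<partial>std_gauss)"
    by (rule integral_distr[OF std_gauss_scale_measurable F])
  finally show ?thesis ..
qed

lemma std_gauss_permute:
  fixes F :: "('t::finite \<Rightarrow> real) \<Rightarrow> real"
  assumes \<sigma>: "bij \<sigma>" and F: "F \<in> borel_measurable (Pi\<^sub>M UNIV (\<lambda>_. borel))"
  shows "(\<integral>x. F (\<lambda>t. x (\<sigma> t)) \<partial>std_gauss) = (\<integral>x. F x \<partial>std_gauss)"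
proof -
  have d: "distr std_gauss std_gauss (\<lambda>x t. x (\<sigma> t)) = std_gauss"
    using distr_PiM_reindex[of UNIV "\<lambda>_. std_normal_distribution" \<sigma> UNIV] bij_is_inj[OF \<sigma>] prob_space_std_normal
    by (simp add: std_gauss_def restrict_def)
  have m: "(\<lambda>x t. x (\<sigma> t)) \<in> measurable std_gauss (std_gauss :: ('t \<Rightarrow> real) measure)"
    unfolding std_gauss_def
    by (rule measurable_PiM_single') (auto intro!: measurable_component_singleton simp: space_PiM)
  have F': "F \<in> borel_measurable std_gauss" using F by simp
  have "(\<integral>x. F x \<partial>std_gauss) = (\<integral>x. F x \<partial>distr std_gauss std_gauss (\<lambda>x t. x (\<sigma> t)))" by (simp only: d)
  also have "\<dots> = (\<integral>x. F (\<lambda>t. x (\<sigma> t)) \<partial>std_gauss)" by (rule integral_distr[OF m F'])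
  finally show ?thesis ..
qed

text \<open>\<sigma> is chosen with 1 / \<sigma>^2 = 1 + 2 h, so that the exponent changes by
  exactly - h y^2; the factor 1 / \<sigma> is the change of normalisation.\<close>

lemma normal_density_tilt:
  assumes h: "h \<ge> 0" and \<sigma>: "\<sigma> = (1 + 2 * h) powr (- 1 / 2)"
  shows "normal_density 0 \<sigma> y = std_normal_density y * (inverse \<sigma> * exp (- h * y\<^sup>2))"
proof -
  have pos: "1 + 2 * h > 0" using h by simp
  have \<sigma>0: "\<sigma> > 0" using pos by (simp add: \<sigma>)
  have sq: "\<sigma>\<^sup>2 = inverse (1 + 2 * h)"
  proof -
    have "\<sigma>\<^sup>2 = (1 + 2 * h) powr (- 1 / 2 + - 1 / 2)"
      unfolding \<sigma> power2_eq_square by (rule powr_add[symmetric])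
    also have "- 1 / 2 + - 1 / 2 = (- 1 :: real)" by simp
    finally show ?thesis using pos by (simp add: powr_minus)
  qed
  have "normal_density 0 \<sigma> y = 1 / sqrt (2 * pi * \<sigma>\<^sup>2) * exp (- y\<^sup>2 / (2 * \<sigma>\<^sup>2))"
    by (simp add: normal_density_def)
  also have "sqrt (2 * pi * \<sigma>\<^sup>2) = sqrt (2 * pi) * \<sigma>" using \<sigma>0 by (simp add: real_sqrt_mult)
  also have "exp (- y\<^sup>2 / (2 * \<sigma>\<^sup>2)) = exp (- y\<^sup>2 / 2) * exp (- h * y\<^sup>2)"
    unfolding sq exp_add[symmetric] by (simp add: field_simps)
  finally show ?thesis
    by (simp only: std_normal_density_def divide_inverse inverse_mult_distrib mult_ac)
qed

text \<open>Shrinking the coordinates in \<open>I\<close> by \<sigma> gives a product of centred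
  normals, each with the tilted density relative to the standard one. Coordinates outside
  \<open>I\<close> have relative density 1.\<close>

lemma std_gauss_tilt:
  fixes F :: "('t::finite \<Rightarrow> real) \<Rightarrow> real"
  assumes h: "h \<ge> 0" and \<sigma>: "\<sigma> = (1 + 2 * h) powr (- 1 / 2)"
    and F: "F \<in> borel_measurable (Pi\<^sub>M UNIV (\<lambda>_. borel))"
  shows "(\<integral>x. F (\<lambda>t. if t \<in> I then \<sigma> * x t else x t) \<partial>std_gauss) =
    (\<integral>x. (\<Prod>t\<in>I. inverse \<sigma> * exp (- h * (x t)\<^sup>2)) * F x \<partial>std_gauss)"
proof -
  have pos: "1 + 2 * h > 0" using h by simp
  have \<sigma>0: "\<sigma> > 0" using pos by (simp add: \<sigma>)
  define s where "s t = (if t \<in> I then \<sigma> else 1)" for t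
  define \<rho> where "\<rho> t y = (if t \<in> I then inverse \<sigma> * exp (- h * y\<^sup>2) else 1)" for t y
  have \<rho>0: "0 \<le> \<rho> t y" for t y using \<sigma>0 by (simp add: \<rho>_def)
  have \<rho>m[measurable]: "\<rho> t \<in> borel_measurable borel" for t unfolding \<rho>_def by measurable
  have s0: "s t \<noteq> 0" "\<bar>s t\<bar> = s t" for t using \<sigma>0 by (auto simp: s_def)
  let ?n = "\<lambda>t. density lborel (\<lambda>y. ennreal (normal_density 0 (s t) y))"
  have n: "?n t = density std_normal_distribution (\<lambda>y. ennreal (\<rho> t y))" for t
  proof -
    have "density std_normal_distribution (\<lambda>y. ennreal (\<rho> t y)) =
        density lborel (\<lambda>y. ennreal (std_normal_density y) * ennreal (\<rho> t y))"
      by (rule density_density_eq) auto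
    also have "\<dots> = ?n t"
      using normal_density_tilt[OF h \<sigma>]
      by (intro arg_cong2[where f=density] refl ext) (auto simp: s_def \<rho>_def ennreal_mult'[symmetric])
    finally show ?thesis ..
  qed
  interpret P: product_prob_space ?n
    by (rule product_prob_spaceI) (rule prob_space_normal_density, use s0 \<sigma>0 in \<open>auto simp: s_def\<close>)
  interpret S: product_prob_space "\<lambda>_ :: 't. std_normal_distribution"
    by (rule product_prob_spaceI) (rule prob_space_std_normal)
  have prodm: "(\<lambda>x. \<Prod>t\<in>UNIV. \<rho> t (x t)) \<in> borel_measurable (Pi\<^sub>M UNIV (\<lambda>_. borel))"
    by (intro borel_measurable_prod measurable_compose[OF _ \<rho>m] measurable_component_singleton) simp
  have dens: "density std_gauss (\<lambda>x. ennreal (\<Prod>t\<in>UNIV. \<rho> t (x t))) = Pi\<^sub>M UNIV ?n"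
  proof (rule P.PiM_eqI)
    show "sets (density std_gauss (\<lambda>x. ennreal (\<Prod>t\<in>UNIV. \<rho> t (x t)))) = sets (Pi\<^sub>M UNIV ?n)"
      by (simp add: sets_std_gauss cong: sets_PiM_cong)
    fix B :: "'t \<Rightarrow> real set" assume "\<And>t. t \<in> UNIV \<Longrightarrow> B t \<in> sets (?n t)"
    then have B: "B t \<in> sets borel" for t by simp
    have PB: "Pi\<^sub>E UNIV B \<in> sets std_gauss"
      unfolding sets_std_gauss using B by (intro sets_PiM_I_finite) auto
    have ind: "ennreal (\<Prod>t\<in>UNIV. \<rho> t (x t)) * indicator (Pi\<^sub>E UNIV B) x =
        (\<Prod>t\<in>UNIV. ennreal (\<rho> t (x t)) * indicator (B t) (x t))" for x
    proof (cases "\<forall>t. x t \<in> B t")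
      case True
      then have "x \<in> Pi\<^sub>E UNIV B" by auto
      then show ?thesis using True \<rho>0 by (simp add: prod_ennreal[symmetric])
    next
      case False
      then obtain t where t: "x t \<notin> B t" by auto
      then have "x \<notin> Pi\<^sub>E UNIV B" by auto
      moreover have "(\<Prod>t\<in>UNIV. ennreal (\<rho> t (x t)) * indicator (B t) (x t)) = 0"
        using t by (intro prod_zero bexI[of _ t]) auto
      ultimately show ?thesis by simp
    qed
    have "emeasure (density std_gauss (\<lambda>x. ennreal (\<Prod>t\<in>UNIV. \<rho> t (x t)))) (Pi\<^sub>E UNIV B) =
       (\<integral>\<^sup>+x. ennreal (\<Prod>t\<in>UNIV. \<rho> t (x t)) * indicator (Pi\<^sub>E UNIV B) x \<partial>std_gauss)"
      using prodm PB by (intro emeasure_density) auto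
    also have "\<dots> = (\<integral>\<^sup>+x. (\<Prod>t\<in>UNIV. ennreal (\<rho> t (x t)) * indicator (B t) (x t)) \<partial>std_gauss)"
      unfolding ind ..
    also have "\<dots> = (\<Prod>t\<in>UNIV. \<integral>\<^sup>+y. ennreal (\<rho> t y) * indicator (B t) y \<partial>std_normal_distribution)"
      unfolding std_gauss_def using B by (intro S.product_nn_integral_prod) auto
    also have "\<dots> = (\<Prod>t\<in>UNIV. emeasure (?n t) (B t))"
      unfolding n using B by (intro prod.cong refl emeasure_density[symmetric]) auto
    finally show "emeasure (density std_gauss (\<lambda>x. ennreal (\<Prod>t\<in>UNIV. \<rho> t (x t)))) (Pi\<^sub>E UNIV B) =
       (\<Prod>t\<in>UNIV. emeasure (?n t) (B t))" .
  qed simp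
  have "(\<integral>x. F (\<lambda>t. if t \<in> I then \<sigma> * x t else x t) \<partial>std_gauss) = (\<integral>x. F (\<lambda>t. s t * x t) \<partial>std_gauss)"
    by (intro Bochner_Integration.integral_cong refl arg_cong[where f=F]) (auto simp: s_def)
  also have "\<dots> = (\<integral>x. F x \<partial>distr std_gauss (Pi\<^sub>M UNIV (\<lambda>_. borel)) (\<lambda>x t. s t * x t))"
    by (rule integral_distr[OF std_gauss_scale_measurable F, symmetric])
  also have "\<dots> = (\<integral>x. F x \<partial>density std_gauss (\<lambda>x. ennreal (\<Prod>t\<in>UNIV. \<rho> t (x t))))"
    using distr_std_gauss_scale[of s, OF s0(1)] by (simp add: s0(2) dens)
  also have "\<dots> = (\<integral>x. (\<Prod>t\<in>UNIV. \<rho> t (x t)) *\<^sub>R F x \<partial>std_gauss)"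
    using F prodm \<rho>0 by (intro integral_density) (auto intro!: prod_nonneg)
  also have "(\<lambda>x. \<Prod>t\<in>UNIV. \<rho> t (x t)) = (\<lambda>x. \<Prod>t\<in>I. inverse \<sigma> * exp (- h * (x t)\<^sup>2))"
    unfolding \<rho>_def by (simp add: prod.If_cases)
  finally show ?thesis by simp
qed

section \<open>Sums over multi-indices of small degree\<close>

definition unit_index :: "'t \<Rightarrow> 't \<Rightarrow> nat" where
  "unit_index t v = (if v = t then 1 else 0)"

text \<open>Adding units one at a time reduces sums over multi-indices of degree 1 and 2 to ordinary
  sums over coordinates.\<close>

definition add_unit :: "('t \<Rightarrow> nat) \<Rightarrow> 't \<Rightarrow> 't \<Rightarrow> nat" where
  "add_unit p t v = p v + unit_index t v"

lemma multi_fact_add_unit: "multi_fact (add_unit p t) = real (Suc (p t)) * multi_fact p"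
proof -
  have "multi_fact (add_unit p t) = fact (Suc (p t)) * (\<Prod>v\<in>UNIV - {t}. fact (add_unit p t v))"
    unfolding multi_fact_def by (subst prod.remove[of UNIV t]) (auto simp: add_unit_def unit_index_def)
  also have "(\<Prod>v\<in>UNIV - {t}. fact (add_unit p t v)) = (\<Prod>v\<in>UNIV - {t}. fact (p v) :: real)"
    by (intro prod.cong) (auto simp: add_unit_def unit_index_def)
  also have "fact (Suc (p t)) * (\<Prod>v\<in>UNIV - {t}. fact (p v) :: real) = real (Suc (p t)) * multi_fact p"
  proof -
    have "multi_fact p = fact (p t) * (\<Prod>v\<in>UNIV - {t}. fact (p v) :: real)"
      unfolding multi_fact_def by (rule prod.remove) auto
    then show ?thesis by (simp only: fact_Suc mult.assoc)
  qed
  finally show ?thesis .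
qed

text \<open>Weighting by \<open>p t\<close> and summing over \<open>t\<close> counts each multi-index \<open>n + 1\<close> times.\<close>

lemma multi_index_sum_Suc:
  fixes g :: "('t::finite \<Rightarrow> nat) \<Rightarrow> real"
  shows "real (Suc n) * (\<Sum>p\<in>multi_index (Suc n). g p / multi_fact p) =
    (\<Sum>t\<in>UNIV. \<Sum>p\<in>multi_index n. g (add_unit p t) / multi_fact p)"
proof -
  have inner: "(\<Sum>p\<in>multi_index n. g (add_unit p t) / multi_fact p) =
      (\<Sum>p\<in>multi_index (Suc n). real (p t) * (g p / multi_fact p))" for t
  proof -
    have "(\<Sum>p\<in>multi_index n. g (add_unit p t) / multi_fact p) =
        (\<Sum>p\<in>{p \<in> multi_index (Suc n). p t > 0}. real (p t) * (g p / multi_fact p))"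
    \<comment> \<open>Truncated subtraction inverts \<open>add_unit\<close> only where
      \<open>p t\<close> is positive; the factor \<open>real (p t)\<close> later restores the
      remaining indices with value 0.\<close>
    proof (rule sum.reindex_bij_witness[where j="\<lambda>p. add_unit p t" and i="\<lambda>p v. p v - unit_index t v"])
      fix p :: "'t \<Rightarrow> nat" assume p: "p \<in> multi_index n"
      show "(\<lambda>v. add_unit p t v - unit_index t v) = p" by (auto simp: add_unit_def)
      show "add_unit p t \<in> {p \<in> multi_index (Suc n). p t > 0}"
        using p by (auto simp: multi_index_def add_unit_def sum.distrib unit_index_def)
      show "real (add_unit p t t) * (g (add_unit p t) / multi_fact (add_unit p t)) = g (add_unit p t) / multi_fact p"
        using multi_fact_nonzero[of p] by (simp add: multi_fact_add_unit del: of_nat_Suc) (simp add: add_unit_def unit_index_def)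
    next
      fix p :: "'t \<Rightarrow> nat" assume p: "p \<in> {p \<in> multi_index (Suc n). p t > 0}"
      then show *: "add_unit (\<lambda>v. p v - unit_index t v) t = p"
        by (auto simp: add_unit_def unit_index_def)
      have "(\<Sum>v\<in>UNIV. p v) = (\<Sum>v\<in>UNIV. add_unit (\<lambda>v. p v - unit_index t v) t v)" by (simp only: *)
      also have "\<dots> = Suc (\<Sum>v\<in>UNIV. p v - unit_index t v)"
        unfolding add_unit_def sum.distrib by (simp add: unit_index_def)
      finally show "(\<lambda>v. p v - unit_index t v) \<in> multi_index n" using p by (simp add: multi_index_def)
    qed
    also have "\<dots> = (\<Sum>p\<in>multi_index (Suc n). real (p t) * (g p / multi_fact p))"
      by (intro sum.mono_neutral_left) auto
    finally show ?thesis .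
  qed
  have "(\<Sum>t\<in>UNIV. \<Sum>p\<in>multi_index n. g (add_unit p t) / multi_fact p) =
      (\<Sum>p\<in>multi_index (Suc n). \<Sum>t\<in>UNIV. real (p t) * (g p / multi_fact p))"
    unfolding inner by (rule sum.swap)
  also have "\<dots> = (\<Sum>p\<in>multi_index (Suc n). real (Suc n) * (g p / multi_fact p))"
  proof (intro sum.cong refl)
    fix p :: "'t \<Rightarrow> nat" assume "p \<in> multi_index (Suc n)"
    then have "(\<Sum>t\<in>UNIV. p t) = Suc n" by (simp add: multi_index_def)
    then have "(\<Sum>t\<in>UNIV. real (p t)) = real (Suc n)" by (metis of_nat_sum)
    then show "(\<Sum>t\<in>UNIV. real (p t) * (g p / multi_fact p)) = real (Suc n) * (g p / multi_fact p)"
      by (simp only: sum_distrib_right[symmetric])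
  qed
  finally show ?thesis by (simp only: sum_distrib_left)
qed

lemma multi_index_0: "multi_index 0 = {\<lambda>_ :: 't::finite. 0}"
  by (auto simp: multi_index_def)

lemma multi_index_sum_0: "(\<Sum>p\<in>multi_index 0. g p / multi_fact p) = g (\<lambda>_ :: 't::finite. 0)"
  by (simp add: multi_index_0 multi_fact_def)

lemma multi_index_sum_1:
  fixes g :: "('t::finite \<Rightarrow> nat) \<Rightarrow> real"
  shows "(\<Sum>p\<in>multi_index 1. g p / multi_fact p) = (\<Sum>t\<in>UNIV. g (add_unit (\<lambda>_. 0) t))"
  using multi_index_sum_Suc[of 0 g] by (simp add: multi_index_sum_0)

text \<open>The sum runs over ordered pairs: a mixed index occurs twice with factorial 1, a diagonal
  one once with factorial 2, so 1 / 2 corrects both.\<close>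

lemma multi_index_sum_2:
  fixes g :: "('t::finite \<Rightarrow> nat) \<Rightarrow> real"
  shows "(\<Sum>p\<in>multi_index 2. g p / multi_fact p) =
    1 / 2 * (\<Sum>t\<in>UNIV. \<Sum>v\<in>UNIV. g (add_unit (add_unit (\<lambda>_. 0) v) t))"
proof -
  have "2 * (\<Sum>p\<in>multi_index 2. g p / multi_fact p) =
      (\<Sum>t\<in>UNIV. \<Sum>p\<in>multi_index 1. g (add_unit p t) / multi_fact p)"
    using multi_index_sum_Suc[of 1 g] by (simp add: numeral_2_eq_2)
  also have "\<dots> = (\<Sum>t\<in>UNIV. \<Sum>v\<in>UNIV. g (add_unit (add_unit (\<lambda>_. 0) v) t))"
    by (simp only: multi_index_sum_1[of "\<lambda>p. g (add_unit p _)"])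
  finally show ?thesis by simp
qed

lemma multi_hermite_0: "multi_hermite (\<lambda>_. 0) x = 1"
  by (simp add: multi_hermite_def)

lemma multi_hermite_1: "multi_hermite (add_unit (\<lambda>_. 0) t) x = x t"
proof -
  have "multi_hermite (add_unit (\<lambda>_. 0) t) x = (\<Prod>v\<in>UNIV. if v = t then x v else 1)"
    unfolding multi_hermite_def by (intro prod.cong) (auto simp: add_unit_def unit_index_def)
  then show ?thesis by simp
qed

lemma multi_hermite_2:
  "multi_hermite (add_unit (add_unit (\<lambda>_. 0) v) t) x = (if v = t then (x t)\<^sup>2 - 1 else x v * x t)"
proof (cases "v = t")
  case True
  have "multi_hermite (add_unit (add_unit (\<lambda>_. 0) v) t) x = (\<Prod>s\<in>UNIV. if s = t then (x s)\<^sup>2 - 1 else 1)"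
    unfolding multi_hermite_def True
    by (intro prod.cong) (auto simp: add_unit_def unit_index_def numeral_2_eq_2 power2_eq_square pderiv_pCons)
  then show ?thesis using True by simp
next
  case False
  have "multi_hermite (add_unit (add_unit (\<lambda>_. 0) v) t) x =
      (\<Prod>s\<in>UNIV. (if s = v then x s else 1) * (if s = t then x s else 1))"
    unfolding multi_hermite_def using False
    by (intro prod.cong) (auto simp: add_unit_def unit_index_def)
  then show ?thesis using False by (simp add: prod.distrib)
qed

text \<open>Sequential because it feeds dominated convergence, and with reversed sign so that the
  quotients of decreasing functions are nonnegative.\<close>

lemma difference_quotient_sequence:
  fixes f :: "real \<Rightarrow> real"
  assumes "(f has_real_derivative D) (at 0)"
  shows "(\<lambda>n. (f 0 - f (1 / real (Suc n))) / (1 / real (Suc n))) \<longlonglongrightarrow> - D"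
proof -
  have 1: "((\<lambda>h. (f (0 + h) - f 0) / h) \<longlongrightarrow> D) (at 0)"
    using assms by (simp add: DERIV_def)
  have "(\<lambda>n. 1 / real (Suc n)) \<longlonglongrightarrow> 0"
    using LIMSEQ_inverse_real_of_nat by (simp add: inverse_eq_divide)
  then have 2: "filterlim (\<lambda>n. 1 / real (Suc n)) (at 0) sequentially"
    by (intro filterlim_atI) auto
  have "(\<lambda>n. (f (0 + 1 / real (Suc n)) - f 0) / (1 / real (Suc n))) \<longlonglongrightarrow> D"
    by (rule filterlim_compose[OF 1 2])
  then have "(\<lambda>n. - ((f (0 + 1 / real (Suc n)) - f 0) / (1 / real (Suc n)))) \<longlonglongrightarrow> - D"
    by (rule tendsto_minus)
  moreover have eq: "- ((f (0 + h) - f 0) / h) = (f 0 - f h) / h" for h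
    by (simp add: minus_divide_left)
  ultimately show ?thesis by (simp only: eq)
qed

section \<open>Coefficients of a homogeneous matrix functional\<close>

definition mat_of :: "('l \<times> 'k option \<Rightarrow> real) \<Rightarrow> real ^ 'k ^ 'l" where
  "mat_of x = (\<chi> i j. x (i, Some j))"

lemma mat_of_measurable:
  "(mat_of :: ('l::finite \<times> 'k::finite option \<Rightarrow> real) \<Rightarrow> _) \<in> borel_measurable (Pi\<^sub>M UNIV (\<lambda>_. borel))"
proof (subst borel_measurable_euclidean_space, intro ballI)
  fix b :: "real ^ 'k ^ 'l" assume "b \<in> Basis"
  then obtain i j where b: "b = axis i (axis j 1)"
    by (auto simp: Basis_vec_def)
  have "(\<lambda>x. mat_of x \<bullet> b) = (\<lambda>x :: 'l \<times> 'k option \<Rightarrow> real. x (i, Some j))"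
    by (simp add: b mat_of_def inner_axis)
  then show "(\<lambda>x. mat_of x \<bullet> b) \<in> borel_measurable (Pi\<^sub>M (UNIV :: ('l \<times> 'k option) set) (\<lambda>_. borel))"
    by (simp add: measurable_component_singleton)
qed

locale gaussian_matrix_functional = gaussian_field N M X
  for N :: "'z measure" and M :: "'w measure" and X :: "'l::finite \<Rightarrow> 'k::finite option \<Rightarrow> 'z \<Rightarrow> 'w \<Rightarrow> real" +
  fixes \<Phi> :: "real ^ 'k ^ 'l \<Rightarrow> real"
  assumes \<Phi>_measurable: "\<Phi> \<in> borel_measurable borel"
    and \<Phi>_A: "assumption_A \<Phi>"
    and \<Phi>_square_integrable: "\<And>z. z \<in> space N \<Longrightarrow> integrable M (\<lambda>\<omega>. (\<Phi> (X_star X z \<omega>))\<^sup>2)"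
begin

lemma X_star_eq: "X_star X z \<omega> = mat_of (\<lambda>t. \<xi> z t \<omega>)"
  by (simp add: X_star_def mat_of_def \<xi>_def)

lemma \<Phi>_mat_measurable: "(\<lambda>x. \<Phi> (mat_of x)) \<in> borel_measurable (Pi\<^sub>M UNIV (\<lambda>_. borel))"
  by (rule measurable_compose[OF mat_of_measurable \<Phi>_measurable])

sublocale gaussian_functional N M X "\<lambda>x. \<Phi> (mat_of x)"
proof
  obtain z where z: "z \<in> space N" using space_N_nonempty by auto
  have "(\<lambda>x. (\<Phi> (mat_of x))\<^sup>2) \<in> borel_measurable (Pi\<^sub>M UNIV (\<lambda>_. borel))"
    using \<Phi>_mat_measurable by simp
  from \<xi>_integrable[OF z this] \<Phi>_square_integrable[OF z] \<Phi>_mat_measurable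
  show "(\<lambda>x. \<Phi> (mat_of x)) \<in> L2_space std_gauss"
    by (simp add: L2_space_def X_star_eq)
  show "\<Phi> (mat_of x) = \<Phi> (mat_of y)" if "\<And>i j. x (i, Some j) = y (i, Some j)" for x y
    using that by (simp add: mat_of_def)
qed

definition \<alpha> :: real where "\<alpha> = (\<integral>x. \<Phi> (mat_of x) \<partial>std_gauss)"

abbreviation \<phi> where "\<phi> \<equiv> coef (\<lambda>x. \<Phi> (mat_of x))"

lemma \<Phi>_permute:
  assumes "bij \<pi>" "bij \<tau>" shows "\<Phi> (\<chi> i j. A $ \<pi> i $ \<tau> j) = \<Phi> A"
  using \<Phi>_A assms unfolding assumption_A_def by blast

lemma \<Phi>_row_scale: "\<Phi> (\<chi> i j. if i = i0 then c * A $ i $ j else A $ i $ j) = \<bar>c\<bar> * \<Phi> A"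
  using \<Phi>_A unfolding assumption_A_def by blast

lemma \<Phi>_column_flip: "\<Phi> (\<chi> i j. if j = j0 then - A $ i $ j else A $ i $ j) = \<Phi> A"
  using \<Phi>_A unfolding assumption_A_def by blast

text \<open>Flipping the signs of the coordinates in \<open>S\<close> preserves the Gaussian law and
  \<Phi>, but by parity negates the Hermite product when the total degree in \<open>S\<close> is
  odd.\<close>

lemma coef_sign:
  fixes S :: "('l \<times> 'k option) set"
  assumes inv: "\<And>x. \<Phi> (mat_of (\<lambda>t. (if t \<in> S then -1 else 1) * x t)) = \<Phi> (mat_of x)"
    and odd: "odd (\<Sum>t\<in>S. p t)"
  shows "\<phi> p = 0"
proof -
  define s where "s t = (if t \<in> S then -1 else 1 :: real)" for t
  have H: "multi_hermite p (\<lambda>t. s t * x t) = - multi_hermite p x" for x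
  proof -
    have "multi_hermite p (\<lambda>t. s t * x t) = (\<Prod>t\<in>UNIV. (if t \<in> S then (-1) ^ p t else 1) * poly (hermite (p t)) (x t))"
      unfolding multi_hermite_def by (intro prod.cong) (auto simp: s_def hermite_uminus)
    also have "\<dots> = (\<Prod>t\<in>S. (-1) ^ p t) * multi_hermite p x"
      by (simp add: prod.distrib multi_hermite_def prod.If_cases)
    also have "(\<Prod>t\<in>S. (-1) ^ p t) = (-1 :: real)" using odd by (simp add: power_sum[symmetric])
    finally show ?thesis by simp
  qed
  have "\<phi> p = (\<integral>x. \<Phi> (mat_of (\<lambda>t. s t * x t)) * multi_hermite p (\<lambda>t. s t * x t) \<partial>std_gauss)"
    unfolding coef_def
    by (rule std_gauss_sign[symmetric, of s "\<lambda>x. \<Phi> (mat_of x) * multi_hermite p x"])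
      (auto simp: s_def intro!: borel_measurable_times \<Phi>_mat_measurable multi_hermite_measurable)
  also have "\<dots> = - \<phi> p" unfolding H coef_def using inv by (simp add: s_def)
  finally show ?thesis by simp
qed

lemma coef_column_odd:
  assumes "odd (\<Sum>i\<in>UNIV. p (i, Some j0))"
  shows "\<phi> p = 0"
proof (rule coef_sign[where S="range (\<lambda>i. (i, Some j0))"])
  fix x :: "'l \<times> 'k option \<Rightarrow> real"
  have "mat_of (\<lambda>t. (if t \<in> range (\<lambda>i. (i, Some j0)) then -1 else 1) * x t) =
      (\<chi> i j. if j = j0 then - mat_of x $ i $ j else mat_of x $ i $ j)"
    by (auto simp: mat_of_def vec_eq_iff)
  then show "\<Phi> (mat_of (\<lambda>t. (if t \<in> range (\<lambda>i. (i, Some j0)) then -1 else 1) * x t)) = \<Phi> (mat_of x)"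
    by (simp only: \<Phi>_column_flip)
  show "odd (\<Sum>t\<in>range (\<lambda>i. (i, Some j0)). p t)"
    using assms by (subst sum.reindex) (auto intro: injI)
qed

text \<open>Changing the sign of a row is row scaling by c = -1, whose factor |c| is 1.\<close>

lemma coef_row_odd:
  assumes "odd (\<Sum>j\<in>UNIV. p (i0, Some j))"
  shows "\<phi> p = 0"
proof (rule coef_sign[where S="range (\<lambda>j. (i0, Some j))"])
  fix x :: "'l \<times> 'k option \<Rightarrow> real"
  have "mat_of (\<lambda>t. (if t \<in> range (\<lambda>j. (i0, Some j)) then -1 else 1) * x t) =
      (\<chi> i j. if i = i0 then (-1) * mat_of x $ i $ j else mat_of x $ i $ j)"
    by (auto simp: mat_of_def vec_eq_iff)
  then have "\<Phi> (mat_of (\<lambda>t. (if t \<in> range (\<lambda>j. (i0, Some j)) then -1 else 1) * x t)) = \<bar>-1\<bar> * \<Phi> (mat_of x)"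
    by (simp only: \<Phi>_row_scale)
  then show "\<Phi> (mat_of (\<lambda>t. (if t \<in> range (\<lambda>j. (i0, Some j)) then -1 else 1) * x t)) = \<Phi> (mat_of x)"
    by simp
  show "odd (\<Sum>t\<in>range (\<lambda>j. (i0, Some j)). p t)"
    using assms by (subst sum.reindex) (auto intro: injI)
qed

lemma coef_permute:
  assumes \<pi>: "bij \<pi>" and \<tau>: "bij \<tau>"
  shows "\<phi> (\<lambda>(i, c). p (\<pi> i, map_option \<tau> c)) = \<phi> p"
proof -
  define \<sigma> where "\<sigma> = (\<lambda>(i :: 'l, c :: 'k option). (\<pi> i, map_option \<tau> c))"
  have \<sigma>: "bij \<sigma>"
  proof (rule o_bij[of "\<lambda>(i, c). (inv \<pi> i, map_option (inv \<tau>) c)"])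
    show "(\<lambda>(i, c). (inv \<pi> i, map_option (inv \<tau>) c)) \<circ> \<sigma> = id"
      using \<pi> \<tau> by (auto simp: \<sigma>_def fun_eq_iff bij_is_inj option.map_comp o_def option.map_ident inv_f_f)
    show "\<sigma> \<circ> (\<lambda>(i, c). (inv \<pi> i, map_option (inv \<tau>) c)) = id"
      using \<pi> \<tau> by (auto simp: \<sigma>_def fun_eq_iff option.map_comp o_def option.map_ident bij_is_surj surj_f_inv_f)
  qed
  have "mat_of (\<lambda>t. x (\<sigma> t)) = (\<chi> i j. mat_of x $ \<pi> i $ \<tau> j)" for x :: "'l \<times> 'k option \<Rightarrow> real"
    by (simp add: mat_of_def \<sigma>_def)
  then have inv: "\<Phi> (mat_of (\<lambda>t. x (\<sigma> t))) = \<Phi> (mat_of x)" for x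
    using \<Phi>_permute[OF \<pi> \<tau>] by simp
  have H: "multi_hermite (\<lambda>t. p (\<sigma> t)) (\<lambda>t. x (\<sigma> t)) = multi_hermite p x" for x
    unfolding multi_hermite_def using \<sigma> by (intro prod.reindex_bij_betw)
  have "\<phi> (\<lambda>t. p (\<sigma> t)) = (\<integral>x. \<Phi> (mat_of (\<lambda>t. x (\<sigma> t))) * multi_hermite (\<lambda>t. p (\<sigma> t)) (\<lambda>t. x (\<sigma> t)) \<partial>std_gauss)"
    unfolding coef_def
    by (rule std_gauss_permute[OF \<sigma>, symmetric, of "\<lambda>x. \<Phi> (mat_of x) * multi_hermite (\<lambda>t. p (\<sigma> t)) x"])
      (intro borel_measurable_times \<Phi>_mat_measurable multi_hermite_measurable)
  then show ?thesis unfolding inv H coef_def by (simp add: \<sigma>_def case_prod_unfold)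
qed

text \<open>Rescaling row \<open>i\<close> by \<open>\<sigma> = (1 + 2 h) powr (- 1 / 2)\<close> multiplies \<open>\<Phi>\<close> by \<open>\<sigma>\<close>, but can also be read as a
  Gaussian tilt of the law: \<open>\<integral> \<Phi> exp (- h R) = \<sigma> ^ (k + 1) \<alpha>\<close> with \<open>R\<close> the squared norm of the row.
  Differentiate at \<open>h = 0\<close>.\<close>

lemma row_second_moment:
  "(\<integral>x. \<Phi> (mat_of x) * (\<Sum>j\<in>UNIV. (x (i, Some j))\<^sup>2) \<partial>std_gauss) = (real CARD('k) + 1) * \<alpha>"
proof -
  define R where "R x = (\<Sum>j\<in>UNIV. (x (i, Some j))\<^sup>2)" for x :: "'l \<times> 'k option \<Rightarrow> real"
  have R0: "0 \<le> R x" for x by (simp add: R_def sum_nonneg)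
  interpret S: prob_space "std_gauss :: ('l \<times> 'k option \<Rightarrow> real) measure" by (rule prob_space_std_gauss)
  have \<Phi>L: "(\<lambda>x. \<Phi> (mat_of x)) \<in> L2_space std_gauss" by (rule \<Psi>_L2)
  have \<Phi>int: "integrable std_gauss (\<lambda>x. \<Phi> (mat_of x))" by (rule S.L2_integrable[OF \<Phi>L])
  have RL: "R \<in> L2_space std_gauss"
  proof -
    \<comment> \<open>Each square is H_2 + 1, so square integrability of \<open>R\<close> comes from
      that of Hermite products. The factors 1 fit the shape of \<open>L2_sum\<close> and
      \<open>L2_lincomb\<close>.\<close>
    have "(\<lambda>x. \<Sum>j\<in>UNIV. 1 * (1 * multi_hermite (add_unit (add_unit (\<lambda>_. 0) (i, Some j)) (i, Some j)) x + 1 * 1))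
        \<in> L2_space (std_gauss :: ('l \<times> 'k option \<Rightarrow> real) measure)"
      by (intro L2_sum L2_lincomb multi_hermite_L2_std S.L2_const) simp
    then show ?thesis by (simp add: multi_hermite_2 R_def[abs_def])
  qed
  have Rm: "R \<in> borel_measurable (Pi\<^sub>M UNIV (\<lambda>_. borel))" using L2_spaceD(1)[OF RL] by simp
  have \<Phi>R: "integrable std_gauss (\<lambda>x. \<Phi> (mat_of x) * R x)" by (rule L2_mult_integrable[OF \<Phi>L RL])
  define k where "k = CARD('k)"
  \<comment> \<open>Homogeneity of the row contributes one factor \<sigma> and the k tilted
    densities contribute k more; \<sigma> is itself the power -1/2 of 1 + 2 h.\<close>
  define n where "n = (real k + 1) / 2"
  have tilt: "(\<integral>x. \<Phi> (mat_of x) * exp (- h * R x) \<partial>std_gauss) = (1 + 2 * h) powr (- n) * \<alpha>" if h: "h \<ge> 0" for h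
  proof -
    define \<sigma> where "\<sigma> = (1 + 2 * h) powr (- 1 / 2)"
    have \<sigma>0: "\<sigma> > 0" using h by (simp add: \<sigma>_def)
    define I where "I = range (\<lambda>j :: 'k. (i, Some j))"
    have inj: "inj (\<lambda>j :: 'k. (i, Some j))" by (auto intro: injI)
    have scale: "\<Phi> (mat_of (\<lambda>t. if t \<in> I then \<sigma> * x t else x t)) = \<sigma> * \<Phi> (mat_of x)" for x
    proof -
      have "mat_of (\<lambda>t. if t \<in> I then \<sigma> * x t else x t) =
          (\<chi> i' j. if i' = i then \<sigma> * mat_of x $ i' $ j else mat_of x $ i' $ j)"
        by (auto simp: mat_of_def vec_eq_iff I_def)
      then show ?thesis using \<sigma>0 by (simp only: \<Phi>_row_scale abs_of_pos)
    qed
    have prod: "(\<Prod>t\<in>I. inverse \<sigma> * exp (- h * (x t)\<^sup>2)) = inverse \<sigma> ^ k * exp (- h * R x)" for x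
      unfolding I_def prod.reindex[OF inj] k_def R_def
      by (simp add: prod.distrib exp_sum[symmetric] sum_distrib_left sum_negf)
    have "\<sigma> * \<alpha> = (\<integral>x. \<Phi> (mat_of (\<lambda>t. if t \<in> I then \<sigma> * x t else x t)) \<partial>std_gauss)"
      unfolding scale \<alpha>_def by simp
    also have "\<dots> = (\<integral>x. (\<Prod>t\<in>I. inverse \<sigma> * exp (- h * (x t)\<^sup>2)) * \<Phi> (mat_of x) \<partial>std_gauss)"
      by (rule std_gauss_tilt[OF h \<sigma>_def \<Phi>_mat_measurable])
    also have "\<dots> = (\<integral>x. inverse \<sigma> ^ k * (\<Phi> (mat_of x) * exp (- h * R x)) \<partial>std_gauss)"
      unfolding prod by (simp add: mult_ac)
    also have "\<dots> = inverse \<sigma> ^ k * (\<integral>x. \<Phi> (mat_of x) * exp (- h * R x) \<partial>std_gauss)" by simp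
    finally have "(\<integral>x. \<Phi> (mat_of x) * exp (- h * R x) \<partial>std_gauss) = \<sigma> ^ Suc k * \<alpha>"
      using \<sigma>0 by (simp add: field_simps)
    moreover have "\<sigma> ^ Suc k = (1 + 2 * h) powr (- n)"
      unfolding \<sigma>_def n_def using h by (subst powr_power) (auto simp: field_simps)
    ultimately show ?thesis by simp
  qed
  define h where "h m = 1 / real (Suc m)" for m
  have hpos: "h m > 0" for m by (simp add: h_def)
  have lim1: "(\<lambda>m. \<integral>x. \<Phi> (mat_of x) * ((1 - exp (- h m * R x)) / h m) \<partial>std_gauss) \<longlonglongrightarrow>
      (\<integral>x. \<Phi> (mat_of x) * R x \<partial>std_gauss)"
  proof (rule integral_dominated_convergence[where w="\<lambda>x. \<bar>\<Phi> (mat_of x) * R x\<bar>"])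
    show "(\<lambda>x. \<Phi> (mat_of x) * R x) \<in> borel_measurable std_gauss"
      by (rule borel_measurable_integrable[OF \<Phi>R])
    show "(\<lambda>x. \<Phi> (mat_of x) * ((1 - exp (- h m * R x)) / h m)) \<in> borel_measurable std_gauss" for m
      using Rm \<Phi>_mat_measurable by simp
    show "integrable std_gauss (\<lambda>x. \<bar>\<Phi> (mat_of x) * R x\<bar>)" using \<Phi>R by (rule integrable_abs)
    show "AE x in std_gauss. (\<lambda>m. \<Phi> (mat_of x) * ((1 - exp (- h m * R x)) / h m)) \<longlonglongrightarrow> \<Phi> (mat_of x) * R x"
    proof (rule AE_I2)
      fix x :: "'l \<times> 'k option \<Rightarrow> real"
      have "((\<lambda>h. exp (- h * R x)) has_real_derivative - R x) (at 0)"
        by (auto intro!: derivative_eq_intros)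
      from difference_quotient_sequence[OF this]
      have "(\<lambda>m. (1 - exp (- h m * R x)) / h m) \<longlonglongrightarrow> R x" by (simp add: h_def)
      then show "(\<lambda>m. \<Phi> (mat_of x) * ((1 - exp (- h m * R x)) / h m)) \<longlonglongrightarrow> \<Phi> (mat_of x) * R x"
        by (rule tendsto_mult_left)
    qed
    show "AE x in std_gauss. norm (\<Phi> (mat_of x) * ((1 - exp (- h m * R x)) / h m)) \<le> \<bar>\<Phi> (mat_of x) * R x\<bar>" for m
    proof (rule AE_I2)
      fix x :: "'l \<times> 'k option \<Rightarrow> real"
      \<comment> \<open>The quotient lies between 0 and \<open>R x\<close> by 1 - exp(-y) <= y,
        which makes the absolute value of \<Phi> times \<open>R\<close> a dominating
        function.\<close>
      have "0 \<le> (1 - exp (- h m * R x)) / h m" using hpos[of m] R0[of x] by simp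
      moreover have "(1 - exp (- h m * R x)) / h m \<le> R x"
        using exp_ge_add_one_self[of "- h m * R x"] hpos[of m] by (simp add: divide_le_eq mult.commute)
      ultimately have "\<bar>(1 - exp (- h m * R x)) / h m\<bar> \<le> \<bar>R x\<bar>" by simp
      then show "norm (\<Phi> (mat_of x) * ((1 - exp (- h m * R x)) / h m)) \<le> \<bar>\<Phi> (mat_of x) * R x\<bar>"
        unfolding real_norm_def abs_mult by (intro mult_left_mono) auto
    qed
  qed
  have val: "(\<integral>x. \<Phi> (mat_of x) * ((1 - exp (- h m * R x)) / h m) \<partial>std_gauss) =
     ((1 - (1 + 2 * h m) powr (- n)) / h m) * \<alpha>" for m
  proof -
    have i: "integrable std_gauss (\<lambda>x. \<Phi> (mat_of x) * exp (- h m * R x))"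
    proof (rule Bochner_Integration.integrable_bound[OF \<Phi>int])
      show "(\<lambda>x. \<Phi> (mat_of x) * exp (- h m * R x)) \<in> borel_measurable std_gauss"
        using Rm \<Phi>_mat_measurable by simp
      show "AE x in std_gauss. norm (\<Phi> (mat_of x) * exp (- h m * R x)) \<le> norm (\<Phi> (mat_of x))"
        using hpos[of m] R0 by (auto simp: abs_mult intro!: AE_I2 mult_left_le)
    qed
    have "(\<integral>x. \<Phi> (mat_of x) * ((1 - exp (- h m * R x)) / h m) \<partial>std_gauss) =
        (\<integral>x. (\<Phi> (mat_of x) - \<Phi> (mat_of x) * exp (- h m * R x)) / h m \<partial>std_gauss)"
      by (simp add: right_diff_distrib)
    also have "\<dots> = (\<alpha> - (1 + 2 * h m) powr (- n) * \<alpha>) / h m"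
      using i \<Phi>int tilt[of "h m"] hpos[of m] by (simp add: \<alpha>_def)
    finally show ?thesis by (simp add: left_diff_distrib diff_divide_distrib)
  qed
  have "((\<lambda>h. (1 + 2 * h) powr (- n)) has_real_derivative - (2 * n)) (at 0)"
    by (auto intro!: derivative_eq_intros)
  from difference_quotient_sequence[OF this]
  have "(\<lambda>m. (1 - (1 + 2 * h m) powr (- n)) / h m) \<longlonglongrightarrow> 2 * n" by (simp add: h_def)
  then have "(\<lambda>m. ((1 - (1 + 2 * h m) powr (- n)) / h m) * \<alpha>) \<longlonglongrightarrow> 2 * n * \<alpha>" by (rule tendsto_mult_right)
  then have "(\<integral>x. \<Phi> (mat_of x) * R x \<partial>std_gauss) = 2 * n * \<alpha>"
    using lim1 LIMSEQ_unique unfolding val by blast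
  moreover have "2 * n = real CARD('k) + 1" by (simp add: n_def k_def)
  ultimately show ?thesis by (simp only: R_def)
qed

lemma coef_0: "\<phi> (\<lambda>_. 0) = \<alpha>"
  by (simp add: coef_def multi_hermite_0 \<alpha>_def)

lemma coef_1: "\<phi> (add_unit (\<lambda>_. 0) (i, Some j)) = 0"
  by (rule coef_column_odd[of _ j]) (simp add: add_unit_def unit_index_def)

text \<open>Column permutations make the coefficient independent of j. The sum over j is the mean of
  \<Phi> times the squared row norm minus k \<alpha>, that is (k + 1) \<alpha> - k \<alpha>.\<close>

lemma coef_2_diag: "\<phi> (add_unit (add_unit (\<lambda>_. 0) (i, Some j)) (i, Some j)) = \<alpha> / real CARD('k)"
proof -
  define e where "e j = add_unit (add_unit (\<lambda>_. 0) (i, Some j)) (i, Some j :: 'k option)" for j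
  have same: "\<phi> (e j') = \<phi> (e j)" for j'
  proof -
    define \<tau> where "\<tau> = Transposition.transpose j j'"
    have \<tau>: "bij \<tau>" by (simp add: \<tau>_def)
    have pointwise: "(case t of (i, c) \<Rightarrow> e j (id i, map_option \<tau> c)) = e j' t" for t
      by (cases t; cases "snd t")
        (auto simp: e_def add_unit_def unit_index_def \<tau>_def Transposition.transpose_def)
    have "(\<lambda>(i, c). e j (id i, map_option \<tau> c)) = e j'" by (rule ext) (rule pointwise)
    then show ?thesis using coef_permute[OF bij_id \<tau>, of "e j"] by simp
  qed
  interpret S: prob_space "std_gauss :: ('l \<times> 'k option \<Rightarrow> real) measure" by (rule prob_space_std_gauss)
  have \<Phi>int: "integrable std_gauss (\<lambda>x. \<Phi> (mat_of x))" by (rule S.L2_integrable[OF \<Psi>_L2])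
  have ei: "integrable std_gauss (\<lambda>x. \<Phi> (mat_of x) * multi_hermite (e j) x)" for j
    by (rule L2_mult_integrable[OF \<Psi>_L2 multi_hermite_L2_std])
  have "real CARD('k) * \<phi> (e j) = (\<Sum>j\<in>UNIV. \<phi> (e j))"
  proof -
    have "(\<Sum>j'\<in>UNIV. \<phi> (e j')) = (\<Sum>j'\<in>(UNIV :: 'k set). \<phi> (e j))" by (intro sum.cong refl same)
    then show ?thesis by simp
  qed
  also have "\<dots> = (\<integral>x. (\<Sum>j\<in>UNIV. \<Phi> (mat_of x) * multi_hermite (e j) x) \<partial>std_gauss)"
    unfolding coef_def using ei by (subst Bochner_Integration.integral_sum) auto
  also have "\<dots> = (\<integral>x. \<Phi> (mat_of x) * (\<Sum>j\<in>UNIV. (x (i, Some j))\<^sup>2) - real CARD('k) * \<Phi> (mat_of x) \<partial>std_gauss)"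
    by (simp add: e_def multi_hermite_2 right_diff_distrib sum_subtractf sum_distrib_left)
  also have "\<dots> = (\<integral>x. \<Phi> (mat_of x) * (\<Sum>j\<in>UNIV. (x (i, Some j))\<^sup>2) \<partial>std_gauss) - real CARD('k) * \<alpha>"
  proof -
    have "integrable std_gauss (\<lambda>x. (\<Sum>j\<in>UNIV. \<Phi> (mat_of x) * multi_hermite (e j) x) + real CARD('k) * \<Phi> (mat_of x))"
      using ei \<Phi>int by simp
    then have "integrable std_gauss (\<lambda>x. \<Phi> (mat_of x) * (\<Sum>j\<in>UNIV. (x (i, Some j))\<^sup>2))"
      by (simp add: e_def multi_hermite_2 right_diff_distrib sum_subtractf sum_distrib_left)
    then show ?thesis using \<Phi>int by (simp add: \<alpha>_def)
  qed
  also have "\<dots> = \<alpha>" unfolding row_second_moment by (simp add: algebra_simps)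
  finally show ?thesis by (simp add: e_def field_simps)
qed

text \<open>Distinct positions differ in row or column. In the same column, row i has degree one and
  a row flip applies; in different columns, column j has degree one and a column flip
  applies.\<close>

lemma coef_2_off:
  assumes "(i, j) \<noteq> (i', j')"
  shows "\<phi> (add_unit (add_unit (\<lambda>_. 0) (i, Some j)) (i', Some j')) = 0"
proof (cases "j = j'")
  case True
  then have "i \<noteq> i'" using assms by simp
  then show ?thesis
    by (intro coef_row_odd[of _ i]) (simp add: add_unit_def unit_index_def sum.distrib)
next
  case False
  then show ?thesis
    by (intro coef_column_odd[of _ j]) (simp add: add_unit_def unit_index_def sum.distrib)
qed

end

section \<open>The projections of low and odd degree\<close>

context gaussian_matrix_functional
begin

lemma local_coef_eq:
  "local_coef u p = multi_hermite (\<lambda>i. p (i, None)) u * (\<Prod>i\<in>UNIV. std_normal_density (u i)) * \<phi> (tail_index p)"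
  by (simp add: local_coef_def hermite_coeff_def multi_hermite_def prod.distrib)

lemma head_add_unit:
  "(\<lambda>i. add_unit p (i', None) (i, None)) = add_unit (\<lambda>i. p (i, None)) i'"
  "(\<lambda>i. add_unit p (i', Some j) (i, None)) = (\<lambda>i. p (i, None))"
  by (auto simp: add_unit_def unit_index_def)

lemma tail_add_unit:
  "tail_index (add_unit p (i, None)) = tail_index p"
  "tail_index (add_unit p (i, Some j)) = add_unit (tail_index p) (i, Some j)"
  "tail_index (\<lambda>_. 0) = (\<lambda>_. 0)"
  by (auto simp: add_unit_def unit_index_def tail_index_def fun_eq_iff)

lemma average_measurable:
  fixes F :: "_ \<Rightarrow> real"
  assumes F: "F \<in> borel_measurable (Pi\<^sub>M UNIV (\<lambda>_. borel))"
  shows "(\<lambda>\<omega>. \<integral>z. F (\<lambda>t. \<xi> z t \<omega>) \<partial>N) \<in> borel_measurable M"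
proof -
  from measurable_compose[OF measurable_pair_swap' measurable_compose[OF \<xi>_vec_measurable F]]
  have "(\<lambda>(\<omega>, z). F (\<lambda>t. \<xi> z t \<omega>)) \<in> borel_measurable (M \<Otimes>\<^sub>M N)"
    by (simp add: case_prod_unfold)
  from M1.borel_measurable_lebesgue_integral[OF this] show ?thesis .
qed

lemma square_AE_integrable: "AE \<omega> in M. integrable N (\<lambda>z. (\<xi> z t \<omega>)\<^sup>2)"
  using L2_field_AE_integrable[OF \<xi>_field[OF multi_hermite_L2_std[of "add_unit (add_unit (\<lambda>_. 0) t) t"]]]
proof eventually_elim
  case (elim \<omega>)
  then have "integrable N (\<lambda>z. ((\<xi> z t \<omega>)\<^sup>2 - 1) + 1)"
    by (intro Bochner_Integration.integrable_add) (simp_all add: multi_hermite_2)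
  then show ?case by simp
qed

context
  fixes u :: "'l \<Rightarrow> real" and J :: "'w \<Rightarrow> real"
  assumes J: "L2_tendsto M (J_approx N (\<lambda>i z \<omega>. X i None z \<omega>) (\<lambda>z \<omega>. \<Phi> (X_star X z \<omega>)) u) J (at_right 0)"
begin

abbreviation \<Gamma> :: real where "\<Gamma> \<equiv> \<Prod>i\<in>UNIV. std_normal_density (u i)"

lemma J_local: "L2_tendsto M (\<lambda>e \<omega>. \<integral>z. local_functional u e (\<lambda>t. \<xi> z t \<omega>) \<partial>N) J (at_right 0)"
proof -
  have "J_approx N (\<lambda>i z \<omega>. X i None z \<omega>) (\<lambda>z \<omega>. \<Phi> (X_star X z \<omega>)) u =
      (\<lambda>e \<omega>. \<integral>z. local_functional u e (\<lambda>t. \<xi> z t \<omega>) \<partial>N)"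
    by (intro ext) (simp add: J_approx_def local_functional_def X_star_eq \<xi>_def)
  then show ?thesis using J by simp
qed

lemma proj_0: "is_chaos_proj M \<GG> 0 J (\<lambda>_. \<alpha> * \<Gamma>)"
proof -
  have "(\<Sum>p\<in>multi_index 0. local_coef u p / multi_fact p * hermite_average p \<omega>) = \<alpha> * \<Gamma>" for \<omega>
    using multi_index_sum_0[of "\<lambda>p. local_coef u p * hermite_average p \<omega>"]
    by (simp add: local_coef_eq tail_add_unit multi_hermite_0 coef_0 hermite_average_def M1.prob_space)
  then show ?thesis using chaos_proj_J[OF J_local, of 0] by simp
qed

text \<open>The constant 1 is the Hermite product of degree 0 and so belongs to the chaos of degree
  0; testing the projection against it gives the mean.\<close>

lemma mean_J: "(\<integral>\<omega>. J \<omega> \<partial>M) = \<alpha> * \<Gamma>"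
proof -
  obtain z where z: "z \<in> space N" using space_N_nonempty by auto
  have "(\<lambda>\<omega>. multi_hermite (\<lambda>_. 0) (\<lambda>t. \<xi> z t \<omega>)) \<in> wiener_chaos M \<GG> 0"
    by (rule G.multi_hermite_in_chaos[OF \<xi>_std[OF z] \<xi>_in_\<GG>[OF z]]) (simp add: multi_index_0)
  then have "(\<lambda>_. 1) \<in> wiener_chaos M \<GG> 0" by (simp add: multi_hermite_0)
  then have "(\<integral>\<omega>. J \<omega> - \<alpha> * \<Gamma> \<partial>M) = 0"
    using proj_0 by (auto simp: is_chaos_proj_def)
  moreover have "integrable M J"
    using J by (intro M2.L2_integrable) (simp add: L2_tendsto_def)
  ultimately show ?thesis by (simp add: M2.prob_space)
qed

text \<open>Degree one in a matrix entry is killed by a column flip, so only H_1(u_i) = u_i with the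
  localised coordinate of row i contributes.\<close>

lemma proj_1: "is_chaos_proj M \<GG> 1 J (\<lambda>\<omega>. \<alpha> * \<Gamma> * (\<Sum>i\<in>UNIV. m_field N X i \<omega> * u i))"
proof -
  have "(\<Sum>p\<in>multi_index 1. local_coef u p / multi_fact p * hermite_average p \<omega>) =
      \<alpha> * \<Gamma> * (\<Sum>i\<in>UNIV. m_field N X i \<omega> * u i)" for \<omega>
  proof -
    have "(\<Sum>p\<in>multi_index 1. local_coef u p / multi_fact p * hermite_average p \<omega>) =
        (\<Sum>t\<in>UNIV. local_coef u (add_unit (\<lambda>_. 0) t) * hermite_average (add_unit (\<lambda>_. 0) t) \<omega>)"
      using multi_index_sum_1[of "\<lambda>p. local_coef u p * hermite_average p \<omega>"] by simp
    also have "\<dots> = (\<Sum>i\<in>UNIV. u i * \<Gamma> * \<alpha> * m_field N X i \<omega>)"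
      unfolding sum_option_split local_coef_eq head_add_unit tail_add_unit hermite_average_def multi_hermite_1
      by (simp add: coef_0 coef_1 m_field_def \<xi>_def)
    finally show ?thesis by (simp add: sum_distrib_left mult_ac)
  qed
  then show ?thesis using chaos_proj_J[OF J_local, of 1] by simp
qed

text \<open>Three kinds of index survive: degree two in one localised coordinate, degree two in one
  matrix entry, and degree one in the localised coordinates of two distinct rows. The last kind
  gives the double sum of products; no symmetry of \<Phi> removes it, as no matrix entry is
  involved. It is empty for a single row and zero if at most one \<open>u i\<close> is
  nonzero.\<close>

lemma proj_2: "is_chaos_proj M \<GG> 2 J
  (\<lambda>\<omega>. \<alpha> / 2 * \<Gamma> *
    ((\<Sum>i\<in>UNIV. (u i)\<^sup>2 * (\<integral>z. ((X i None z \<omega>)\<^sup>2 - 1) \<partial>N) + D_field N X i \<omega>) +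
     (\<Sum>i1\<in>UNIV. \<Sum>i2\<in>UNIV - {i1}. u i1 * u i2 * (\<integral>z. X i1 None z \<omega> * X i2 None z \<omega> \<partial>N))))"
proof (rule G.chaos_proj_AE_cong[OF chaos_proj_J[OF J_local]])
  have comp: "(\<lambda>x. x t) \<in> borel_measurable (Pi\<^sub>M UNIV (\<lambda>_. borel :: real measure))" for t :: "'l \<times> 'k option"
    by (rule measurable_component_singleton) simp
  have m1: "(\<lambda>\<omega>. \<integral>z. ((X i c z \<omega>)\<^sup>2 - 1) \<partial>N) \<in> borel_measurable M" for i c
    using average_measurable[of "\<lambda>x. (x (i, c))\<^sup>2 - 1"] comp[of "(i, c)"] by (simp add: \<xi>_def)
  have m2: "(\<lambda>\<omega>. \<integral>z. (X i c z \<omega>)\<^sup>2 \<partial>N) \<in> borel_measurable M" for i c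
    using average_measurable[of "\<lambda>x. (x (i, c))\<^sup>2"] comp[of "(i, c)"] by (simp add: \<xi>_def)
  have m3: "(\<lambda>\<omega>. \<integral>z. X i c z \<omega> * X i' c' z \<omega> \<partial>N) \<in> borel_measurable M" for i c i' c'
    using average_measurable[of "\<lambda>x. x (i, c) * x (i', c')"] comp[of "(i, c)"] comp[of "(i', c')"]
    by (simp add: \<xi>_def)
  show "(\<lambda>\<omega>. \<alpha> / 2 * \<Gamma> *
    ((\<Sum>i\<in>UNIV. (u i)\<^sup>2 * (\<integral>z. ((X i None z \<omega>)\<^sup>2 - 1) \<partial>N) + D_field N X i \<omega>) +
     (\<Sum>i1\<in>UNIV. \<Sum>i2\<in>UNIV - {i1}. u i1 * u i2 * (\<integral>z. X i1 None z \<omega> * X i2 None z \<omega> \<partial>N))))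
     \<in> borel_measurable M"
    unfolding D_field_def
    by (intro borel_measurable_times borel_measurable_add borel_measurable_diff borel_measurable_sum
      borel_measurable_const m1 m2 m3)
  \<comment> \<open>Splitting the integral of the square minus 1 requires integrability, as a
    nonintegrable function has integral 0 by convention; hence the identity holds only almost
    surely.\<close>
  have "AE \<omega> in M. \<forall>t\<in>UNIV. integrable N (\<lambda>z. (\<xi> z t \<omega>)\<^sup>2)"
    by (intro AE_finite_allI square_AE_integrable) simp
  then show "AE \<omega> in M. (\<Sum>p\<in>multi_index 2. local_coef u p / multi_fact p * hermite_average p \<omega>) =
    \<alpha> / 2 * \<Gamma> *
    ((\<Sum>i\<in>UNIV. (u i)\<^sup>2 * (\<integral>z. ((X i None z \<omega>)\<^sup>2 - 1) \<partial>N) + D_field N X i \<omega>) +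
     (\<Sum>i1\<in>UNIV. \<Sum>i2\<in>UNIV - {i1}. u i1 * u i2 * (\<integral>z. X i1 None z \<omega> * X i2 None z \<omega> \<partial>N)))"
  proof eventually_elim
    case (elim \<omega>)
    define a where "a t = (\<integral>z. (\<xi> z t \<omega>)\<^sup>2 \<partial>N)" for t
    have a: "(\<integral>z. (\<xi> z t \<omega>)\<^sup>2 - 1 \<partial>N) = a t - 1" for t
    proof -
      have "integrable N (\<lambda>z. (\<xi> z t \<omega>)\<^sup>2)" using elim by (rule bspec) simp
      then show ?thesis by (simp add: a_def M1.prob_space)
    qed
    define b where "b i i' = (\<integral>z. \<xi> z (i, None) \<omega> * \<xi> z (i', None) \<omega> \<partial>N)" for i i'
    define k where "k = real CARD('k)"
    have k0: "k > 0" by (simp add: k_def)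
    define g where "g v t = local_coef u (add_unit (add_unit (\<lambda>_. 0) v) t) *
      hermite_average (add_unit (add_unit (\<lambda>_. 0) v) t) \<omega>" for v t
    have av: "hermite_average (add_unit (add_unit (\<lambda>_. 0) t) t) \<omega> = a t - 1" for t
      by (simp add: hermite_average_def multi_hermite_2 a)
    have gNN: "g (i', None) (i, None) = \<Gamma> * \<alpha> * (if i' = i then ((u i)\<^sup>2 - 1) * (a (i, None) - 1) else u i * u i' * b i i')" for i i'
      by (simp add: g_def local_coef_eq head_add_unit tail_add_unit coef_0 av multi_hermite_2)
        (simp add: hermite_average_def multi_hermite_2 b_def mult_ac)
    have gNS: "g (i', None) (i, Some j) = 0" for i i' j
      by (simp add: g_def local_coef_eq head_add_unit tail_add_unit coef_1)
    have gSN: "g (i', Some j) (i, None) = 0" for i i' j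
      by (simp add: g_def local_coef_eq head_add_unit tail_add_unit coef_1)
    have gSS: "g (i', Some j') (i, Some j) = (if i' = i \<and> j' = j then \<Gamma> * \<alpha> * ((a (i, Some j) - 1) / k) else 0)" for i i' j j'
      by (auto simp: g_def local_coef_eq head_add_unit tail_add_unit coef_2_off coef_2_diag av multi_hermite_0 k_def)
    have D: "D_field N X i \<omega> = (\<Sum>j\<in>UNIV. a (i, Some j)) / k - a (i, None)" for i
      by (simp add: D_field_def a_def \<xi>_def k_def)
    have sum1: "(\<Sum>j\<in>UNIV. (a (i, Some j) - 1) / k) = (\<Sum>j\<in>UNIV. a (i, Some j)) / k - 1" for i
      using k0 by (simp add: sum_divide_distrib[symmetric] sum_subtractf diff_divide_distrib) (simp add: k_def)
    have rem: "(\<Sum>i'\<in>UNIV. if i' = i then p else f i') = p + (\<Sum>i'\<in>UNIV - {i}. f i')"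
      for i :: 'l and p :: real and f :: "'l \<Rightarrow> real"
      by (subst sum.remove[of UNIV i]) (auto intro!: sum.cong)
    have "(\<Sum>p\<in>multi_index 2. local_coef u p / multi_fact p * hermite_average p \<omega>) =
        1 / 2 * (\<Sum>t\<in>UNIV. \<Sum>v\<in>UNIV. g v t)"
      using multi_index_sum_2[of "\<lambda>p. local_coef u p * hermite_average p \<omega>"] by (simp add: g_def)
    also have "(\<Sum>t\<in>UNIV. \<Sum>v\<in>UNIV. g v t) = (\<Sum>i\<in>UNIV. \<Sum>i'\<in>UNIV. g (i', None) (i, None)) +
        (\<Sum>i\<in>UNIV. \<Sum>j\<in>UNIV. \<Sum>i'\<in>UNIV. \<Sum>j'\<in>UNIV. g (i', Some j') (i, Some j))"
      by (simp add: sum_option_split gNS gSN)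
    also have "(\<Sum>i\<in>UNIV. \<Sum>i'\<in>UNIV. g (i', None) (i, None)) =
        \<Gamma> * \<alpha> * (\<Sum>i\<in>UNIV. ((u i)\<^sup>2 - 1) * (a (i, None) - 1) + (\<Sum>i'\<in>UNIV - {i}. u i * u i' * b i i'))"
      unfolding gNN sum_distrib_left[symmetric] by (simp only: rem)
    also have "(\<Sum>i\<in>UNIV. \<Sum>j\<in>UNIV. \<Sum>i'\<in>UNIV. \<Sum>j'\<in>UNIV. g (i', Some j') (i, Some j)) =
        \<Gamma> * \<alpha> * (\<Sum>i\<in>UNIV. (\<Sum>j\<in>UNIV. a (i, Some j)) / k - 1)"
    proof -
      have "(\<Sum>i'\<in>UNIV. \<Sum>j'\<in>UNIV. g (i', Some j') (i, Some j)) = \<Gamma> * \<alpha> * ((a (i, Some j) - 1) / k)" for i j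
      proof -
        have "(\<Sum>j'\<in>UNIV. g (i', Some j') (i, Some j)) = (if i' = i then \<Gamma> * \<alpha> * ((a (i, Some j) - 1) / k) else 0)" for i'
          by (cases "i' = i") (simp_all add: gSS)
        then show ?thesis by simp
      qed
      then show ?thesis by (simp only: sum_distrib_left[symmetric] sum1)
    qed
    also have "1 / 2 * (\<Gamma> * \<alpha> * (\<Sum>i\<in>UNIV. ((u i)\<^sup>2 - 1) * (a (i, None) - 1) + (\<Sum>i'\<in>UNIV - {i}. u i * u i' * b i i')) +
        \<Gamma> * \<alpha> * (\<Sum>i\<in>UNIV. (\<Sum>j\<in>UNIV. a (i, Some j)) / k - 1)) =
      \<alpha> / 2 * \<Gamma> * ((\<Sum>i\<in>UNIV. (u i)\<^sup>2 * (a (i, None) - 1) + D_field N X i \<omega>) +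
        (\<Sum>i\<in>UNIV. \<Sum>i'\<in>UNIV - {i}. u i * u i' * b i i'))"
    proof -
      \<comment> \<open>The -1 in H_2(u) = u^2 - 1 contributes 1 - \<open>a (i, None)\<close>. The
        constant cancels against the -1 of the matrix entries, and the rest completes
        \<open>D_field\<close>.\<close>
      have "(\<Sum>i\<in>UNIV. ((u i)\<^sup>2 - 1) * (a (i, None) - 1)) + (\<Sum>i\<in>UNIV. (\<Sum>j\<in>UNIV. a (i, Some j)) / k - 1) =
          (\<Sum>i\<in>UNIV. (u i)\<^sup>2 * (a (i, None) - 1) + D_field N X i \<omega>)"
        unfolding sum.distrib[symmetric] D by (intro sum.cong refl) (simp add: algebra_simps)
      note total = this[symmetric]
      have "1 / 2 * (x * y * (A + C) + x * y * B) = y / 2 * x * ((A + B) + C)" for x y A B C :: real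
        by (simp add: algebra_simps)
      then show ?thesis
        unfolding total
        by (simp only: sum.distrib[of "\<lambda>i. ((u i)\<^sup>2 - 1) * (a (i, None) - 1)"])
    qed
    finally show ?case by (simp add: a[symmetric] b_def \<xi>_def)
  qed
qed

end

text \<open>Either some localised coordinate has odd degree, and odd Hermite polynomials vanish at
  0; or all those degrees are even, so the matrix entries have odd total degree, some column has odd
  degree, and a column flip kills the coefficient.\<close>

lemma local_coef_odd:
  assumes "odd q" "p \<in> multi_index q"
  shows "local_coef (\<lambda>_. 0) p = 0"
proof (cases "\<exists>i. odd (p (i, None))")
  case True
  then obtain i where "odd (p (i, None))" by auto
  then have "multi_hermite (\<lambda>i. p (i, None)) (\<lambda>_. 0) = 0"
    unfolding multi_hermite_def using hermite_odd_zero by (intro prod_zero bexI[of _ i]) auto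
  then show ?thesis by (simp add: local_coef_eq)
next
  case False
  have "(\<Sum>i\<in>UNIV. p (i, None)) + (\<Sum>j\<in>UNIV. \<Sum>i\<in>UNIV. p (i, Some j)) = q"
  proof -
    have "(\<Sum>j\<in>UNIV. \<Sum>i\<in>UNIV. p (i, Some j)) = (\<Sum>i\<in>UNIV. \<Sum>j\<in>UNIV. p (i, Some j))"
      by (rule sum.swap)
    then show ?thesis using assms(2) by (simp add: multi_index_def sum_option_split)
  qed
  moreover have "even (\<Sum>i\<in>UNIV. p (i, None))" using False by (intro dvd_sum) auto
  ultimately have "odd (\<Sum>j\<in>UNIV. \<Sum>i\<in>UNIV. p (i, Some j))" using assms(1) by auto
  then obtain j where "odd (\<Sum>i\<in>UNIV. p (i, Some j))" by (meson dvd_sum)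
  then have "\<phi> (tail_index p) = 0" by (intro coef_column_odd[of _ j]) (simp add: tail_index_def)
  then show ?thesis by (simp add: local_coef_eq)
qed

lemma proj_odd:
  assumes "L2_tendsto M (J_approx N (\<lambda>i z \<omega>. X i None z \<omega>) (\<lambda>z \<omega>. \<Phi> (X_star X z \<omega>)) (\<lambda>_. 0)) J (at_right 0)"
    and q: "odd q"
  shows "is_chaos_proj M \<GG> q J (\<lambda>_. 0)"
  using chaos_proj_J[OF J_local[OF assms(1)], of q] local_coef_odd[OF q] by simp

end

lemma std_normal_density_0_power: "std_normal_density 0 ^ n = 1 / (2 * pi) powr (real n / 2)"
proof -
  have "(2 * pi) powr (real n / 2) = ((2 * pi) powr (1 / 2)) powr real n" by (simp add: powr_powr)
  also have "\<dots> = sqrt (2 * pi) ^ n" by (simp add: powr_half_sqrt powr_realpow)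
  finally show ?thesis by (simp add: std_normal_density_def power_one_over)
qed

text \<open>The chaos formula is asserted for every family \<open>V\<close> of jointly measurable
  versions of the projected weights; the first conjunct supplies such versions, so the
  quantification is not vacuous. The point \<open>z0\<close> serves only to name \<alpha>, since the
  law of the matrix does not depend on z. In degree 2 the products over two distinct rows come from
  r = 0 and j equal to 1 in two rows.\<close>

theorem theorem2p3:
  fixes M :: "'w measure" and N :: "'z measure"
    and X :: "'l::finite \<Rightarrow> 'k::finite option \<Rightarrow> 'z \<Rightarrow> 'w \<Rightarrow> real"
    and \<Phi> :: "real ^ 'k ^ 'l \<Rightarrow> real"
    and u :: "'l \<Rightarrow> real" and J :: "'w \<Rightarrow> real"
    and \<alpha> :: real and z0 :: 'z
    and G :: "'l \<Rightarrow> 'z \<Rightarrow> 'w \<Rightarrow> real" and W :: "'z \<Rightarrow> 'w \<Rightarrow> real" and \<GG> :: "('w \<Rightarrow> real) set"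
  defines "G \<equiv> \<lambda>i z \<omega>. X i None z \<omega>"
    and "W \<equiv> \<lambda>z \<omega>. \<Phi> (X_star X z \<omega>)"
    and "\<GG> \<equiv> gauss_space M N X"
    and "\<alpha> \<equiv> (\<integral>\<omega>. \<Phi> (X_star X z0 \<omega>) \<partial>M)"
  assumes prob_M: "prob_space M" and prob_N: "prob_space N"
    and dims: "CARD('l) \<le> CARD('k)"
    and joint_measurable:
      "\<And>i c. (\<lambda>(z, \<omega>). X i c z \<omega>) \<in> borel_measurable (N \<Otimes>\<^sub>M M)"
    and gaussian: "\<And>i. gaussian_family M (UNIV \<times> space N) (\<lambda>(c, z). X i c z)"
    and standard: "\<And>i z. z \<in> space N \<Longrightarrow> std_gaussian_vector M UNIV (\<lambda>c. X i c z)"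
    and independent:
      "prob_space.indep_vars M (\<lambda>_. PiM (UNIV \<times> space N) (\<lambda>_. borel))
         (\<lambda>i \<omega>. \<lambda>(c, z)\<in>UNIV \<times> space N. X i c z \<omega>) UNIV"
    and \<Phi>_measurable: "\<Phi> \<in> borel_measurable borel"
    and \<Phi>_A: "assumption_A \<Phi>"
    and \<Phi>_square_integrable: "\<And>z. z \<in> space N \<Longrightarrow> integrable M (\<lambda>\<omega>. (\<Phi> (X_star X z \<omega>))\<^sup>2)"
    and z0: "z0 \<in> space N"
    and J: "L2_tendsto M (J_approx N G W u) J (at_right 0)"
  shows
    "\<comment> \<open>(i)\<close>
     (\<forall>r. \<exists>V. is_chaos_proj_field M N \<GG> r W V) \<and>
     (\<forall>q V. (\<forall>r. is_chaos_proj_field M N \<GG> r W (V r)) \<longrightarrow>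
        (\<forall>j r. (\<Sum>i\<in>UNIV. j i) + r = q \<longrightarrow>
           (AE \<omega> in M. integrable N (\<lambda>z. (\<Prod>i\<in>UNIV. poly (hermite (j i)) (G i z \<omega>)) * V r z \<omega>))) \<and>
        is_chaos_proj M \<GG> q J
          (\<lambda>\<omega>. \<Sum>(j, r) \<in> {(j, r). (\<Sum>i\<in>UNIV. j i) + r = q}.
             (\<Prod>i\<in>UNIV. hermite_coeff (u i) (j i)) / (\<Prod>i\<in>UNIV. fact (j i)) *
             (\<integral>z. (\<Prod>i\<in>UNIV. poly (hermite (j i)) (G i z \<omega>)) * V r z \<omega> \<partial>N))) \<and>
     is_chaos_proj M \<GG> 0 J (\<lambda>_. \<alpha> * (\<Prod>i\<in>UNIV. std_normal_density (u i))) \<and>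
     (\<integral>\<omega>. J \<omega> \<partial>M) = \<alpha> * (\<Prod>i\<in>UNIV. std_normal_density (u i)) \<and>
     is_chaos_proj M \<GG> 1 J
       (\<lambda>\<omega>. \<alpha> * (\<Prod>i\<in>UNIV. std_normal_density (u i)) * (\<Sum>i\<in>UNIV. m_field N X i \<omega> * u i)) \<and>
     is_chaos_proj M \<GG> 2 J
       (\<lambda>\<omega>. \<alpha> / 2 * (\<Prod>i\<in>UNIV. std_normal_density (u i)) *
          ((\<Sum>i\<in>UNIV. (u i)\<^sup>2 * (\<integral>z. ((X i None z \<omega>)\<^sup>2 - 1) \<partial>N) + D_field N X i \<omega>) +
           (\<Sum>i1\<in>UNIV. \<Sum>i2\<in>UNIV - {i1}.
              u i1 * u i2 * (\<integral>z. X i1 None z \<omega> * X i2 None z \<omega> \<partial>N)))) \<and>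
     \<comment> \<open>(ii)\<close>
     ((\<forall>i. u i = 0) \<and> (\<forall>i. AE \<omega> in M. D_field N X i \<omega> = 0) \<longrightarrow>
        is_chaos_proj M \<GG> 0 J (\<lambda>_. \<alpha> / (2 * pi) powr (real CARD('l) / 2)) \<and>
        (\<integral>\<omega>. J \<omega> \<partial>M) = \<alpha> / (2 * pi) powr (real CARD('l) / 2) \<and>
        (\<forall>q. is_chaos_proj M \<GG> (2 * q + 1) J (\<lambda>_. 0)) \<and>
        is_chaos_proj M \<GG> 2 J (\<lambda>_. 0))"
proof -
  interpret M: prob_space M by (rule prob_M)
  interpret N: prob_space N by (rule prob_N)
  interpret P: pair_prob_space N M ..
  interpret L: gaussian_matrix_functional N M X \<Phi>
    by unfold_locales
      (fact joint_measurable gaussian standard independent \<Phi>_measurable \<Phi>_A \<Phi>_square_integrable)+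
  have GG: "\<GG> = L.\<GG>" by (simp add: \<GG>_def L.\<GG>_def)
  have W: "W = (\<lambda>z \<omega>. \<Phi> (mat_of (\<lambda>t. L.\<xi> z t \<omega>)))" by (simp add: W_def L.X_star_eq)
  have G: "G i z \<omega> = L.\<xi> z (i, None) \<omega>" for i z \<omega> by (simp add: G_def L.\<xi>_def)
  have \<alpha>: "\<alpha> = L.\<alpha>"
    unfolding \<alpha>_def L.\<alpha>_def L.X_star_eq by (rule L.\<xi>_integral[OF z0 L.\<Phi>_mat_measurable])
  have J': "L2_tendsto M (J_approx N (\<lambda>i z \<omega>. X i None z \<omega>) (\<lambda>z \<omega>. \<Phi> (X_star X z \<omega>)) u) J (at_right 0)"
    using J by (simp add: G_def W_def)
  have field: "\<exists>V. is_chaos_proj_field M N \<GG> r W V" for r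
    unfolding GG W using L.W_part_field by blast
  have formula: "(AE \<omega> in M. integrable N (\<lambda>z. (\<Prod>i\<in>UNIV. poly (hermite (j i)) (G i z \<omega>)) * V r z \<omega>))"
    "is_chaos_proj M \<GG> q J
          (\<lambda>\<omega>. \<Sum>(j, r) \<in> {(j, r). (\<Sum>i\<in>UNIV. j i) + r = q}.
             (\<Prod>i\<in>UNIV. hermite_coeff (u i) (j i)) / (\<Prod>i\<in>UNIV. fact (j i)) *
             (\<integral>z. (\<Prod>i\<in>UNIV. poly (hermite (j i)) (G i z \<omega>)) * V r z \<omega> \<partial>N))"
    if V: "\<And>r. is_chaos_proj_field M N \<GG> r W (V r)" for V q j r
    using L.chaos_proj_J_fields[OF L.J_local[OF J'] V[unfolded GG W]] unfolding GG G by auto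
  note p0 = L.proj_0[OF J'] and mean = L.mean_J[OF J'] and p1 = L.proj_1[OF J'] and p2 = L.proj_2[OF J']
  have zero_case: "is_chaos_proj M \<GG> 0 J (\<lambda>_. \<alpha> / (2 * pi) powr (real CARD('l) / 2)) \<and>
        (\<integral>\<omega>. J \<omega> \<partial>M) = \<alpha> / (2 * pi) powr (real CARD('l) / 2) \<and>
        (\<forall>q. is_chaos_proj M \<GG> (2 * q + 1) J (\<lambda>_. 0)) \<and>
        is_chaos_proj M \<GG> 2 J (\<lambda>_. 0)"
    if "\<forall>i. u i = 0" "\<forall>i. AE \<omega> in M. D_field N X i \<omega> = 0"
  proof -
    have u: "u = (\<lambda>_. 0)" using that(1) by auto
    have \<Gamma>: "\<alpha> * (\<Prod>i\<in>UNIV. std_normal_density (u i)) = \<alpha> / (2 * pi) powr (real CARD('l) / 2)"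
      by (simp add: u std_normal_density_0_power)
    have odd: "is_chaos_proj M \<GG> (2 * q + 1) J (\<lambda>_. 0)" for q
      unfolding GG using J' unfolding u by (rule L.proj_odd) simp
    have D: "AE \<omega> in M. \<forall>i\<in>UNIV. D_field N X i \<omega> = 0"
      using that(2) by (intro AE_finite_allI) auto
    \<comment> \<open>At u = 0 the squares and the mixed products all carry a factor
      \<open>u i\<close>, and \<open>D_field\<close> vanishes almost surely for all rows at
      once.\<close>
    have two: "is_chaos_proj M \<GG> 2 J (\<lambda>_. 0)"
      unfolding GG by (rule L.G.chaos_proj_AE_cong[OF p2], simp) (rule eventually_mono[OF D], simp add: u)
    show ?thesis
      using p0 mean odd two unfolding \<alpha>[symmetric] GG[symmetric] \<Gamma> by blast
  qed
  show ?thesis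
    using field formula p0 mean p1 p2 zero_case unfolding \<alpha>[symmetric] GG[symmetric] by blast
qed

end
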